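(* Let $\delta>0$, let $\theta_0\in\Theta^\delta$ be the true regression function with $k_0$ change-points, levels $a^0=(a_1^0,\dots,a_{k_0}^0)$ and locations $t^0=(t_0^0,\dots,t_{k_0}^0)$, and let the prior $\Pi$ on $\Theta^\delta$ satisfy assumption (A) (all defined in the context). Let $l_j=t_j^0-t_{j-1}^0$, $j=1,\dots,k_0$, be the true segment lengths, let $\Pi^n_{a|Z}$ denote the posterior distribution of the vector of segment levels $a=(a_1,\dots,a_{k_0})$ restricted to (i.e. conditional on) the event $\{k=k_0\}$, and let $I_0=\mathrm{diag}\big(1/(l_1n),\dots,1/(l_{k_0}n)\big)$. Let $\hat a(t^0)$ be the maximum likelihood estimator of $a$ based on $Z=(Z_1,\dots,Z_n)$ when the locations of the change-points are known to be the true ones $t^0$. Then $$E_{Z|\theta_0}\big\|\Pi^n_{a|Z}-N(\hat a(t^0),I_0)\big\|_{TV}\to0\quad\text{as }n\to\infty,$$ where $N(\mu,\Sigma)$ is the Gaussian distribution with mean $\mu$ and covariance matrix $\Sigma$, $\|P-Q\|_{TV}$ is the total variation distance between probability measures $P$ and $Q$, and $E_{Z|\theta_0}$ is expectation under $P_0^n$.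
   Context: Model space. Fix an integer $k_{max}\ge 1$, $K>0$ and $\delta>0$. For $k\ge1$ let $T_k^\delta$ be the set of tuples $t=(t_0,\dots,t_k)$ with $0=t_0<t_1<\dots<t_k=1$ and $\min_{1\le j\le k}|t_j-t_{j-1}|\ge\delta$ (identified with a subset of $\mathbb{R}^{k-1}$ through $(t_1,\dots,t_{k-1})$). A pair $(a,t)\in[-K,K]^k\times T_k^\delta$ is identified with the step function $\theta(x)=\sum_{j=1}^k a_j I(t_{j-1}\le x<t_j)$ on $[0,1)$. $\Theta_k^\delta$ is the set of such $\theta=(a,t)$ ("functions with $k$ change-points", i.e. $k$ segments), and $\Theta^\delta=\bigcup_{k=1}^{k_{max}}\Theta_k^\delta$; $k$ is regarded as part of the parameter. Data. One observes i.i.d. $Z_i=(X_i,Y_i)$, $i=1,\dots,n$, with $X_i$ uniform on $[0,1)$ and $Y_i=\theta_0(X_i)+\varepsilon_i$, where the $\varepsilon_i\sim N(0,1)$ are i.i.d. and independent of the $X_i$. The true function is $\theta_0=\sum_{j=1}^{k_0}a_j^0I(t_{j-1}^0\le x<t_j^0)\in\Theta_{k_0}^\delta\subset\Theta^\delta$, $k_0\le k_{max}$, with $a_j^0\ne a_{j-1}^0$ for $2\le j\le k_0$. $P_\theta$ is the law of one observation under $\theta$, with density $p_\theta$; $P_0=P_{\theta_0}$, and $P_0^n$ is the law of $(Z_1,\dots,Z_n)$ under $\theta_0$. Prior. $\Pi=\sum_{k=1}^{k_{max}}p(k)\Pi_k$ with $p(k)>0$, $\sum_kp(k)=1$, where $\Pi_k$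 is a probability measure on $\Theta_k^\delta$ with density $\pi_k(a,t)=\pi_k^a(a|t)\pi_k^t(t)$ with respect to Lebesgue measure. Assumption (A) (version for $\Theta^\delta$): for each $k$, the densities $\pi_k^a(a|t)$ and $\pi_k^t(t)$ are bounded away from zero and infinity on $[-K,K]^k$ and $T_k^\delta$ respectively. Posterior. $\Pi^n(A)=\int_A\prod_{i=1}^np_\theta(Z_i)\,d\Pi(\theta)\big/\int\prod_{i=1}^np_\theta(Z_i)\,d\Pi(\theta)$.
   Formalization: The formal theorem additionally assumes that all true levels satisfy |a_j^0| < K and that the prior density π_{k0}^a(a|t) is continuous at (a^0,t^0) relative to [-K,K]^{k0} × T_{k0}^δ; without these the claim is false. *)

theory Defs
  imports "HOL-Probability.Probability"
begin

section \<open>The change-point model\<close>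

text \<open>
  A vector in \<open>\<real>\<^sup>k\<close> is a function on \<open>{1..k}\<close>, extended by \<open>undefined\<close>. A tuple
  \<open>0 = t\<^sub>0 < \<dots> < t\<^sub>k = 1\<close> is represented by its free part \<open>s = (t\<^sub>1, \<dots>, t\<^bsub>k-1\<^esub>)\<close>, a function
  on \<open>{1..<k}\<close>; \<open>knot k s j\<close> recovers \<open>t\<^sub>j\<close>. A parameter is a triple \<open>(k, a, s)\<close>, so that the
  number of segments is part of it.
\<close>

type_synonym param = "nat \<times> (nat \<Rightarrow> real) \<times> (nat \<Rightarrow> real)"

type_synonym sample = "nat \<Rightarrow> real \<times> real"

definition knot :: "nat \<Rightarrow> (nat \<Rightarrow> real) \<Rightarrow> nat \<Rightarrow> real" where
  "knot k s j = (if j = 0 then 0 else if j = k then 1 else s j)"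

definition levels :: "real \<Rightarrow> nat \<Rightarrow> (nat \<Rightarrow> real) set" where
  "levels K k = (\<Pi>\<^sub>E j\<in>{1..k}. {-K..K})"

definition locations :: "real \<Rightarrow> nat \<Rightarrow> (nat \<Rightarrow> real) set" where
  "locations \<delta> k = {s \<in> extensional {1..<k}.
     (\<forall>j\<in>{1..k}. knot k s (j - 1) < knot k s j) \<and>
     (\<forall>j\<in>{1..k}. \<bar>knot k s j - knot k s (j - 1)\<bar> \<ge> \<delta>)}"

definition seg_length :: "nat \<Rightarrow> (nat \<Rightarrow> real) \<Rightarrow> nat \<Rightarrow> real" where
  "seg_length k s j = knot k s j - knot k s (j - 1)"

definition step_fun :: "param \<Rightarrow> real \<Rightarrow> real" where
  "step_fun = (\<lambda>(k, a, s) x. \<Sum>j\<in>{1..k}. a j * indicator {knot k s (j - 1)..<knot k s j} x)"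

definition obs_law :: "(real \<Rightarrow> real) \<Rightarrow> (real \<times> real) measure" where
  "obs_law f = distr (uniform_measure lborel {0..<1} \<Otimes>\<^sub>M density lborel (normal_density 0 1)) borel
     (\<lambda>(x, \<epsilon>). (x, f x + \<epsilon>))"

definition obs_density :: "(real \<Rightarrow> real) \<Rightarrow> real \<times> real \<Rightarrow> real" where
  "obs_density f = (\<lambda>(x, y). indicator {0..<1} x * normal_density (f x) 1 y)"

definition sample_law :: "nat \<Rightarrow> param \<Rightarrow> sample measure" where
  "sample_law n \<theta> = (\<Pi>\<^sub>M i\<in>{1..n}. obs_law (step_fun \<theta>))"

definition likelihood :: "nat \<Rightarrow> sample \<Rightarrow> param \<Rightarrow> real" where
  "likelihood n z \<theta> = (\<Prod>i\<in>{1..n}. obs_density (step_fun \<theta>) (z i))"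


section \<open>Prior and posterior\<close>

abbreviation lebesgue_pow :: "nat set \<Rightarrow> (nat \<Rightarrow> real) measure" where
  "lebesgue_pow J \<equiv> (\<Pi>\<^sub>M j\<in>J. lborel)"

definition param_space :: "param measure" where
  "param_space = count_space UNIV \<Otimes>\<^sub>M ((\<Pi>\<^sub>M j\<in>UNIV. borel) \<Otimes>\<^sub>M (\<Pi>\<^sub>M j\<in>UNIV. borel))"

text \<open>
  In the following \<open>\<pi>a k a s\<close> and \<open>\<pi>t k s\<close> stand for the densities \<open>\<pi>\<^sub>k\<^sup>a(a|t)\<close> and
  \<open>\<pi>\<^sub>k\<^sup>t(t)\<close>; only their values on \<open>levels K k\<close> and \<open>locations \<delta> k\<close> matter.
\<close>

definition prior_densities ::
  "real \<Rightarrow> real \<Rightarrow> nat \<Rightarrow> (nat \<Rightarrow> (nat \<Rightarrow> real) \<Rightarrow> (nat \<Rightarrow> real) \<Rightarrow> real) \<Rightarrow>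
    (nat \<Rightarrow> (nat \<Rightarrow> real) \<Rightarrow> real) \<Rightarrow> bool" where
  "prior_densities K \<delta> kmax \<pi>a \<pi>t \<longleftrightarrow> (\<forall>k\<in>{1..kmax}.
     (\<lambda>(a, s). \<pi>a k a s) \<in> borel_measurable (lebesgue_pow {1..k} \<Otimes>\<^sub>M lebesgue_pow {1..<k}) \<and>
     \<pi>t k \<in> borel_measurable (lebesgue_pow {1..<k}) \<and>
     (\<forall>s\<in>locations \<delta> k. 0 \<le> \<pi>t k s) \<and>
     (\<forall>a\<in>levels K k. \<forall>s\<in>locations \<delta> k. 0 \<le> \<pi>a k a s) \<and>
     (\<integral>\<^sup>+s\<in>locations \<delta> k. ennreal (\<pi>t k s) \<partial>lebesgue_pow {1..<k}) = 1 \<and>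
     (\<forall>s\<in>locations \<delta> k. (\<integral>\<^sup>+a\<in>levels K k. ennreal (\<pi>a k a s) \<partial>lebesgue_pow {1..k}) = 1))"

definition assumption_A ::
  "real \<Rightarrow> real \<Rightarrow> nat \<Rightarrow> (nat \<Rightarrow> (nat \<Rightarrow> real) \<Rightarrow> (nat \<Rightarrow> real) \<Rightarrow> real) \<Rightarrow>
    (nat \<Rightarrow> (nat \<Rightarrow> real) \<Rightarrow> real) \<Rightarrow> bool" where
  "assumption_A K \<delta> kmax \<pi>a \<pi>t \<longleftrightarrow> (\<forall>k\<in>{1..kmax}.
     (\<exists>c C. 0 < c \<and> (\<forall>a\<in>levels K k. \<forall>s\<in>locations \<delta> k. c \<le> \<pi>a k a s \<and> \<pi>a k a s \<le> C)) \<and>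
     (\<exists>c C. 0 < c \<and> (\<forall>s\<in>locations \<delta> k. c \<le> \<pi>t k s \<and> \<pi>t k s \<le> C)))"

definition prior_component ::
  "real \<Rightarrow> real \<Rightarrow> (nat \<Rightarrow> (nat \<Rightarrow> real) \<Rightarrow> (nat \<Rightarrow> real) \<Rightarrow> real) \<Rightarrow>
    (nat \<Rightarrow> (nat \<Rightarrow> real) \<Rightarrow> real) \<Rightarrow> nat \<Rightarrow> param measure" where
  "prior_component K \<delta> \<pi>a \<pi>t k = distr
     (density (lebesgue_pow {1..k} \<Otimes>\<^sub>M lebesgue_pow {1..<k})
       (\<lambda>(a, s). ennreal (\<pi>a k a s * \<pi>t k s) * indicator (levels K k \<times> locations \<delta> k) (a, s)))
     param_space (\<lambda>(a, s). (k, a, s))"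

definition prior ::
  "real \<Rightarrow> real \<Rightarrow> nat \<Rightarrow> (nat \<Rightarrow> real) \<Rightarrow> (nat \<Rightarrow> (nat \<Rightarrow> real) \<Rightarrow> (nat \<Rightarrow> real) \<Rightarrow> real) \<Rightarrow>
    (nat \<Rightarrow> (nat \<Rightarrow> real) \<Rightarrow> real) \<Rightarrow> param measure" where
  "prior K \<delta> kmax p \<pi>a \<pi>t = measure_of (space param_space) (sets param_space)
     (\<lambda>A. \<Sum>k\<in>{1..kmax}. ennreal (p k) * emeasure (prior_component K \<delta> \<pi>a \<pi>t k) A)"

definition posterior :: "param measure \<Rightarrow> nat \<Rightarrow> sample \<Rightarrow> param measure" where
  "posterior Q n z =
     density Q (\<lambda>\<theta>. ennreal (likelihood n z \<theta> / (\<integral>\<theta>'. likelihood n z \<theta>' \<partial>Q)))"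

text \<open>Law of the levels under the posterior conditioned on the event that there are \<open>k\<close> segments.\<close>

definition level_posterior :: "param measure \<Rightarrow> nat \<Rightarrow> nat \<Rightarrow> sample \<Rightarrow> (nat \<Rightarrow> real) measure" where
  "level_posterior Q k n z =
     distr (uniform_measure (posterior Q n z) {\<theta> \<in> space param_space. fst \<theta> = k})
       (\<Pi>\<^sub>M j\<in>{1..k}. borel) (\<lambda>(_, a, _). restrict a {1..k})"


section \<open>The limiting Gaussian and total variation\<close>

text \<open>Maximisation is over all of \<open>\<real>\<^sup>k\<close>, at the known locations \<open>s\<close>.\<close>

definition is_level_mle :: "nat \<Rightarrow> (nat \<Rightarrow> real) \<Rightarrow> nat \<Rightarrow> sample \<Rightarrow> (nat \<Rightarrow> real) \<Rightarrow> bool" where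
  "is_level_mle k s n z = is_arg_max (\<lambda>a. likelihood n z (k, a, s)) (\<lambda>a. a \<in> extensional {1..k})"

text \<open>The Gaussian on \<open>\<real>\<^sup>k\<close> with mean \<open>\<mu>\<close> and covariance \<open>diag(v\<^sub>1, \<dots>, v\<^sub>k)\<close>.\<close>

definition diag_gaussian :: "nat \<Rightarrow> (nat \<Rightarrow> real) \<Rightarrow> (nat \<Rightarrow> real) \<Rightarrow> (nat \<Rightarrow> real) measure" where
  "diag_gaussian k \<mu> v = (\<Pi>\<^sub>M j\<in>{1..k}. density lborel (normal_density (\<mu> j) (sqrt (v j))))"

definition tv_dist :: "'a measure \<Rightarrow> 'a measure \<Rightarrow> real" where
  "tv_dist P Q = (SUP A\<in>sets P. \<bar>measure P A - measure Q A\<bar>)"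


section \<open>Well-definedness\<close>

lemma space_param_space [simp]: "space param_space = UNIV"
  by (simp add: param_space_def space_pair_measure space_PiM)

lemma sets_prior [simp, measurable_cong]: "sets (prior K \<delta> kmax p \<pi>a \<pi>t) = sets param_space"
  unfolding prior_def
  by (simp add: sets.space_closed sets.sigma_sets_eq del: space_param_space)

lemma emeasure_prior:
  assumes "A \<in> sets param_space"
  shows "emeasure (prior K \<delta> kmax p \<pi>a \<pi>t) A =
    (\<Sum>k\<in>{1..kmax}. ennreal (p k) * emeasure (prior_component K \<delta> \<pi>a \<pi>t k) A)"
proof -
  let ?\<mu> = "\<lambda>A. \<Sum>k\<in>{1..kmax}. ennreal (p k) * emeasure (prior_component K \<delta> \<pi>a \<pi>t k) A"
  have "countably_additive (sets param_space) ?\<mu>"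
  proof (rule countably_additiveI)
    fix A :: "nat \<Rightarrow> param set"
    assume A: "range A \<subseteq> sets param_space" "disjoint_family A"
    have eq: "(\<Sum>i. emeasure (prior_component K \<delta> \<pi>a \<pi>t k) (A i))
        = emeasure (prior_component K \<delta> \<pi>a \<pi>t k) (\<Union>i. A i)" for k
      by (rule suminf_emeasure) (use A in \<open>auto simp: prior_component_def\<close>)
    have "(\<Sum>i. ?\<mu> (A i)) =
        (\<Sum>k\<in>{1..kmax}. \<Sum>i. ennreal (p k) * emeasure (prior_component K \<delta> \<pi>a \<pi>t k) (A i))"
      by (rule suminf_sum) auto
    then show "(\<Sum>i. ?\<mu> (A i)) = ?\<mu> (\<Union>i. A i)"
      by (simp add: ennreal_suminf_cmult eq)
  qed
  moreover have "positive (sets param_space) ?\<mu>"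
    by (simp add: positive_def)
  ultimately show ?thesis
    using assms unfolding prior_def
    by (intro emeasure_measure_of_sigma) (auto simp del: space_param_space intro: sets.sigma_algebra_axioms)
qed

lemma measurable_tag_segments [measurable]:
  "(\<lambda>(a, s). (k, a, s)) \<in>
    lebesgue_pow {1..k} \<Otimes>\<^sub>M lebesgue_pow {1..<k} \<rightarrow>\<^sub>M param_space"
proof -
  have *: "(\<lambda>a. a) \<in> lebesgue_pow J \<rightarrow>\<^sub>M (\<Pi>\<^sub>M j\<in>UNIV. borel)" for J
  proof (rule measurable_PiM_single')
    fix j
    show "(\<lambda>a. a j) \<in> borel_measurable (lebesgue_pow J)"
    proof (cases "j \<in> J")
      case True
      then show ?thesis
        using measurable_component_singleton[OF True, of "\<lambda>_. lborel :: real measure"] by simp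
    next
      case False
      have "a j = undefined" if "a \<in> space (lebesgue_pow J)" for a
        using that False by (auto simp: space_PiM PiE_def extensional_def)
      then show ?thesis
        by (subst measurable_cong[where g = "\<lambda>_. undefined"]) auto
    qed
  qed auto
  have [measurable]:
    "fst \<in> lebesgue_pow {1..k} \<Otimes>\<^sub>M lebesgue_pow {1..<k} \<rightarrow>\<^sub>M (\<Pi>\<^sub>M j\<in>UNIV. borel)"
    "snd \<in> lebesgue_pow {1..k} \<Otimes>\<^sub>M lebesgue_pow {1..<k} \<rightarrow>\<^sub>M (\<Pi>\<^sub>M j\<in>UNIV. borel)"
    by (rule measurable_compose[OF measurable_fst *], rule measurable_compose[OF measurable_snd *])
  show ?thesis
    unfolding param_space_def split_beta by measurable
qed

lemma sets_levels [measurable]: "levels K k \<in> sets (lebesgue_pow {1..k})"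
  unfolding levels_def by (rule sets_PiM_I_finite) auto

lemma sets_locations [measurable]: "locations \<delta> k \<in> sets (lebesgue_pow {1..<k})"
proof -
  have knot: "(\<lambda>s. knot k s j) \<in> borel_measurable (lebesgue_pow {1..<k})" if "j \<le> k" for j
    using that measurable_component_singleton[of j "{1..<k}" "\<lambda>_. lborel :: real measure"]
    by (cases "j = 0"; cases "j = k") (auto simp: knot_def[abs_def])
  have "locations \<delta> k = {s \<in> space (lebesgue_pow {1..<k}).
     (\<forall>j\<in>{1..k}. knot k s (j - 1) < knot k s j) \<and>
     (\<forall>j\<in>{1..k}. \<delta> \<le> \<bar>knot k s j - knot k s (j - 1)\<bar>)}"
    by (auto simp: locations_def space_PiM PiE_def)
  also have "\<dots> \<in> sets (lebesgue_pow {1..<k})"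
  proof (intro sets.sets_Collect_conj sets.sets_Collect_finite_All)
    fix j assume "j \<in> {1..k}"
    then have [measurable]: "(\<lambda>s. knot k s j) \<in> borel_measurable (lebesgue_pow {1..<k})"
      "(\<lambda>s. knot k s (j - 1)) \<in> borel_measurable (lebesgue_pow {1..<k})"
      using knot by auto
    show "{s \<in> space (lebesgue_pow {1..<k}). knot k s (j - 1) < knot k s j}
        \<in> sets (lebesgue_pow {1..<k})"
      "{s \<in> space (lebesgue_pow {1..<k}). \<delta> \<le> \<bar>knot k s j - knot k s (j - 1)\<bar>}
        \<in> sets (lebesgue_pow {1..<k})"
      by measurable
  qed auto
  finally show ?thesis .
qed

lemma prob_space_prior_component:
  assumes "prior_densities K \<delta> kmax \<pi>a \<pi>t" and k: "k \<in> {1..kmax}"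
  shows "prob_space (prior_component K \<delta> \<pi>a \<pi>t k)"
proof -
  let ?A = "lebesgue_pow {1..k}" and ?S = "lebesgue_pow {1..<k}"
  have [measurable]: "(\<lambda>(a, s). \<pi>a k a s) \<in> borel_measurable (?A \<Otimes>\<^sub>M ?S)"
      "\<pi>t k \<in> borel_measurable ?S"
    and nn: "\<And>s. s \<in> locations \<delta> k \<Longrightarrow> 0 \<le> \<pi>t k s"
      "\<And>a s. a \<in> levels K k \<Longrightarrow> s \<in> locations \<delta> k \<Longrightarrow> 0 \<le> \<pi>a k a s"
    and t1: "(\<integral>\<^sup>+s\<in>locations \<delta> k. ennreal (\<pi>t k s) \<partial>?S) = 1"
    and a1: "\<And>s. s \<in> locations \<delta> k \<Longrightarrow>
      (\<integral>\<^sup>+a\<in>levels K k. ennreal (\<pi>a k a s) \<partial>?A) = 1"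
    using assms unfolding prior_densities_def by blast+
  interpret L: product_sigma_finite "\<lambda>_::nat. lborel :: real measure" ..
  interpret AS: pair_sigma_finite ?A ?S
    by (intro pair_sigma_finite.intro L.sigma_finite) auto
  let ?d = "\<lambda>(a, s). ennreal (\<pi>a k a s * \<pi>t k s) * indicator (levels K k \<times> locations \<delta> k) (a, s)"
  have d[measurable]: "?d \<in> borel_measurable (?A \<Otimes>\<^sub>M ?S)"
    unfolding split_beta by measurable
  have "(\<integral>\<^sup>+x. ?d x \<partial>(?A \<Otimes>\<^sub>M ?S)) = (\<integral>\<^sup>+s. \<integral>\<^sup>+a. ?d (a, s) \<partial>?A \<partial>?S)"
    by (rule AS.nn_integral_snd[symmetric, OF d])
  also have "\<dots> = (\<integral>\<^sup>+s\<in>locations \<delta> k. ennreal (\<pi>t k s) \<partial>?S)"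
  proof (rule nn_integral_cong)
    fix s assume s: "s \<in> space ?S"
    have pa: "(\<lambda>a. \<pi>a k a s) \<in> borel_measurable ?A"
      using measurable_compose[OF measurable_Pair2'[OF s]
        \<open>(\<lambda>(a, s). \<pi>a k a s) \<in> borel_measurable (?A \<Otimes>\<^sub>M ?S)\<close>] by simp
    show "(\<integral>\<^sup>+a. ?d (a, s) \<partial>?A) = ennreal (\<pi>t k s) * indicator (locations \<delta> k) s"
    proof (cases "s \<in> locations \<delta> k")
      case True
      have "(\<integral>\<^sup>+a. ?d (a, s) \<partial>?A) =
          (\<integral>\<^sup>+a. ennreal (\<pi>t k s) * (ennreal (\<pi>a k a s) * indicator (levels K k) a) \<partial>?A)"
        using True nn by (intro nn_integral_cong) (auto simp: indicator_def ennreal_mult mult.commute)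
      also have "\<dots> = ennreal (\<pi>t k s) * (\<integral>\<^sup>+a\<in>levels K k. ennreal (\<pi>a k a s) \<partial>?A)"
        by (intro nn_integral_cmult borel_measurable_times_ennreal borel_measurable_indicator
            sets_levels measurable_compose[OF pa measurable_ennreal])
      also have "\<dots> = ennreal (\<pi>t k s)"
        by (simp only: a1[OF True] mult_1_right)
      finally show ?thesis using True by simp
    qed (simp add: indicator_def)
  qed
  finally have "(\<integral>\<^sup>+x. ?d x \<partial>(?A \<Otimes>\<^sub>M ?S)) = 1"
    using t1 by simp
  moreover have "emeasure (density (?A \<Otimes>\<^sub>M ?S) ?d) (space (?A \<Otimes>\<^sub>M ?S)) =
      (\<integral>\<^sup>+x. ?d x \<partial>(?A \<Otimes>\<^sub>M ?S))"
    by (subst emeasure_density[OF d sets.top]) (auto intro!: nn_integral_cong simp: indicator_def)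
  ultimately have "prob_space (density (?A \<Otimes>\<^sub>M ?S) ?d)"
    by (intro prob_spaceI) (simp only: space_density)
  then show ?thesis
    unfolding prior_component_def
    by (rule prob_space.prob_space_distr) (use measurable_tag_segments in \<open>simp only: measurable_density_eq1\<close>)
qed

lemma prob_space_prior:
  assumes "prior_densities K \<delta> kmax \<pi>a \<pi>t"
    and p: "\<And>k. k \<in> {1..kmax} \<Longrightarrow> 0 < p k" "(\<Sum>k\<in>{1..kmax}. p k) = 1"
  shows "prob_space (prior K \<delta> kmax p \<pi>a \<pi>t)"
proof (rule prob_spaceI)
  have "space (prior K \<delta> kmax p \<pi>a \<pi>t) = UNIV"
    using sets_eq_imp_space_eq[OF sets_prior] by simp
  moreover have "UNIV \<in> sets param_space"
    using sets.top[of param_space] by simp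
  moreover have "emeasure (prior_component K \<delta> \<pi>a \<pi>t k) UNIV = 1" if "k \<in> {1..kmax}" for k
    using prob_space.emeasure_space_1[OF prob_space_prior_component[OF assms(1) that]]
    by (simp add: prior_component_def)
  ultimately have "emeasure (prior K \<delta> kmax p \<pi>a \<pi>t) (space (prior K \<delta> kmax p \<pi>a \<pi>t)) =
      (\<Sum>k\<in>{1..kmax}. ennreal (p k))"
    by (simp add: emeasure_prior)
  also have "\<dots> = 1"
    using p by (subst sum_ennreal) (auto simp: less_imp_le)
  finally show "emeasure (prior K \<delta> kmax p \<pi>a \<pi>t) (space (prior K \<delta> kmax p \<pi>a \<pi>t)) = 1" .
qed

lemma borel_measurable_knot [measurable]:
  "(\<lambda>s. knot k s j) \<in> borel_measurable (\<Pi>\<^sub>M j\<in>UNIV. borel)"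
  unfolding knot_def by measurable

lemma borel_measurable_step_fun_arg [measurable]:
  "step_fun \<theta> \<in> borel_measurable borel"
proof (cases \<theta>)
  case (fields k a s)
  show ?thesis
    unfolding fields step_fun_def prod.case by measurable
qed

lemma borel_measurable_step_fun [measurable]:
  "(\<lambda>\<theta>. step_fun \<theta> x) \<in> borel_measurable param_space"
  unfolding param_space_def
proof (rule measurable_pair_measure_countable1)
  fix k :: nat
  let ?M = "(\<Pi>\<^sub>M j\<in>UNIV. borel) \<Otimes>\<^sub>M (\<Pi>\<^sub>M j\<in>UNIV. borel) :: ((nat \<Rightarrow> real) \<times> (nat \<Rightarrow> real)) measure"
  have [measurable]: "(\<lambda>y. fst y j) \<in> borel_measurable ?M" for j
    by (rule measurable_compose[OF measurable_fst measurable_component_singleton]) simp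
  have [measurable]: "(\<lambda>y. knot k (snd y) j) \<in> borel_measurable ?M" for j
    by (rule measurable_compose[OF measurable_snd borel_measurable_knot])
  have "(\<lambda>y. \<Sum>j\<in>{1..k}. fst y j *
      (if knot k (snd y) (j - 1) \<le> x \<and> x < knot k (snd y) j then 1 else 0)) \<in> borel_measurable ?M"
    by measurable
  then show "(\<lambda>y. step_fun (k, y) x) \<in> borel_measurable ?M"
    by (simp add: step_fun_def indicator_def split_beta of_bool_def)
qed simp

lemma borel_measurable_likelihood [measurable]: "likelihood n z \<in> borel_measurable param_space"
  unfolding likelihood_def obs_density_def split_beta normal_density_def by measurable

lemma emeasure_posterior:
  assumes "A \<in> sets param_space"
  shows "emeasure (posterior (prior K \<delta> kmax p \<pi>a \<pi>t) n z) A =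
    (\<integral>\<^sup>+\<theta>\<in>A. ennreal (likelihood n z \<theta> / (\<integral>\<theta>'. likelihood n z \<theta>' \<partial>prior K \<delta> kmax p \<pi>a \<pi>t))
       \<partial>prior K \<delta> kmax p \<pi>a \<pi>t)"
  unfolding posterior_def using assms by (subst emeasure_density) auto

lemma obs_law_eq_density:
  assumes [measurable]: "f \<in> borel_measurable borel"
  shows "obs_law f = density lborel (\<lambda>z. ennreal (obs_density f z))"
proof (rule measure_eqI)
  show "sets (obs_law f) = sets (density lborel (\<lambda>z. ennreal (obs_density f z)))"
    by (simp add: obs_law_def)
next
  fix A assume "A \<in> sets (obs_law f)"
  then have A[measurable]: "A \<in> sets borel" by (simp add: obs_law_def)
  have A2[measurable]: "A \<in> sets (borel \<Otimes>\<^sub>M borel)" using A unfolding borel_prod .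
  interpret N: prob_space "density lborel (normal_density 0 1)"
    by (rule prob_space_normal_density) simp
  have [measurable]: "(\<lambda>(x, \<epsilon>). (x, f x + \<epsilon>)) \<in>
      (uniform_measure lborel {0..<1::real} \<Otimes>\<^sub>M density lborel (normal_density 0 1)) \<rightarrow>\<^sub>M borel"
    unfolding borel_prod[symmetric] by measurable
  have [measurable]: "(\<lambda>z. obs_density f z) \<in> borel_measurable borel"
    unfolding borel_prod[symmetric] obs_density_def normal_density_def split_beta by measurable
  have shift: "(\<integral>\<^sup>+\<epsilon>. ennreal (normal_density 0 1 \<epsilon>) * indicator A (x, f x + \<epsilon>) \<partial>lborel) =
      (\<integral>\<^sup>+y. ennreal (normal_density (f x) 1 y) * indicator A (x, y) \<partial>lborel)" for x
  proof -
    have "(\<integral>\<^sup>+y. ennreal (normal_density (f x) 1 y) * indicator A (x, y) \<partial>lborel) =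
      (\<integral>\<^sup>+y. ennreal (normal_density (f x) 1 y) * indicator A (x, y) \<partial>distr lborel borel ((+) (f x)))"
      by (simp add: lborel_distr_plus)
    also have "\<dots> = (\<integral>\<^sup>+\<epsilon>. ennreal (normal_density (f x) 1 (f x + \<epsilon>)) * indicator A (x, f x + \<epsilon>) \<partial>lborel)"
      by (subst nn_integral_distr) auto
    finally show ?thesis by (simp add: normal_density_def)
  qed
  have "emeasure (obs_law f) A =
      (\<integral>\<^sup>+w. indicator A (case w of (x, \<epsilon>) \<Rightarrow> (x, f x + \<epsilon>))
         \<partial>(uniform_measure lborel {0..<1::real} \<Otimes>\<^sub>M density lborel (normal_density 0 1)))"
  proof -
    let ?N = "uniform_measure lborel {0..<1::real} \<Otimes>\<^sub>M density lborel (normal_density 0 1)"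
    let ?T = "\<lambda>(x, \<epsilon>). (x, f x + \<epsilon>)"
    have "emeasure (distr ?N borel ?T) A = (\<integral>\<^sup>+z. indicator A z \<partial>distr ?N borel ?T)"
      by (subst nn_integral_indicator) simp_all
    also have "\<dots> = (\<integral>\<^sup>+w. indicator A (?T w) \<partial>?N)"
      by (rule nn_integral_distr) measurable
    finally show ?thesis by (simp add: obs_law_def)
  qed
  also have "\<dots> = (\<integral>\<^sup>+x. \<integral>\<^sup>+\<epsilon>. indicator A (x, f x + \<epsilon>)
      \<partial>density lborel (normal_density 0 1) \<partial>uniform_measure lborel {0..<1::real})"
    by (subst N.nn_integral_fst[symmetric]) auto
  also have "\<dots> = (\<integral>\<^sup>+x. \<integral>\<^sup>+\<epsilon>. ennreal (normal_density 0 1 \<epsilon>) * indicator A (x, f x + \<epsilon>) \<partial>lborel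
      \<partial>uniform_measure lborel {0..<1::real})"
    by (intro nn_integral_cong, subst nn_integral_density) auto
  also have "\<dots> = (\<integral>\<^sup>+x. (\<integral>\<^sup>+y. ennreal (normal_density (f x) 1 y) * indicator A (x, y) \<partial>lborel) * indicator {0..<1::real} x
      \<partial>lborel)"
    unfolding shift by (subst nn_integral_uniform_measure) (auto simp: normal_density_def divide_ennreal_def)
  also have "\<dots> = (\<integral>\<^sup>+x. \<integral>\<^sup>+y. ennreal (obs_density f (x, y)) * indicator A (x, y) \<partial>lborel \<partial>lborel)"
    by (intro nn_integral_cong) (auto simp: obs_density_def indicator_def)
  also have "\<dots> = (\<integral>\<^sup>+z. ennreal (obs_density f z) * indicator A z \<partial>(lborel \<Otimes>\<^sub>M lborel))"
    by (rule lborel.nn_integral_fst) (simp add: lborel_prod)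
  also have "\<dots> = emeasure (density lborel (\<lambda>z. ennreal (obs_density f z))) A"
    unfolding lborel_prod by (subst emeasure_density) auto
  finally show "emeasure (obs_law f) A = emeasure (density lborel (\<lambda>z. ennreal (obs_density f z))) A" .
qed

end

theory Submission
  imports Defs
begin

text \<open>
  Conditioning on the number of segments removes all other components of the prior, so only
  parameters \<open>(a, s)\<close> with the true number \<open>k\<close> of segments matter. Finitely many statistics of
  the sample, all sums of the noise over intervals attached to the true knots, define a good
  event whose probability is close to 1 uniformly in \<open>n\<close>, and under the law of a parameter
  \<open>(a, s)\<close> the good event has probability at most
  \<open>C exp (- c n (\<Sum>\<^sub>j |s\<^sub>j - s0\<^sub>j| + \<Sum>\<^sub>j (a\<^sub>j - a0\<^sub>j)\<^sup>2))\<close>, because a shifted level or knot creates a drift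
  in one of these sums. By Fubini, the expected likelihood mass outside
  \<open>|a - a0| \<le> M / sqrt n, |s - s0| \<le> M / n\<close> is then a small multiple of \<open>n\<^bsup>-(k-1)-k/2\<^esup>\<close>, while on the
  good event the total mass is at least a fixed multiple of it. Inside that neighbourhood only
  boundedly many observations change segment, so the likelihood at \<open>(a, s)\<close> factorises up to
  \<open>1 + o(1)\<close> into the Gaussian density in \<open>a\<close> and a function of \<open>s\<close>; integrating out \<open>s\<close>
  leaves the Gaussian.
\<close>

section \<open>Chernoff bounds for sums over intervals\<close>

text \<open>The likelihood jumps as a knot passes an observation, so no smooth expansion in
  \<open>s\<close> is available: knots localise at rate \<open>1 / n\<close>, and their posterior
  keeps a random shape. That shape never has to be identified. It enters numerator and denominator
  of the level posterior as the same factor and cancels, once the interaction between a level shift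
  of order \<open>1 / sqrt n\<close> and a knot shift of order \<open>1 / n\<close> is known to be
  small. The tail is controlled in expectation because the lower bound for the total mass is a
  multiple of the likelihood at the truth: dividing by it under the true law turns the likelihood at
  \<open>(a, s)\<close>, integrated over the good event, into a probability under
  \<open>(a, s)\<close>. One event thus serves both as a test and as the place where the local
  approximation holds. The constants are coupled: the power of the tests and the lower bound depend
  on \<open>T\<close> and \<open>R\<close>, the radius \<open>M\<close> is taken large enough to
  beat both, the noise bound \<open>T'\<close> in the larger neighbourhood depends on
  \<open>M\<close>, and only after that does \<open>n\<close> grow.\<close>

lemma PiM_density:
  assumes "finite I" and M: "product_sigma_finite M" "product_sigma_finite (\<lambda>i. density (M i) (f i))"
    and f: "\<And>i. i \<in> I \<Longrightarrow> f i \<in> borel_measurable (M i)"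
  shows "PiM I (\<lambda>i. density (M i) (f i)) = density (PiM I M) (\<lambda>x. \<Prod>i\<in>I. f i (x i))"
proof -
  interpret M: product_sigma_finite M by fact
  interpret D: product_sigma_finite "\<lambda>i. density (M i) (f i)" by fact
  have [measurable]: "(\<lambda>x. f i (x i)) \<in> borel_measurable (PiM I M)" if "i \<in> I" for i
    by (rule measurable_compose[OF measurable_component_singleton[OF that, where M = M] f[OF that]])
  have d[measurable]: "(\<lambda>x. \<Prod>i\<in>I. f i (x i)) \<in> borel_measurable (PiM I M)"
    by measurable
  show ?thesis
  proof (rule D.PiM_eqI[symmetric])
    show "sets (density (PiM I M) (\<lambda>x. \<Prod>i\<in>I. f i (x i))) = sets (Pi\<^sub>M I (\<lambda>i. density (M i) (f i)))"
      by (simp cong: sets_PiM_cong)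
    fix A assume "\<And>i. i \<in> I \<Longrightarrow> A i \<in> sets (density (M i) (f i))"
    then have A: "\<And>i. i \<in> I \<Longrightarrow> A i \<in> sets (M i)" by simp
    have PA: "Pi\<^sub>E I A \<in> sets (PiM I M)" using A \<open>finite I\<close> by (intro sets_PiM_I_finite) auto
    have "emeasure (density (PiM I M) (\<lambda>x. \<Prod>i\<in>I. f i (x i))) (Pi\<^sub>E I A) =
        (\<integral>\<^sup>+x. (\<Prod>i\<in>I. f i (x i)) * indicator (Pi\<^sub>E I A) x \<partial>PiM I M)"
      using PA by (subst emeasure_density) auto
    also have "\<dots> = (\<integral>\<^sup>+x. (\<Prod>i\<in>I. f i (x i) * indicator (A i) (x i)) \<partial>PiM I M)"
    proof (rule nn_integral_cong)
      fix x assume x: "x \<in> space (PiM I M)"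
      have "indicator (Pi\<^sub>E I A) x = (\<Prod>i\<in>I. indicator (A i) (x i) :: ennreal)"
        using x \<open>finite I\<close> by (auto simp: indicator_def PiE_iff space_PiM prod_eq_1_iff intro!: prod_zero[symmetric])
      then show "(\<Prod>i\<in>I. f i (x i)) * indicator (Pi\<^sub>E I A) x = (\<Prod>i\<in>I. f i (x i) * indicator (A i) (x i))"
        by (simp add: prod.distrib)
    qed
    also have "\<dots> = (\<Prod>i\<in>I. \<integral>\<^sup>+x. f i x * indicator (A i) x \<partial>M i)"
      using A f \<open>finite I\<close> by (intro M.product_nn_integral_prod) auto
    also have "\<dots> = (\<Prod>i\<in>I. emeasure (density (M i) (f i)) (A i))"
      using A f by (intro prod.cong) (auto simp: emeasure_density)
    finally show "emeasure (density (PiM I M) (\<lambda>x. \<Prod>i\<in>I. f i (x i))) (Pi\<^sub>E I A) =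
      (\<Prod>i\<in>I. emeasure (density (M i) (f i)) (A i))" .
  qed fact
qed

section \<open>The law of the sample under an arbitrary regression function\<close>

abbreviation sample_space :: "nat \<Rightarrow> sample measure" where
  "sample_space n \<equiv> (\<Pi>\<^sub>M i\<in>{1..n}. borel)"

abbreviation product_law :: "nat \<Rightarrow> (real \<Rightarrow> real) \<Rightarrow> sample measure" where
  "product_law n f \<equiv> (\<Pi>\<^sub>M i\<in>{1..n}. obs_law f)"

lemma sets_obs_law [simp, measurable_cong]: "sets (obs_law f) = sets borel"
  by (simp add: obs_law_def)

lemma space_obs_law [simp]: "space (obs_law f) = UNIV"
  by (simp add: obs_law_def)

lemma sets_product_law [measurable_cong]: "sets (product_law n f) = sets (sample_space n)"
  by (intro sets_PiM_cong) auto

lemma space_product_law: "space (product_law n f) = space (sample_space n)"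
  by (intro sets_eq_imp_space_eq sets_product_law)

lemma measurable_obs_fst: "fst \<in> borel_measurable (borel :: (real \<times> real) measure)"
  and measurable_obs_snd: "snd \<in> borel_measurable (borel :: (real \<times> real) measure)"
  by (simp_all add: borel_prod[symmetric])

lemma measurable_sample [measurable]:
  assumes "i \<in> {1..n}"
  shows "(\<lambda>z. fst (z i)) \<in> borel_measurable (sample_space n)"
    "(\<lambda>z. snd (z i)) \<in> borel_measurable (sample_space n)"
  using measurable_compose[OF measurable_component_singleton[OF assms] measurable_obs_fst]
    measurable_compose[OF measurable_component_singleton[OF assms] measurable_obs_snd] by auto

lemma borel_measurable_obs_density [measurable]:
  assumes [measurable]: "f \<in> borel_measurable borel"
  shows "obs_density f \<in> borel_measurable borel"
  unfolding borel_prod[symmetric] obs_density_def normal_density_def split_beta by measurable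

lemma prob_space_obs_law:
  assumes [measurable]: "f \<in> borel_measurable borel"
  shows "prob_space (obs_law f)"
proof -
  interpret N: prob_space "density lborel (normal_density 0 1)"
    by (rule prob_space_normal_density) simp
  interpret U: prob_space "uniform_measure lborel {0..<1::real}"
    by (rule prob_space_uniform_measure) auto
  interpret P: pair_prob_space "uniform_measure lborel {0..<1::real}" "density lborel (normal_density 0 1)" ..
  have [measurable]: "(\<lambda>(x, \<epsilon>). (x, f x + \<epsilon>)) \<in>
      (uniform_measure lborel {0..<1::real} \<Otimes>\<^sub>M density lborel (normal_density 0 1)) \<rightarrow>\<^sub>M borel"
    unfolding borel_prod[symmetric] by measurable
  show ?thesis
    unfolding obs_law_def by (rule P.prob_space_distr) measurable
qed

lemma product_sigma_finite_obs_law: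
  assumes "f \<in> borel_measurable borel"
  shows "product_sigma_finite (\<lambda>_::nat. obs_law f)"
  using prob_space_obs_law[OF assms]
  by (auto simp: product_sigma_finite_def prob_space_def finite_measure_def)

lemma prob_space_product_law:
  assumes "f \<in> borel_measurable borel"
  shows "prob_space (product_law n f)"
  using prob_space_obs_law[OF assms] by (intro prob_space_PiM)

lemma product_law_eq_density:
  assumes [measurable]: "f \<in> borel_measurable borel"
  shows "product_law n f =
    density (\<Pi>\<^sub>M i\<in>{1..n}. lborel) (\<lambda>z. ennreal (\<Prod>i\<in>{1..n}. obs_density f (z i)))"
proof -
  have eq: "obs_law f = density lborel (\<lambda>z. ennreal (obs_density f z))"
    by (rule obs_law_eq_density) fact
  have nn: "0 \<le> obs_density f z" for z
    by (auto simp: obs_density_def split: prod.split)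
  show ?thesis
    unfolding eq
    by (subst PiM_density)
      (use product_sigma_finite_obs_law[OF assms] in
       \<open>auto simp: eq[symmetric] prod_ennreal nn product_sigma_finite_def intro: sigma_finite_lborel\<close>)
qed

lemma nn_integral_obs_law:
  assumes [measurable]: "f \<in> borel_measurable borel" "h \<in> borel_measurable (borel :: (real \<times> real) measure)"
  shows "(\<integral>\<^sup>+z. h z \<partial>obs_law f) =
    (\<integral>\<^sup>+x. (\<integral>\<^sup>+e. h (x, f x + e) \<partial>density lborel std_normal_density) * indicator {0..<1} x \<partial>lborel)"
proof -
  interpret N: prob_space "density lborel (normal_density 0 1)"
    by (rule prob_space_normal_density) simp
  let ?U = "uniform_measure lborel {0..<1::real}"
  have [measurable]: "(\<lambda>(x, \<epsilon>). (x, f x + \<epsilon>)) \<in>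
      (?U \<Otimes>\<^sub>M density lborel (normal_density 0 1)) \<rightarrow>\<^sub>M borel"
    unfolding borel_prod[symmetric] by measurable
  have [measurable]: "(\<lambda>(x, \<epsilon>). (x, f x + \<epsilon>)) \<in> (borel \<Otimes>\<^sub>M borel) \<rightarrow>\<^sub>M (borel :: (real \<times> real) measure)"
    unfolding borel_prod[symmetric] by measurable
  have m: "(\<lambda>(x, e). h (x, f x + e)) \<in> borel_measurable (borel \<Otimes>\<^sub>M borel)"
    using measurable_compose[OF \<open>(\<lambda>(x, \<epsilon>). (x, f x + \<epsilon>)) \<in> (borel \<Otimes>\<^sub>M borel) \<rightarrow>\<^sub>M borel\<close> assms(2)]
    by (simp add: split_beta)
  have "(\<integral>\<^sup>+z. h z \<partial>obs_law f) =
      (\<integral>\<^sup>+w. h (case w of (x, e) \<Rightarrow> (x, f x + e)) \<partial>(?U \<Otimes>\<^sub>M density lborel (normal_density 0 1)))"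
    unfolding obs_law_def by (subst nn_integral_distr) simp_all
  also have "\<dots> = (\<integral>\<^sup>+w. (case w of (x, e) \<Rightarrow> h (x, f x + e)) \<partial>(?U \<Otimes>\<^sub>M density lborel (normal_density 0 1)))"
    by (simp add: split_beta)
  also have "\<dots> = (\<integral>\<^sup>+x. \<integral>\<^sup>+e. h (x, f x + e) \<partial>density lborel (normal_density 0 1) \<partial>?U)"
    using m by (subst N.nn_integral_fst[symmetric]) (auto cong: measurable_cong_sets sets_pair_measure_cong)
  also have "\<dots> = (\<integral>\<^sup>+x. (\<integral>\<^sup>+e. h (x, f x + e) \<partial>density lborel (normal_density 0 1)) * indicator {0..<1} x \<partial>lborel)"
  proof (subst nn_integral_uniform_measure)
    have "(\<lambda>x. \<integral>\<^sup>+e. (case (x, e) of (x, e) \<Rightarrow> h (x, f x + e)) \<partial>density lborel (normal_density 0 1)) \<in> borel_measurable borel"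
      by (rule N.borel_measurable_nn_integral_fst) (use m in \<open>simp cong: measurable_cong_sets sets_pair_measure_cong\<close>)
    then show "(\<lambda>x. \<integral>\<^sup>+e. h (x, f x + e) \<partial>density lborel (normal_density 0 1)) \<in> borel_measurable lborel"
      by simp
  qed (auto simp: divide_ennreal_def)
  finally show ?thesis .
qed

text \<open>Off \<open>I\<close> the exponent is 0; on \<open>I\<close> the residual against
  \<open>f0\<close> is the noise plus \<open>\<Delta>\<close>, with exponential moment at most
  \<open>C\<close>. A uniform design point thus gives at most \<open>1 + |I| (C - 1)\<close>, which
  is below the exponential.\<close>

lemma nn_integral_obs_law_exp_le:
  assumes [measurable]: "f \<in> borel_measurable borel" "f0 \<in> borel_measurable borel" "g \<in> borel_measurable borel"
    and I[measurable]: "I \<in> sets borel" and sub: "I \<subseteq> {0..<1}"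
    and \<Delta>: "\<And>x. x \<in> I \<Longrightarrow> f x = f0 x + \<Delta>"
    and C: "(\<integral>\<^sup>+e. ennreal (exp (g (e + \<Delta>))) \<partial>density lborel std_normal_density) \<le> ennreal C" and "0 \<le> C"
  shows "(\<integral>\<^sup>+z. ennreal (exp (indicator I (fst z) * g (snd z - f0 (fst z)))) \<partial>obs_law f)
    \<le> ennreal (exp (measure lborel I * (C - 1)))"
proof -
  interpret N: prob_space "density lborel (normal_density 0 1)"
    by (rule prob_space_normal_density) simp
  have fin: "emeasure lborel I \<le> 1"
    using emeasure_mono[OF sub, of lborel] by simp
  then have fin': "emeasure lborel I = ennreal (measure lborel I)"
    by (metis emeasure_eq_ennreal_measure ennreal_one_less_top leD top.not_eq_extremum)
  have le1: "measure lborel I \<le> 1"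
    using fin fin' by simp
  have "(\<integral>\<^sup>+z. ennreal (exp (indicator I (fst z) * g (snd z - f0 (fst z)))) \<partial>obs_law f) =
     (\<integral>\<^sup>+x. (\<integral>\<^sup>+e. ennreal (exp (indicator I x * g (f x + e - f0 x))) \<partial>density lborel std_normal_density)
        * indicator {0..<1} x \<partial>lborel)"
    by (subst nn_integral_obs_law) (auto simp: borel_prod[symmetric])
  also have "\<dots> \<le> (\<integral>\<^sup>+x. indicator ({0..<1} - I) x + ennreal C * indicator I x \<partial>lborel)"
  proof (rule nn_integral_mono)
    fix x :: real
    show "(\<integral>\<^sup>+e. ennreal (exp (indicator I x * g (f x + e - f0 x))) \<partial>density lborel std_normal_density)
        * indicator {0..<1} x \<le> indicator ({0..<1} - I) x + ennreal C * indicator I x"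
    proof (cases "x \<in> I")
      case True
      then have "(\<lambda>e. ennreal (exp (indicator I x * g (f x + e - f0 x)))) = (\<lambda>e. ennreal (exp (g (e + \<Delta>))))"
        using \<Delta>[of x] by (simp add: algebra_simps)
      with True C sub show ?thesis by (auto simp: indicator_def)
    next
      case False
      then show ?thesis using N.emeasure_space_1 by (auto simp: indicator_def)
    qed
  qed
  also have "\<dots> = emeasure lborel ({0..<1} - I) + ennreal C * emeasure lborel I"
    by (subst nn_integral_add) (auto simp: nn_integral_cmult)
  also have "emeasure lborel ({0..<1} - I) = ennreal (1 - measure lborel I)"
    using sub fin' by (subst emeasure_Diff) (auto simp: ennreal_minus simp flip: ennreal_1)
  also have "ennreal (1 - measure lborel I) + ennreal C * emeasure lborel I =
      ennreal (1 + measure lborel I * (C - 1))"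
    using le1 \<open>0 \<le> C\<close> by (simp add: fin' algebra_simps flip: ennreal_mult' ennreal_plus)
  also have "\<dots> \<le> ennreal (exp (measure lborel I * (C - 1)))"
    by (intro ennreal_leI exp_ge_add_one_self)
  finally show ?thesis .
qed

text \<open>The choices of \<open>g\<close> give noise sums (identity), counts (constant 1) and
  absolute noise (\<open>1 + \<bar>e\<bar>\<close>). Residuals are taken against \<open>f0\<close>
  whatever the law of the sample, so that another parameter shows up as a drift.\<close>

definition segment_stat :: "nat \<Rightarrow> (real \<Rightarrow> real) \<Rightarrow> (real \<Rightarrow> real) \<Rightarrow> real set \<Rightarrow> sample \<Rightarrow> real" where
  "segment_stat n f0 g I z = (\<Sum>i\<in>{1..n}. indicator I (fst (z i)) * g (snd (z i) - f0 (fst (z i))))"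

lemma borel_measurable_segment_stat [measurable]:
  assumes [measurable]: "f0 \<in> borel_measurable borel" "g \<in> borel_measurable borel" "I \<in> sets borel"
  shows "segment_stat n f0 g I \<in> borel_measurable (sample_space n)"
  unfolding segment_stat_def by measurable

text \<open>Markov's inequality for \<open>exp\<close> of the statistic; a tilting parameter is
  absorbed into \<open>g\<close>. The law \<open>f\<close> and the centring \<open>f0\<close> are
  kept apart, so that one bound yields tails under the truth (\<open>\<Delta> = 0\<close>) as well
  as power under another parameter.\<close>

lemma chernoff:
  assumes [measurable]: "f \<in> borel_measurable borel" "f0 \<in> borel_measurable borel" "g \<in> borel_measurable borel"
    and I[measurable]: "I \<in> sets borel" and sub: "I \<subseteq> {0..<1}"
    and \<Delta>: "\<And>x. x \<in> I \<Longrightarrow> f x = f0 x + \<Delta>"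
    and C: "(\<integral>\<^sup>+e. ennreal (exp (g (e + \<Delta>))) \<partial>density lborel std_normal_density) \<le> ennreal C" and "0 \<le> C"
  shows "emeasure (product_law n f) {z \<in> space (sample_space n). b \<le> segment_stat n f0 g I z}
    \<le> ennreal (exp (real n * measure lborel I * (C - 1) - b))"
proof -
  interpret P: product_sigma_finite "\<lambda>_::nat. obs_law f"
    by (rule product_sigma_finite_obs_law) fact
  let ?h = "\<lambda>z::real \<times> real. indicator I (fst z) * g (snd z - f0 (fst z))"
  have [measurable]: "?h \<in> borel_measurable borel"
    unfolding borel_prod[symmetric] by measurable
  have "emeasure (product_law n f) {z \<in> space (sample_space n). b \<le> segment_stat n f0 g I z} =
      (\<integral>\<^sup>+z. indicator {z \<in> space (sample_space n). b \<le> segment_stat n f0 g I z} z \<partial>product_law n f)"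
    by (rule nn_integral_indicator[symmetric]) (unfold sets_product_law, measurable)
  also have "\<dots> \<le> (\<integral>\<^sup>+z. ennreal (exp (- b)) * (\<Prod>i\<in>{1..n}. ennreal (exp (?h (z i)))) \<partial>product_law n f)"
  proof (rule nn_integral_mono)
    fix z
    have "ennreal (exp (- b)) * (\<Prod>i\<in>{1..n}. ennreal (exp (?h (z i)))) = ennreal (exp (segment_stat n f0 g I z - b))"
      unfolding segment_stat_def exp_diff exp_minus exp_sum[OF finite_atLeastAtMost]
      by (subst prod_ennreal) (auto simp: divide_inverse mult.commute simp flip: ennreal_mult')
    moreover have "indicator {z \<in> space (sample_space n). b \<le> segment_stat n f0 g I z} z
        \<le> ennreal (exp (segment_stat n f0 g I z - b))"
      by (auto simp: indicator_def)
    ultimately show "indicator {z \<in> space (sample_space n). b \<le> segment_stat n f0 g I z} z \<le>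
         ennreal (exp (- b)) * (\<Prod>i\<in>{1..n}. ennreal (exp (?h (z i))))" by simp
  qed
  also have "\<dots> = ennreal (exp (- b)) * (\<integral>\<^sup>+z. (\<Prod>i\<in>{1..n}. ennreal (exp (?h (z i)))) \<partial>product_law n f)"
    by (rule nn_integral_cmult) (unfold measurable_cong_sets[OF sets_product_law refl], measurable)
  also have "(\<integral>\<^sup>+z. (\<Prod>i\<in>{1..n}. ennreal (exp (?h (z i)))) \<partial>product_law n f) =
      (\<Prod>i\<in>{1..n}. \<integral>\<^sup>+z. ennreal (exp (?h z)) \<partial>obs_law f)"
    by (rule P.product_nn_integral_prod) auto
  also have "ennreal (exp (- b)) * (\<Prod>i\<in>{1..n}. \<integral>\<^sup>+z. ennreal (exp (?h z)) \<partial>obs_law f)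
      \<le> ennreal (exp (- b)) * (\<Prod>i\<in>{1..n}. ennreal (exp (measure lborel I * (C - 1))))"
    by (intro mult_left_mono prod_mono_ennreal nn_integral_obs_law_exp_le[where \<Delta>=\<Delta>] assms) auto
  also have "\<dots> = ennreal (exp (real n * measure lborel I * (C - 1) - b))"
    by (simp add: ennreal_power mult_exp_exp mult.assoc flip: ennreal_mult exp_of_nat_mult)
  finally show ?thesis .
qed

section \<open>Exponential moments of the noise and elementary bounds for \<open>exp\<close>\<close>

lemma nn_integral_exp_std_normal:
  "(\<integral>\<^sup>+e. ennreal (exp (\<eta> * (e + \<Delta>))) \<partial>density lborel std_normal_density) = ennreal (exp (\<eta> * \<Delta> + \<eta>\<^sup>2 / 2))"
proof -
  have eq: "std_normal_density e * exp (\<eta> * (e + \<Delta>)) = exp (\<eta> * \<Delta> + \<eta>\<^sup>2 / 2) * normal_density \<eta> 1 e" for e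
    by (simp add: normal_density_def exp_add[symmetric] mult_exp_exp power2_eq_square field_simps)
  have "(\<integral>\<^sup>+e. ennreal (exp (\<eta> * (e + \<Delta>))) \<partial>density lborel std_normal_density) =
      (\<integral>\<^sup>+e. ennreal (exp (\<eta> * \<Delta> + \<eta>\<^sup>2 / 2)) * ennreal (normal_density \<eta> 1 e) \<partial>lborel)"
    by (subst nn_integral_density) (auto simp: eq simp flip: ennreal_mult)
  also have "\<dots> = ennreal (exp (\<eta> * \<Delta> + \<eta>\<^sup>2 / 2)) * emeasure (density lborel (normal_density \<eta> 1)) UNIV"
    by (subst nn_integral_cmult) (auto simp: emeasure_density)
  also have "\<dots> = ennreal (exp (\<eta> * \<Delta> + \<eta>\<^sup>2 / 2))"
    using prob_space.emeasure_space_1[OF prob_space_normal_density[of 1 \<eta>]] by simp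
  finally show ?thesis .
qed

text \<open>\<open>exp (1 + \<bar>e\<bar>)\<close> is at most
  \<open>exp (1 + e) + exp (1 - e)\<close>, and each summand has mean
  \<open>exp (3 / 2)\<close>.\<close>

lemma nn_integral_exp_abs_std_normal_le:
  "(\<integral>\<^sup>+e. ennreal (exp (1 + \<bar>e\<bar>)) \<partial>density lborel std_normal_density) \<le> ennreal (2 * exp (3 / 2))"
proof -
  have "(\<integral>\<^sup>+e. ennreal (exp (1 + \<bar>e\<bar>)) \<partial>density lborel std_normal_density) \<le>
      (\<integral>\<^sup>+e. ennreal (exp (1 * (e + 1))) + ennreal (exp ((-1) * (e + (-1)))) \<partial>density lborel std_normal_density)"
    by (intro nn_integral_mono) (auto simp: abs_if add.commute simp flip: ennreal_plus)
  also have "\<dots> = ennreal (exp (1 * 1 + 1\<^sup>2 / 2)) + ennreal (exp ((-1) * (-1) + (-1)\<^sup>2 / 2))"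
    by (subst nn_integral_add) (simp_all only: nn_integral_exp_std_normal, auto)
  also have "\<dots> = ennreal (2 * exp (3 / 2))"
    by (simp flip: ennreal_plus)
  finally show ?thesis .
qed

text \<open>\<open>(1 + \<eta>) (1 - \<eta> + \<eta>\<^sup>2) = 1 + \<eta>\<^sup>3\<close>, and
  \<open>1 + \<eta> \<le> exp \<eta>\<close>. This is the negative counterpart of
  \<open>exp_bound\<close>, needed for the lower tail of the counts.\<close>

lemma exp_minus_le_quadratic: "exp (- \<eta>) \<le> 1 - \<eta> + \<eta>\<^sup>2" if "0 \<le> \<eta>" for \<eta> :: real
proof -
  have "1 \<le> (1 + \<eta>) * (1 - \<eta> + \<eta>\<^sup>2)"
    using that by (simp add: algebra_simps power2_eq_square)
  also have "\<dots> \<le> exp \<eta> * (1 - \<eta> + \<eta>\<^sup>2)"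
  proof (rule mult_right_mono)
    show "0 \<le> 1 - \<eta> + \<eta>\<^sup>2"
      using zero_le_power2[of "\<eta> - 1"] that by (simp add: power2_eq_square algebra_simps)
  qed simp
  finally show ?thesis by (simp add: exp_minus field_simps)
qed

lemma segment_stat_cmult: "segment_stat n f0 (\<lambda>e. c * g e) I z = c * segment_stat n f0 g I z"
  unfolding segment_stat_def sum_distrib_left by (intro sum.cong) (simp_all add: mult_ac)

context
  fixes f0 :: "real \<Rightarrow> real" and I :: "real set" and n :: nat
  assumes f0 [measurable]: "f0 \<in> borel_measurable borel"
    and I [measurable]: "I \<in> sets borel" and I_sub: "I \<subseteq> {0..<1}"
begin

lemma two_sided_tail:
  assumes [measurable]: "g \<in> borel_measurable borel"
    and "emeasure (product_law n f0) {z \<in> space (sample_space n). b \<le> segment_stat n f0 g I z - c} \<le> ennreal B"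
    and "emeasure (product_law n f0) {z \<in> space (sample_space n). b \<le> - (segment_stat n f0 g I z - c)} \<le> ennreal B"
    and "0 \<le> B"
  shows "emeasure (product_law n f0) {z \<in> space (sample_space n). b \<le> \<bar>segment_stat n f0 g I z - c\<bar>} \<le> ennreal (2 * B)"
proof -
  let ?A = "{z \<in> space (sample_space n). b \<le> segment_stat n f0 g I z - c}"
  let ?B = "{z \<in> space (sample_space n). b \<le> - (segment_stat n f0 g I z - c)}"
  have [measurable]: "?A \<in> sets (sample_space n)" "?B \<in> sets (sample_space n)"
    by measurable
  have "{z \<in> space (sample_space n). b \<le> \<bar>segment_stat n f0 g I z - c\<bar>} \<subseteq> ?A \<union> ?B"
    by auto
  then have "emeasure (product_law n f0) {z \<in> space (sample_space n). b \<le> \<bar>segment_stat n f0 g I z - c\<bar>}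
      \<le> emeasure (product_law n f0) (?A \<union> ?B)"
    by (intro emeasure_mono) (unfold sets_product_law, measurable)
  also have "\<dots> \<le> emeasure (product_law n f0) ?A + emeasure (product_law n f0) ?B"
    by (rule emeasure_subadditive) (unfold sets_product_law, measurable)
  also have "\<dots> \<le> ennreal B + ennreal B"
    by (intro add_mono assms)
  also have "\<dots> = ennreal (2 * B)"
    using \<open>0 \<le> B\<close> by (simp flip: ennreal_plus)
  finally show ?thesis .
qed

text \<open>For \<open>\<eta> \<le> 1\<close> the moment satisfies
  \<open>exp (\<eta>\<^sup>2 / 2) - 1 \<le> \<eta>\<^sup>2\<close>. The tilt stays free:
  \<open>1 / sqrt n\<close> gives tails on the scale \<open>sqrt n\<close>, a fixed tilt gives
  exponential tails for deviations proportional to \<open>n\<close> times the length of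
  \<open>I\<close>.\<close>

lemma noise_tail:
  assumes "0 \<le> \<eta>" "\<eta> \<le> 1"
  shows "emeasure (product_law n f0) {z \<in> space (sample_space n). b \<le> \<bar>segment_stat n f0 (\<lambda>e. e) I z\<bar>}
    \<le> ennreal (2 * exp (real n * measure lborel I * \<eta>\<^sup>2 - \<eta> * b))"
proof -
  have "exp (\<eta>\<^sup>2 / 2) \<le> 1 + \<eta>\<^sup>2 / 2 + (\<eta>\<^sup>2 / 2)\<^sup>2"
    using assms power_le_one[of \<eta> 2] by (intro exp_bound) auto
  moreover have "(\<eta>\<^sup>2 / 2)\<^sup>2 \<le> \<eta>\<^sup>2 / 2"
    using power_le_one[OF assms, of 2] mult_left_le[of "\<eta>\<^sup>2 / 2" "\<eta>\<^sup>2 / 2"]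
    by (simp add: power2_eq_square)
  ultimately have e: "exp (\<eta>\<^sup>2 / 2) - 1 \<le> \<eta>\<^sup>2" by simp
  have *: "emeasure (product_law n f0) {z \<in> space (sample_space n). b \<le> \<sigma> * segment_stat n f0 (\<lambda>e. e) I z}
      \<le> ennreal (exp (real n * measure lborel I * \<eta>\<^sup>2 - \<eta> * b))" if "\<sigma> \<in> {1, -1}" for \<sigma>
  proof -
    have "emeasure (product_law n f0) {z \<in> space (sample_space n). b \<le> \<sigma> * segment_stat n f0 (\<lambda>e. e) I z}
      \<le> emeasure (product_law n f0) {z \<in> space (sample_space n). \<eta> * b \<le> segment_stat n f0 (\<lambda>e. (\<eta> * \<sigma>) * e) I z}"
      using mult_left_mono[OF _ \<open>0 \<le> \<eta>\<close>, of b]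
      by (intro emeasure_mono; unfold sets_product_law segment_stat_cmult; (measurable)?) (auto simp: mult.assoc)
    also have "\<dots> \<le> ennreal (exp (real n * measure lborel I * (exp (\<eta>\<^sup>2 / 2) - 1) - \<eta> * b))"
      using nn_integral_exp_std_normal[of "\<eta> * \<sigma>" 0] that
      by (intro chernoff[where \<Delta>=0] I_sub) (auto simp: power_mult_distrib)
    also have "\<dots> \<le> ennreal (exp (real n * measure lborel I * \<eta>\<^sup>2 - \<eta> * b))"
      using e by (auto intro!: ennreal_leI mult_left_mono)
    finally show ?thesis .
  qed
  show ?thesis
    using two_sided_tail[of "\<lambda>e. e" b 0] *[of 1] *[of "-1"] by simp
qed

text \<open>The linear term of \<open>exp (\<sigma> * \<eta>)\<close> cancels against the centring
  of the count, leaving the remainder \<open>\<eta>\<^sup>2\<close>.\<close>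

lemma count_tail:
  assumes "0 \<le> \<eta>" "\<eta> \<le> 1"
  shows "emeasure (product_law n f0)
      {z \<in> space (sample_space n). b \<le> \<bar>segment_stat n f0 (\<lambda>_. 1) I z - real n * measure lborel I\<bar>}
    \<le> ennreal (2 * exp (real n * measure lborel I * \<eta>\<^sup>2 - \<eta> * b))"
proof -
  let ?m = "real n * measure lborel I"
  have e: "exp (\<sigma> * \<eta>) \<le> 1 + \<sigma> * \<eta> + \<eta>\<^sup>2" if "\<sigma> \<in> {1, -1}" for \<sigma>
    using that exp_bound[of \<eta>] exp_minus_le_quadratic[of \<eta>] assms by auto
  have *: "emeasure (product_law n f0) {z \<in> space (sample_space n). b \<le> \<sigma> * (segment_stat n f0 (\<lambda>_. 1) I z - ?m)}
      \<le> ennreal (exp (?m * \<eta>\<^sup>2 - \<eta> * b))" if \<sigma>: "\<sigma> \<in> {1, -1}" for \<sigma>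
  proof -
    have "emeasure (product_law n f0) {z \<in> space (sample_space n). b \<le> \<sigma> * (segment_stat n f0 (\<lambda>_. 1) I z - ?m)}
      \<le> emeasure (product_law n f0)
        {z \<in> space (sample_space n). \<eta> * b + \<eta> * \<sigma> * ?m \<le> segment_stat n f0 (\<lambda>_. (\<eta> * \<sigma>) * 1) I z}"
      using mult_left_mono[OF _ \<open>0 \<le> \<eta>\<close>, of b]
      by (intro emeasure_mono; unfold sets_product_law segment_stat_cmult; (measurable)?)
        (fastforce simp: algebra_simps)
    also have "\<dots> \<le> ennreal (exp (?m * (exp (\<sigma> * \<eta>) - 1) - (\<eta> * b + \<eta> * \<sigma> * ?m)))"
      using prob_space.emeasure_space_1[OF prob_space_normal_density[of 1 0]]
      by (intro chernoff[where \<Delta>=0] I_sub) (auto simp: mult.commute)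
    also have "\<dots> \<le> ennreal (exp (?m * \<eta>\<^sup>2 - \<eta> * b))"
      using mult_left_mono[OF e[OF \<sigma>], of ?m] by (auto intro!: ennreal_leI simp: algebra_simps)
    finally show ?thesis .
  qed
  show ?thesis
    by (rule two_sided_tail) (use *[of 1] *[of "-1"] in simp_all)
qed

text \<open>The sets of interest have measure of order \<open>1 / n\<close> and only boundedness is
  wanted, so tilt 1 and a crude moment bound suffice.\<close>

lemma abs_noise_tail:
  "emeasure (product_law n f0) {z \<in> space (sample_space n). b \<le> segment_stat n f0 (\<lambda>e. 1 + \<bar>e\<bar>) I z}
    \<le> ennreal (exp (real n * measure lborel I * (2 * exp (3 / 2)) - b))"
proof -
  have "emeasure (product_law n f0) {z \<in> space (sample_space n). b \<le> segment_stat n f0 (\<lambda>e. 1 + \<bar>e\<bar>) I z}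
    \<le> ennreal (exp (real n * measure lborel I * (2 * exp (3 / 2) - 1) - b))"
    using nn_integral_exp_abs_std_normal_le by (intro chernoff[where \<Delta>=0] I_sub) auto
  also have "\<dots> \<le> ennreal (exp (real n * measure lborel I * (2 * exp (3 / 2)) - b))"
    by (auto intro!: ennreal_leI mult_left_mono)
  finally show ?thesis .
qed

text \<open>Chernoff's bound with parameter \<open>\<Delta>\<close> itself, so that the exponent is quadratic in \<open>\<Delta>\<close>.\<close>

lemma shifted_noise_small:
  fixes K \<Delta> :: real
  defines "c \<equiv> 1 / (2 + 4 * K\<^sup>2)"
  assumes [measurable]: "f \<in> borel_measurable borel" and \<Delta>: "\<And>x. x \<in> I \<Longrightarrow> f x = f0 x + \<Delta>"
    and "\<bar>\<Delta>\<bar> \<le> 2 * K" and b: "b \<le> c / 2 * real n * measure lborel I * \<bar>\<Delta>\<bar>"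
  shows "emeasure (product_law n f) {z \<in> space (sample_space n). \<bar>segment_stat n f0 (\<lambda>e. e) I z\<bar> \<le> b}
    \<le> ennreal (exp (- (c / 2 * real n * measure lborel I * \<Delta>\<^sup>2)))"
proof -
  let ?m = "real n * measure lborel I"
  have K2: "\<Delta>\<^sup>2 \<le> (2 * K)\<^sup>2"
    using power_mono[OF \<open>\<bar>\<Delta>\<bar> \<le> 2 * K\<close>, of 2] by simp
  \<comment> \<open>The bound on \<open>\<Delta>\<close> turns the exponential moment into one that
    is linear in \<open>\<Delta>\<^sup>2\<close>, with slope \<open>c\<close>.\<close>
  have "1 / exp (\<Delta>\<^sup>2 / 2) \<le> 1 / (1 + \<Delta>\<^sup>2 / 2)"
    using exp_ge_add_one_self[of "\<Delta>\<^sup>2 / 2"] by (intro divide_left_mono) (auto simp: add_pos_nonneg)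
  also have "\<dots> = 1 - \<Delta>\<^sup>2 / (2 + \<Delta>\<^sup>2)"
  proof -
    have "2 + \<Delta>\<^sup>2 > 0" by (simp add: add_pos_nonneg)
    then have "1 / (1 + \<Delta>\<^sup>2 / 2) = 2 / (2 + \<Delta>\<^sup>2)" "1 = (2 + \<Delta>\<^sup>2) / (2 + \<Delta>\<^sup>2)"
      by (auto simp: divide_simps)
    then show ?thesis by (metis add_diff_cancel_right' add_divide_distrib)
  qed
  also have "\<dots> \<le> 1 - c * \<Delta>\<^sup>2"
    using K2 unfolding c_def by (auto simp: power_mult_distrib intro!: divide_left_mono mult_pos_pos add_pos_nonneg)
  finally have e: "exp (- (\<Delta>\<^sup>2 / 2)) - 1 \<le> - (c * \<Delta>\<^sup>2)"
    by (simp add: exp_minus inverse_eq_divide)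
  have "emeasure (product_law n f) {z \<in> space (sample_space n). \<bar>segment_stat n f0 (\<lambda>e. e) I z\<bar> \<le> b}
      \<le> emeasure (product_law n f) {z \<in> space (sample_space n). - (b * \<bar>\<Delta>\<bar>) \<le> segment_stat n f0 (\<lambda>e. - \<Delta> * e) I z}"
  proof (rule emeasure_mono)
    have "- (b * \<bar>\<Delta>\<bar>) \<le> - \<Delta> * S" if "\<bar>S\<bar> \<le> b" for S :: real
    proof -
      have "\<Delta> * S \<le> \<bar>\<Delta>\<bar> * \<bar>S\<bar>"
        by (metis abs_ge_self abs_mult)
      also have "\<dots> \<le> \<bar>\<Delta>\<bar> * b"
        using that by (intro mult_left_mono) auto
      finally show ?thesis by (simp add: mult.commute)
    qed
    then show "{z \<in> space (sample_space n). \<bar>segment_stat n f0 (\<lambda>e. e) I z\<bar> \<le> b} \<subseteq>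
       {z \<in> space (sample_space n). - (b * \<bar>\<Delta>\<bar>) \<le> segment_stat n f0 (\<lambda>e. - \<Delta> * e) I z}"
      unfolding segment_stat_cmult by auto
  qed (unfold sets_product_law, measurable)
  \<comment> \<open>Under \<open>f\<close> the tilt \<open>- \<Delta>\<close> meets noise of mean
    \<open>\<Delta>\<close>, so the moment is
    \<open>exp (- \<Delta>\<^sup>2 + \<Delta>\<^sup>2 / 2)\<close>.\<close>
  also have "\<dots> \<le> ennreal (exp (?m * (exp (- (\<Delta>\<^sup>2 / 2)) - 1) - (- (b * \<bar>\<Delta>\<bar>))))"
    using nn_integral_exp_std_normal[of "- \<Delta>" \<Delta>] \<Delta>
    by (intro chernoff[where \<Delta>=\<Delta>] I_sub) (auto simp: power2_eq_square)
  also have "\<dots> \<le> ennreal (exp (- (c / 2 * ?m * \<Delta>\<^sup>2)))"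
  proof (intro ennreal_leI, unfold exp_le_cancel_iff)
    have "b * \<bar>\<Delta>\<bar> \<le> c / 2 * real n * measure lborel I * \<bar>\<Delta>\<bar> * \<bar>\<Delta>\<bar>"
      using b by (intro mult_right_mono) auto
    also have "\<dots> = c / 2 * ?m * \<Delta>\<^sup>2"
      by (simp add: power2_eq_square)
    finally have "b * \<bar>\<Delta>\<bar> \<le> c / 2 * ?m * \<Delta>\<^sup>2" .
    moreover have "?m * (exp (- (\<Delta>\<^sup>2 / 2)) - 1) \<le> ?m * (- (c * \<Delta>\<^sup>2))"
      using e by (intro mult_left_mono) auto
    ultimately show "?m * (exp (- (\<Delta>\<^sup>2 / 2)) - 1) - (- (b * \<bar>\<Delta>\<bar>)) \<le> - (c / 2 * ?m * \<Delta>\<^sup>2)"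
      by (simp add: algebra_simps)
  qed
  finally show ?thesis by (simp add: mult.assoc)
qed

end

section \<open>Segments, knots and the squared loss\<close>

lemma knot_0 [simp]: "knot k s 0 = 0"
  by (simp add: knot_def)

lemma knot_last [simp]: "1 \<le> k \<Longrightarrow> knot k s k = 1"
  by (simp add: knot_def)

lemma knot_inner [simp]: "j \<in> {1..<k} \<Longrightarrow> knot k s j = s j"
  by (simp add: knot_def)

abbreviation segment :: "nat \<Rightarrow> (nat \<Rightarrow> real) \<Rightarrow> nat \<Rightarrow> real set" where
  "segment k s j \<equiv> {knot k s (j - 1)..<knot k s j}"

lemma knot_step:
  assumes "s \<in> locations \<delta> k" "j \<in> {1..k}"
  shows "knot k s (j - 1) + \<delta> \<le> knot k s j"
proof -
  have "knot k s (j - 1) < knot k s j" "\<bar>knot k s j - knot k s (j - 1)\<bar> \<ge> \<delta>"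
    using assms by (auto simp: locations_def)
  then show ?thesis by linarith
qed

lemma knot_gap:
  assumes s: "s \<in> locations \<delta> k" and "0 < \<delta>" "i < j" "j \<le> k"
  shows "knot k s i + \<delta> \<le> knot k s j"
  using \<open>i < j\<close> \<open>j \<le> k\<close>
proof (induction j)
  case (Suc j)
  then have "knot k s j + \<delta> \<le> knot k s (Suc j)"
    using knot_step[OF s, of "Suc j"] by simp
  with Suc \<open>0 < \<delta>\<close> show ?case by (cases "i = j") auto
qed simp

lemma knot_mono:
  assumes "s \<in> locations \<delta> k" "0 < \<delta>" "i \<le> j" "j \<le> k"
  shows "knot k s i \<le> knot k s j"
  using knot_gap[OF assms(1,2), of i j] assms by (cases "i = j") auto

lemma knot_bounds:
  assumes "s \<in> locations \<delta> k" "0 < \<delta>" "1 \<le> k" "j \<le> k"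
  shows "0 \<le> knot k s j" "knot k s j \<le> 1"
  using knot_mono[OF assms(1,2), of 0 j] knot_mono[OF assms(1,2), of j k] assms by auto

lemma segment_subset:
  assumes "s \<in> locations \<delta> k" "0 < \<delta>" "1 \<le> k" "j \<in> {1..k}"
  shows "segment k s j \<subseteq> {0..<1}"
proof -
  have "0 \<le> knot k s (j - 1)" "knot k s j \<le> 1"
    by (rule knot_bounds[OF assms(1-3)]; use assms(4) in auto)+
  then show ?thesis by auto
qed

lemma segment_exists:
  assumes "s \<in> locations \<delta> k" "1 \<le> k" "x \<in> {0..<1}"
  obtains j where "j \<in> {1..k}" "x \<in> segment k s j"
proof -
  have ex: "\<exists>j\<le>k. x < knot k s j" using assms by (intro exI[of _ k]) auto
  define j where "j = (LEAST j. x < knot k s j)"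
  have j: "x < knot k s j" unfolding j_def using ex by (metis LeastI)
  have "j \<le> k" unfolding j_def using ex by (metis Least_le order.trans)
  have "j \<noteq> 0" using j assms(3) by (auto intro: ccontr)
  moreover have "knot k s (j - 1) \<le> x"
    using not_less_Least[of "j - 1" "\<lambda>j. x < knot k s j"] \<open>j \<noteq> 0\<close> unfolding j_def[symmetric] by auto
  ultimately show ?thesis using j \<open>j \<le> k\<close> by (intro that[of j]) auto
qed

lemma segment_unique:
  assumes "s \<in> locations \<delta> k" "0 < \<delta>" "i \<in> {1..k}" "j \<in> {1..k}" "x \<in> segment k s i" "x \<in> segment k s j"
  shows "i = j"
proof (rule ccontr)
  assume "i \<noteq> j"
  then consider "i \<le> j - 1" | "j \<le> i - 1" by linarith
  then show False
  proof cases
    case 1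
    have "knot k s i \<le> knot k s (j - 1)"
      using 1 assms by (intro knot_mono[OF assms(1,2)]) auto
    then show False using assms(5,6) by simp
  next
    case 2
    have "knot k s j \<le> knot k s (i - 1)"
      using 2 assms by (intro knot_mono[OF assms(1,2)]) auto
    then show False using assms(5,6) by simp
  qed
qed

lemma sum_segment:
  assumes "s \<in> locations \<delta> k" "0 < \<delta>" "j \<in> {1..k}" "x \<in> segment k s j"
  shows "(\<Sum>i\<in>{1..k}. indicator (segment k s i) x * h i) = (h j :: real)"
proof -
  have "(\<Sum>i\<in>{1..k}. indicator (segment k s i) x * h i) = (\<Sum>i\<in>{1..k}. if i = j then h j else 0)"
  proof (rule sum.cong)
    fix i assume "i \<in> {1..k}"
    then show "indicator (segment k s i) x * h i = (if i = j then h j else 0)"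
    proof (cases "x \<in> segment k s i")
      case True
      then have "i = j"
        by (rule segment_unique[OF assms(1,2) \<open>i \<in> {1..k}\<close> assms(3) _ assms(4)])
      with True show ?thesis by simp
    qed (use assms(4) in auto)
  qed simp
  also have "\<dots> = h j" using assms(3) by simp
  finally show ?thesis .
qed

lemma step_fun_segment:
  assumes "s \<in> locations \<delta> k" "0 < \<delta>" "j \<in> {1..k}" "x \<in> segment k s j"
  shows "step_fun (k, a, s) x = a j"
  using sum_segment[OF assms, of a] by (simp add: step_fun_def mult.commute)

text \<open>Almost sure under the sample law, but needed pointwise: \<open>obs_density\<close>
  vanishes outside the unit interval, so the likelihood is an exponential of the squared loss only
  on this set.\<close>

definition in_design :: "nat \<Rightarrow> sample \<Rightarrow> bool" where
  "in_design n z \<longleftrightarrow> (\<forall>i\<in>{1..n}. fst (z i) \<in> {0..<1})"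

lemma in_designD: "in_design n z \<Longrightarrow> i \<in> {1..n} \<Longrightarrow> fst (z i) \<in> {0..<1}"
  by (simp add: in_design_def)

locale change_point =
  fixes k :: nat and K \<delta> :: real and a0 s0 :: "nat \<Rightarrow> real"
  assumes k: "1 \<le> k" and K: "0 < K" and \<delta>: "0 < \<delta>"
    and a0: "a0 \<in> levels K k" and s0: "s0 \<in> locations \<delta> k"
begin

abbreviation f0 :: "real \<Rightarrow> real" where
  "f0 \<equiv> step_fun (k, a0, s0)"

text \<open>Contains every design point that can change segment when each knot moves by at most
  \<open>r\<close>.\<close>

definition near_knots :: "real \<Rightarrow> real set" where
  "near_knots r = {0..<1} \<inter> (\<Union>j\<in>{1..<k}. {s0 j - r..s0 j + r})"

lemma sets_near_knots [measurable]: "near_knots r \<in> sets borel"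
  unfolding near_knots_def by measurable

lemma near_knots_subset: "near_knots r \<subseteq> {0..<1}"
  by (auto simp: near_knots_def)

lemma measure_near_knots_le:
  assumes "0 \<le> r"
  shows "measure lborel (near_knots r) \<le> 2 * r * real k"
proof -
  have "emeasure lborel (near_knots r) \<le> emeasure lborel (\<Union>j\<in>{1..<k}. {s0 j - r..s0 j + r})"
    by (intro emeasure_mono) (auto simp: near_knots_def)
  also have "\<dots> \<le> (\<Sum>j\<in>{1..<k}. emeasure lborel {s0 j - r..s0 j + r})"
    by (intro emeasure_subadditive_finite) auto
  also have "\<dots> = (\<Sum>j\<in>{1..<k}. ennreal (2 * r))"
    using assms by (intro sum.cong) auto
  also have "\<dots> \<le> ennreal (2 * r * real k)"
    using assms by (auto simp: ennreal_of_nat_eq_real_of_nat simp flip: ennreal_mult intro!: ennreal_leI)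
      (simp add: mult_left_mono mult.commute)
  finally show ?thesis
    using assms by (simp add: measure_def enn2real_leI)
qed

lemma level_bound:
  assumes "a \<in> levels K k" "j \<in> {1..k}"
  shows "\<bar>a j\<bar> \<le> K"
proof -
  have "a j \<in> {-K..K}" using assms unfolding levels_def by (rule PiE_mem)
  then show ?thesis by auto
qed

lemma step_fun_bound:
  assumes "a \<in> levels K k" "s \<in> locations \<delta> k" "x \<in> {0..<1}"
  shows "\<bar>step_fun (k, a, s) x\<bar> \<le> K"
proof -
  obtain j where j: "j \<in> {1..k}" "x \<in> segment k s j"
    using segment_exists[OF assms(2) k assms(3)] .
  then show ?thesis
    using step_fun_segment[OF assms(2) \<delta> j] level_bound[OF assms(1)] by simp
qed

text \<open>Outside \<open>near_knots r\<close> the point is farther than \<open>r\<close> from each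
  inner knot, so no knot crosses it.\<close>

lemma segment_transfer:
  assumes s: "s \<in> locations \<delta> k" and r: "\<And>j. j \<in> {1..<k} \<Longrightarrow> \<bar>s j - s0 j\<bar> \<le> r"
    and x: "x \<in> {0..<1}" "x \<notin> near_knots r" and j: "j \<in> {1..k}" "x \<in> segment k s0 j"
  shows "x \<in> segment k s j"
proof -
  have far: "x < s0 i - r \<or> s0 i + r < x" if "i \<in> {1..<k}" for i
    using x that by (auto simp: near_knots_def not_le)
  have "knot k s (j - 1) \<le> x"
  proof (cases "j = 1")
    case False
    then have i: "j - 1 \<in> {1..<k}" using j(1) by auto
    then have "s0 (j - 1) \<le> x" using j(2) knot_inner[OF i, of s0] by simp
    then show ?thesis using far[OF i] r[OF i] knot_inner[OF i, of s] by linarith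
  qed (use x in simp)
  moreover have "x < knot k s j"
  proof (cases "j = k")
    case False
    then have i: "j \<in> {1..<k}" using j(1) by auto
    then have "x < s0 j" using j(2) by simp
    then show ?thesis using far[OF i] r[OF i] i by (simp, linarith)
  qed (use x k in simp)
  ultimately show ?thesis by simp
qed

lemma step_fun_transfer:
  assumes s: "s \<in> locations \<delta> k" and r: "\<And>j. j \<in> {1..<k} \<Longrightarrow> \<bar>s j - s0 j\<bar> \<le> r"
    and x: "x \<in> {0..<1}" "x \<notin> near_knots r"
  shows "step_fun (k, a, s) x = step_fun (k, a, s0) x"
proof -
  obtain j where j: "j \<in> {1..k}" "x \<in> segment k s0 j"
    using segment_exists[OF s0 k x(1)] .
  show ?thesis
    using step_fun_segment[OF s0 \<delta> j] step_fun_segment[OF s \<delta> j(1) segment_transfer[OF s r x j]] by simp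
qed

section \<open>The squared loss: exact quadratic in the levels, bounded change in the knots\<close>

definition loss :: "nat \<Rightarrow> sample \<Rightarrow> (nat \<Rightarrow> real) \<Rightarrow> (nat \<Rightarrow> real) \<Rightarrow> real" where
  "loss n z a s = (\<Sum>i\<in>{1..n}. (snd (z i) - step_fun (k, a, s) (fst (z i)))\<^sup>2)"

abbreviation noise_sum :: "nat \<Rightarrow> real set \<Rightarrow> sample \<Rightarrow> real" where
  "noise_sum n I z \<equiv> segment_stat n f0 (\<lambda>e. e) I z"

abbreviation count :: "nat \<Rightarrow> real set \<Rightarrow> sample \<Rightarrow> real" where
  "count n I z \<equiv> segment_stat n f0 (\<lambda>_. 1) I z"

abbreviation abs_noise :: "nat \<Rightarrow> real set \<Rightarrow> sample \<Rightarrow> real" where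
  "abs_noise n I z \<equiv> segment_stat n f0 (\<lambda>e. 1 + \<bar>e\<bar>) I z"

lemma likelihood_eq:
  assumes z: "in_design n z"
  shows "likelihood n z (k, a, s) = (1 / sqrt (2 * pi)) ^ n * exp (- loss n z a s / 2)"
proof -
  have "likelihood n z (k, a, s) =
      (\<Prod>i\<in>{1..n}. 1 / sqrt (2 * pi) * exp (- (snd (z i) - step_fun (k, a, s) (fst (z i)))\<^sup>2 / 2))"
    unfolding likelihood_def using in_designD[OF z]
    by (intro prod.cong) (auto simp: obs_density_def normal_density_def split_beta)
  also have "\<dots> = (1 / sqrt (2 * pi)) ^ n *
      (\<Prod>i\<in>{1..n}. exp (- (snd (z i) - step_fun (k, a, s) (fst (z i)))\<^sup>2 / 2))"
    by (simp only: prod.distrib prod_constant card_atLeastAtMost diff_Suc_1)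
  also have "(\<Prod>i\<in>{1..n}. exp (- (snd (z i) - step_fun (k, a, s) (fst (z i)))\<^sup>2 / 2)) = exp (- loss n z a s / 2)"
    by (simp add: exp_sum[symmetric] loss_def sum_negf sum_divide_distrib)
  finally show ?thesis .
qed

text \<open>With the true knots each observation sees exactly one level, so the loss separates: the
  counts are the curvatures, the noise sums the gradients.\<close>

lemma loss_quadratic:
  assumes z: "in_design n z"
  shows "loss n z a s0 = loss n z a0 s0 +
    (\<Sum>j\<in>{1..k}. count n (segment k s0 j) z * (a j - a0 j)\<^sup>2 - 2 * (a j - a0 j) * noise_sum n (segment k s0 j) z)"
proof -
  let ?e = "\<lambda>i. snd (z i) - f0 (fst (z i))"
  have "loss n z a s0 - loss n z a0 s0 =
      (\<Sum>i\<in>{1..n}. (snd (z i) - step_fun (k, a, s0) (fst (z i)))\<^sup>2 - (?e i)\<^sup>2)"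
    by (simp add: loss_def sum_subtractf)
  also have "\<dots> = (\<Sum>i\<in>{1..n}. \<Sum>j\<in>{1..k}. indicator (segment k s0 j) (fst (z i)) *
      ((a j - a0 j)\<^sup>2 - 2 * (a j - a0 j) * ?e i))"
  proof (rule sum.cong)
    fix i assume "i \<in> {1..n}"
    obtain j where j: "j \<in> {1..k}" "fst (z i) \<in> segment k s0 j"
      using segment_exists[OF s0 k in_designD[OF z \<open>i \<in> {1..n}\<close>]] .
    show "(snd (z i) - step_fun (k, a, s0) (fst (z i)))\<^sup>2 - (?e i)\<^sup>2 =
        (\<Sum>j\<in>{1..k}. indicator (segment k s0 j) (fst (z i)) * ((a j - a0 j)\<^sup>2 - 2 * (a j - a0 j) * ?e i))"
      unfolding sum_segment[OF s0 \<delta> j] step_fun_segment[OF s0 \<delta> j]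
      by (simp add: power2_eq_square algebra_simps)
  qed simp
  also have "\<dots> = (\<Sum>j\<in>{1..k}. \<Sum>i\<in>{1..n}. indicator (segment k s0 j) (fst (z i)) *
      ((a j - a0 j)\<^sup>2 - 2 * (a j - a0 j) * ?e i))"
    by (rule sum.swap)
  also have "\<dots> = (\<Sum>j\<in>{1..k}. count n (segment k s0 j) z * (a j - a0 j)\<^sup>2 - 2 * (a j - a0 j) * noise_sum n (segment k s0 j) z)"
  proof (rule sum.cong)
    fix j
    show "(\<Sum>i\<in>{1..n}. indicator (segment k s0 j) (fst (z i)) * ((a j - a0 j)\<^sup>2 - 2 * (a j - a0 j) * ?e i)) =
        count n (segment k s0 j) z * (a j - a0 j)\<^sup>2 - 2 * (a j - a0 j) * noise_sum n (segment k s0 j) z"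
      unfolding segment_stat_def sum_distrib_left sum_distrib_right sum_subtractf[symmetric]
      by (intro sum.cong) (simp_all only: right_diff_distrib mult_1_right mult.left_commute)
  qed simp
  finally show ?thesis by simp
qed

text \<open>The two functions differ only on \<open>near_knots r\<close>.\<close>

lemma loss_shift:
  assumes z: "in_design n z"
    and s: "s \<in> locations \<delta> k" and r: "\<And>j. j \<in> {1..<k} \<Longrightarrow> \<bar>s j - s0 j\<bar> \<le> r"
  shows "\<bar>loss n z a0 s - loss n z a0 s0\<bar> \<le> (4 * K + 4 * K\<^sup>2) * abs_noise n (near_knots r) z"
proof -
  let ?e = "\<lambda>i. snd (z i) - f0 (fst (z i))"
  have "\<bar>loss n z a0 s - loss n z a0 s0\<bar> =
      \<bar>\<Sum>i\<in>{1..n}. (snd (z i) - step_fun (k, a0, s) (fst (z i)))\<^sup>2 - (?e i)\<^sup>2\<bar>"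
    by (simp add: loss_def sum_subtractf)
  also have "\<dots> \<le> (\<Sum>i\<in>{1..n}. (4 * K + 4 * K\<^sup>2) * (indicator (near_knots r) (fst (z i)) * (1 + \<bar>?e i\<bar>)))"
  proof (rule order.trans[OF sum_abs sum_mono])
    fix i assume i: "i \<in> {1..n}"
    show "\<bar>(snd (z i) - step_fun (k, a0, s) (fst (z i)))\<^sup>2 - (?e i)\<^sup>2\<bar>
        \<le> (4 * K + 4 * K\<^sup>2) * (indicator (near_knots r) (fst (z i)) * (1 + \<bar>?e i\<bar>))"
    proof (cases "fst (z i) \<in> near_knots r")
      case False
      then show ?thesis using step_fun_transfer[OF s r in_designD[OF z i] False, of a0] by simp
    next
      case True
      define b c e where "b = step_fun (k, a0, s) (fst (z i))" and "c = f0 (fst (z i))" and "e = ?e i"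
      have bc: "\<bar>b\<bar> \<le> K" "\<bar>c\<bar> \<le> K"
        unfolding b_def c_def using step_fun_bound[OF a0 _ in_designD[OF z i]] s s0 by auto
      have "(snd (z i) - b)\<^sup>2 - e\<^sup>2 = (c - b) * (2 * e + (c - b))"
        unfolding e_def c_def by (simp add: power2_eq_square algebra_simps)
      then have "\<bar>(snd (z i) - b)\<^sup>2 - e\<^sup>2\<bar> = \<bar>c - b\<bar> * \<bar>2 * e + (c - b)\<bar>"
        by (simp add: abs_mult)
      also have "\<dots> \<le> (2 * K) * (2 * \<bar>e\<bar> + 2 * K)"
        using bc K by (intro mult_mono) auto
      also have "\<dots> \<le> (4 * K + 4 * K\<^sup>2) * (1 + \<bar>e\<bar>)"
        using K by (simp add: power2_eq_square algebra_simps)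
      finally show ?thesis using True by (simp add: b_def e_def c_def)
    qed
  qed
  also have "\<dots> = (4 * K + 4 * K\<^sup>2) * abs_noise n (near_knots r) z"
    unfolding segment_stat_def sum_distrib_left ..
  finally show ?thesis .
qed

text \<open>The interaction of a level change with a knot change. Each loss difference in the levels
  is a difference of squares with factor \<open>a j - a0 j\<close>, and off
  \<open>near_knots r\<close> the two differences agree. The factor \<open>\<tau>\<close> is the
  gain over \<open>loss_shift\<close>: for \<open>\<tau>\<close> of order \<open>1 / sqrt n\<close>
  the interaction vanishes although the effect of the knots alone need not, and this is what lets
  the likelihood factorise.\<close>

lemma loss_shift_difference:
  assumes z: "in_design n z"
    and s: "s \<in> locations \<delta> k" and r: "\<And>j. j \<in> {1..<k} \<Longrightarrow> \<bar>s j - s0 j\<bar> \<le> r"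
    and a: "a \<in> levels K k" and \<tau>: "\<And>j. j \<in> {1..k} \<Longrightarrow> \<bar>a j - a0 j\<bar> \<le> \<tau>"
  shows "\<bar>(loss n z a s - loss n z a s0) - (loss n z a0 s - loss n z a0 s0)\<bar>
    \<le> (4 + 8 * K) * \<tau> * abs_noise n (near_knots r) z"
proof -
  let ?e = "\<lambda>i. snd (z i) - f0 (fst (z i))"
  let ?d = "\<lambda>i s. (snd (z i) - step_fun (k, a, s) (fst (z i)))\<^sup>2 - (snd (z i) - step_fun (k, a0, s) (fst (z i)))\<^sup>2"
  have "0 \<le> \<tau>" using \<tau>[of 1] k by force
  have "\<bar>(loss n z a s - loss n z a s0) - (loss n z a0 s - loss n z a0 s0)\<bar> =
      \<bar>\<Sum>i\<in>{1..n}. ?d i s - ?d i s0\<bar>"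
    by (simp add: loss_def sum_subtractf)
  also have "\<dots> \<le> (\<Sum>i\<in>{1..n}. ((4 + 8 * K) * \<tau>) * (indicator (near_knots r) (fst (z i)) * (1 + \<bar>?e i\<bar>)))"
  proof (rule order.trans[OF sum_abs sum_mono])
    fix i assume i: "i \<in> {1..n}"
    show "\<bar>?d i s - ?d i s0\<bar> \<le> ((4 + 8 * K) * \<tau>) * (indicator (near_knots r) (fst (z i)) * (1 + \<bar>?e i\<bar>))"
    proof (cases "fst (z i) \<in> near_knots r")
      case False
      then show ?thesis using step_fun_transfer[OF s r in_designD[OF z i] False] by simp
    next
      case True
      have d: "\<bar>?d i t\<bar> \<le> \<tau> * (2 * \<bar>?e i\<bar> + 4 * K)" if t: "t \<in> locations \<delta> k" for t
      proof -
        obtain j where j: "j \<in> {1..k}" "fst (z i) \<in> segment k t j"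
          using segment_exists[OF t k in_designD[OF z i]] .
        define b b0 c e where "b = a j" and "b0 = a0 j" and "c = f0 (fst (z i))" and "e = ?e i"
        have bc: "\<bar>b\<bar> \<le> K" "\<bar>b0\<bar> \<le> K" "\<bar>c\<bar> \<le> K" "\<bar>b - b0\<bar> \<le> \<tau>"
          unfolding b_def c_def b0_def
          using step_fun_bound[OF a0 s0 in_designD[OF z i]] level_bound[OF a0 j(1)] level_bound[OF a j(1)] \<tau>[OF j(1)] by auto
        have "?d i t = (b0 - b) * (2 * e + (2 * c - b - b0))"
          unfolding step_fun_segment[OF t \<delta> j] e_def c_def b_def b0_def
          by (simp add: power2_eq_square algebra_simps)
        then have "\<bar>?d i t\<bar> = \<bar>b0 - b\<bar> * \<bar>2 * e + (2 * c - b - b0)\<bar>"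
          by (simp add: abs_mult)
        also have "\<dots> \<le> \<tau> * (2 * \<bar>e\<bar> + 4 * K)"
          using bc \<open>0 \<le> \<tau>\<close> by (intro mult_mono) auto
        finally show ?thesis unfolding e_def .
      qed
      have "\<bar>?d i s - ?d i s0\<bar> \<le> \<tau> * (2 * \<bar>?e i\<bar> + 4 * K) + \<tau> * (2 * \<bar>?e i\<bar> + 4 * K)"
        using d[OF s] d[OF s0] by linarith
      also have "\<dots> = \<tau> * (4 * \<bar>?e i\<bar> + 8 * K)"
        by (simp add: algebra_simps)
      also have "\<dots> \<le> \<tau> * ((4 + 8 * K) * (1 + \<bar>?e i\<bar>))"
        using \<open>0 \<le> \<tau>\<close> K by (intro mult_left_mono) (auto simp: algebra_simps)
      finally show ?thesis using True by (simp add: mult_ac)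
    qed
  qed
  also have "\<dots> = (4 + 8 * K) * \<tau> * abs_noise n (near_knots r) z"
    unfolding segment_stat_def sum_distrib_left ..
  finally show ?thesis .
qed

text \<open>The explicit minimiser \<open>c\<close> of the quadratic is compared with
  \<open>b\<close>: the excess loss of \<open>b\<close> is a sum of squares weighted by the counts,
  and it is at most 0. Positive counts make every square vanish.\<close>

lemma level_mle_eq:
  assumes z: "in_design n z"
    and mle: "is_level_mle k s0 n z b"
    and pos: "\<And>j. j \<in> {1..k} \<Longrightarrow> 0 < count n (segment k s0 j) z" and j: "j \<in> {1..k}"
  shows "b j - a0 j = noise_sum n (segment k s0 j) z / count n (segment k s0 j) z"
proof -
  let ?N = "\<lambda>j. count n (segment k s0 j) z" and ?S = "\<lambda>j. noise_sum n (segment k s0 j) z"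
  define c where "c = restrict (\<lambda>j. a0 j + ?S j / ?N j) {1..k}"
  have "likelihood n z (k, c, s0) \<le> likelihood n z (k, b, s0)"
    using mle unfolding is_level_mle_def is_arg_max_def by (auto simp: c_def not_less)
  then have "exp (- loss n z c s0 / 2) \<le> exp (- loss n z b s0 / 2)"
    unfolding likelihood_eq[OF z] by (subst (asm) mult_le_cancel_left_pos) auto
  then have "loss n z b s0 - loss n z c s0 \<le> 0" by simp
  also have "loss n z b s0 - loss n z c s0 = (\<Sum>j\<in>{1..k}. ?N j * (b j - c j)\<^sup>2)"
    unfolding loss_quadratic[OF z, of b] loss_quadratic[OF z, of c] add_diff_cancel_left sum_subtractf[symmetric]
  proof (rule sum.cong)
    fix j assume "j \<in> {1..k}"
    then have "0 < ?N j" "c j - a0 j = ?S j / ?N j" using pos by (auto simp: c_def)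
    then have eq: "?S j = ?N j * (c j - a0 j)" by simp
    show "?N j * (b j - a0 j)\<^sup>2 - 2 * (b j - a0 j) * ?S j - (?N j * (c j - a0 j)\<^sup>2 - 2 * (c j - a0 j) * ?S j)
        = ?N j * (b j - c j)\<^sup>2"
      unfolding eq by (simp add: power2_eq_square algebra_simps)
  qed simp
  finally have le: "(\<Sum>j\<in>{1..k}. ?N j * (b j - c j)\<^sup>2) \<le> 0" .
  have "?N j * (b j - c j)\<^sup>2 \<le> (\<Sum>j\<in>{1..k}. ?N j * (b j - c j)\<^sup>2)"
  proof (rule member_le_sum[OF j])
    fix i assume "i \<in> {1..k} - {j}"
    then show "0 \<le> ?N i * (b i - c i)\<^sup>2" using pos[of i] by (intro mult_nonneg_nonneg) auto
  qed simp
  with le have "?N j * (b j - c j)\<^sup>2 \<le> 0" by linarith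
  then have "b j = c j" using pos[OF j] by (auto simp: mult_le_0_iff)
  then show ?thesis using j by (simp add: c_def)
qed

text \<open>Recentring a quadratic at its minimiser removes the linear term.\<close>

lemma loss_around_mle:
  assumes z: "in_design n z"
    and mle: "is_level_mle k s0 n z b"
    and pos: "\<And>j. j \<in> {1..k} \<Longrightarrow> 0 < count n (segment k s0 j) z"
  shows "loss n z a s0 = loss n z b s0 + (\<Sum>j\<in>{1..k}. count n (segment k s0 j) z * (a j - b j)\<^sup>2)"
proof -
  let ?N = "\<lambda>j. count n (segment k s0 j) z" and ?S = "\<lambda>j. noise_sum n (segment k s0 j) z"
  have "loss n z a s0 - loss n z b s0 = (\<Sum>j\<in>{1..k}. ?N j * (a j - b j)\<^sup>2)"
    unfolding loss_quadratic[OF z, of a] loss_quadratic[OF z, of b] add_diff_cancel_left sum_subtractf[symmetric]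
  proof (rule sum.cong)
    fix j assume j: "j \<in> {1..k}"
    then have eq: "?S j = ?N j * (b j - a0 j)" using level_mle_eq[OF z mle pos, of j] pos[of j] by simp
    show "?N j * (a j - a0 j)\<^sup>2 - 2 * (a j - a0 j) * ?S j - (?N j * (b j - a0 j)\<^sup>2 - 2 * (b j - a0 j) * ?S j)
        = ?N j * (a j - b j)\<^sup>2"
      unfolding eq by (simp add: power2_eq_square algebra_simps)
  qed simp
  then show ?thesis by simp
qed

end

section \<open>Tests for the levels and the knots\<close>

text \<open>Writing \<open>p = C * exp (- L)\<close>, each bound says
  \<open>c * y i \<le> L\<close>, and the average of the \<open>y i\<close> inherits it; passing to
  the sum costs the factor \<open>m\<close>. \<open>p \<le> C\<close> gives
  \<open>0 \<le> L\<close>, so that \<open>card J\<close> may be replaced by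
  \<open>m\<close>.\<close>

lemma exp_bound_sum:
  fixes p c C :: real
  assumes J: "finite J" "card J \<le> m" and "0 < m" "0 \<le> c" "0 < C" "p \<le> C"
    and le: "\<And>i. i \<in> J \<Longrightarrow> p \<le> C * exp (- (c * y i))"
  shows "p \<le> C * exp (- (c / real m * sum y J))"
proof (cases "0 < p")
  case True
  define L where "L = ln (C / p)"
  have p: "p = C * exp (- L)"
    unfolding L_def using True \<open>0 < C\<close> by (simp add: exp_minus)
  have "0 \<le> L" unfolding L_def using True \<open>p \<le> C\<close> by simp
  have "c * y i \<le> L" if "i \<in> J" for i
    using le[OF that] \<open>0 < C\<close> unfolding p by simp
  then have "(\<Sum>i\<in>J. c * y i) \<le> real (card J) * L"
    by (intro sum_bounded_above) auto
  also have "\<dots> \<le> real m * L"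
    using \<open>0 \<le> L\<close> J by (intro mult_right_mono) auto
  finally have "c / real m * sum y J \<le> L"
    using \<open>0 < m\<close> by (simp add: sum_distrib_left[symmetric] field_simps)
  then show ?thesis unfolding p using \<open>0 < C\<close> by simp
next
  case False
  moreover have "0 < C * exp (- (c / real m * sum y J))" using \<open>0 < C\<close> by simp
  ultimately show ?thesis by linarith
qed

text \<open>Induction upwards gives \<open>j \<le> \<sigma> j\<close>, induction downwards from
  \<open>k - 1\<close> gives \<open>\<sigma> j \<le> j\<close>.\<close>

lemma strict_mono_selfmap_eq:
  fixes \<sigma> :: "nat \<Rightarrow> nat"
  assumes maps: "\<And>j. j \<in> {1..<k} \<Longrightarrow> \<sigma> j \<in> {1..<k}"
    and mono: "\<And>i j. i \<in> {1..<k} \<Longrightarrow> j \<in> {1..<k} \<Longrightarrow> i < j \<Longrightarrow> \<sigma> i < \<sigma> j"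
    and j: "j \<in> {1..<k}"
  shows "\<sigma> j = j"
proof -
  have "1 \<le> j \<Longrightarrow> j < k \<Longrightarrow> j \<le> \<sigma> j" for j
  proof (induction j rule: nat_induct_at_least)
    case base
    then show ?case using maps[of 1] by auto
  next
    case (Suc j)
    then show ?case using mono[of j "Suc j"] by auto
  qed
  moreover have "i \<le> k - 1 \<Longrightarrow> 1 \<le> i \<Longrightarrow> \<sigma> i \<le> i" for i
  proof (induction i rule: inc_induct)
    case base
    then show ?case using maps[of "k - 1"] by auto
  next
    case (step i)
    then have "\<sigma> i < \<sigma> (Suc i)" by (intro mono) auto
    with step show ?case by auto
  qed
  ultimately show ?thesis using j by (intro antisym) auto
qed

text \<open>\<open>\<kappa>\<close> is a lower bound for all jumps of the truth; capping it at 1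
  keeps the tilt \<open>\<beta> / 2\<close> of the dyadic tests admissible.\<close>

locale separated_change_point = change_point +
  fixes \<kappa> :: real
  assumes \<kappa>_le_1: "\<kappa> \<le> 1" and \<kappa>: "0 < \<kappa>" "\<And>j. j \<in> {1..<k} \<Longrightarrow> \<kappa> \<le> \<bar>a0 (Suc j) - a0 j\<bar>"
begin

text \<open>A quarter of the minimal gap: knots that come \<open>\<eta>\<close>-close to different
  true knots keep their order, and segments trimmed by \<open>\<eta>\<close> at both ends retain
  length \<open>\<delta> / 2\<close>.\<close>

definition \<eta> :: real where "\<eta> = \<delta> / 4"

text \<open>The rate constant of \<open>shifted_noise_small\<close>.\<close>

definition c1 :: real where "c1 = 1 / (2 + 4 * K\<^sup>2)"

text \<open>Chosen such that \<open>\<beta> * n * r\<close> equals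
  \<open>c1 / 2 * n * r * (\<kappa> / 2)\<close>, the largest threshold for which
  \<open>shifted_noise_small\<close> detects a discrepancy of \<open>\<kappa> / 2\<close> on an
  interval of length \<open>r\<close>.\<close>

definition \<beta> :: real where "\<beta> = c1 * \<kappa> / 4"

lemma \<eta>_pos: "0 < \<eta>" and \<eta>_le: "\<eta> \<le> \<delta>"
  using \<delta> by (auto simp: \<eta>_def)

lemma c1_pos: "0 < c1"
  by (simp add: c1_def add_pos_nonneg)

lemma \<beta>_pos: "0 < \<beta>"
  using c1_pos \<kappa> by (simp add: \<beta>_def)

lemma \<delta>_le_1: "\<delta> \<le> 1"
  using knot_gap[OF s0 \<delta>, of 0 k] k by simp

definition left :: "nat \<Rightarrow> real \<Rightarrow> real set" where "left j r = {s0 j - r..<s0 j}"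

definition right :: "nat \<Rightarrow> real \<Rightarrow> real set" where "right j r = {s0 j..<s0 j + r}"

text \<open>Trimmed so that it stays inside the \<open>j\<close>-th segment of every
  \<open>s\<close> whose knots are \<open>\<eta>\<close>-close to the true ones.\<close>

definition core :: "nat \<Rightarrow> real set" where "core j = {knot k s0 (j - 1) + \<eta>..<knot k s0 j - \<eta>}"

lemma sets_tests [measurable]: "left j r \<in> sets borel" "right j r \<in> sets borel" "core j \<in> sets borel"
  by (auto simp: left_def right_def core_def)

lemma left_subset_segment:
  assumes "j \<in> {1..<k}" "r \<le> \<delta>"
  shows "left j r \<subseteq> segment k s0 j"
  using knot_step[OF s0, of j] knot_inner[OF assms(1), of s0] assms by (auto simp: left_def)

lemma right_subset_segment:
  assumes "j \<in> {1..<k}" "r \<le> \<delta>"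
  shows "right j r \<subseteq> segment k s0 (Suc j)"
  using knot_step[OF s0, of "Suc j"] knot_inner[OF assms(1), of s0] assms by (auto simp: right_def)

lemma core_subset_segment: "core j \<subseteq> segment k s0 j"
  using \<eta>_pos by (auto simp: core_def)

lemma tests_subset:
  shows "j \<in> {1..<k} \<Longrightarrow> r \<le> \<delta> \<Longrightarrow> left j r \<subseteq> {0..<1}"
    and "j \<in> {1..<k} \<Longrightarrow> r \<le> \<delta> \<Longrightarrow> right j r \<subseteq> {0..<1}"
    and "j \<in> {1..k} \<Longrightarrow> core j \<subseteq> {0..<1}"
  using left_subset_segment[of j r] right_subset_segment[of j r] core_subset_segment[of j]
    segment_subset[OF s0 \<delta> k, of j] segment_subset[OF s0 \<delta> k, of "Suc j"] by auto

lemma f0_tests: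
  shows "j \<in> {1..<k} \<Longrightarrow> r \<le> \<delta> \<Longrightarrow> x \<in> left j r \<Longrightarrow> f0 x = a0 j"
    and "j \<in> {1..<k} \<Longrightarrow> r \<le> \<delta> \<Longrightarrow> x \<in> right j r \<Longrightarrow> f0 x = a0 (Suc j)"
    and "j \<in> {1..k} \<Longrightarrow> x \<in> core j \<Longrightarrow> f0 x = a0 j"
proof -
  show "f0 x = a0 j" if "j \<in> {1..<k}" "r \<le> \<delta>" "x \<in> left j r"
    by (rule step_fun_segment[OF s0 \<delta>]) (use left_subset_segment[of j r] that in auto)
  show "f0 x = a0 (Suc j)" if "j \<in> {1..<k}" "r \<le> \<delta>" "x \<in> right j r"
    by (rule step_fun_segment[OF s0 \<delta>]) (use right_subset_segment[of j r] that in auto)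
  show "f0 x = a0 j" if "j \<in> {1..k}" "x \<in> core j"
    by (rule step_fun_segment[OF s0 \<delta>]) (use core_subset_segment[of j] that in auto)
qed

lemma measure_tests:
  shows "0 \<le> r \<Longrightarrow> measure lborel (left j r) = r"
    and "0 \<le> r \<Longrightarrow> measure lborel (right j r) = r"
    and "j \<in> {1..k} \<Longrightarrow> \<delta> / 2 \<le> measure lborel (core j)"
  using knot_step[OF s0, of j] \<delta> by (auto simp: left_def right_def core_def \<eta>_def)

text \<open>True knots are at least \<open>4 * \<eta>\<close> apart, so choosing for each one a
  close knot of \<open>s\<close> is strictly increasing. Both sides have \<open>k - 1\<close> knots,
  hence the choice is the identity.\<close>

lemma knots_matched:
  assumes s: "s \<in> locations \<delta> k" and ex: "\<And>j. j \<in> {1..<k} \<Longrightarrow> \<exists>i\<in>{1..<k}. \<bar>s i - s0 j\<bar> < \<eta>"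
    and j: "j \<in> {1..<k}"
  shows "\<bar>s j - s0 j\<bar> < \<eta>"
proof -
  obtain \<sigma> where \<sigma>: "\<And>j. j \<in> {1..<k} \<Longrightarrow> \<sigma> j \<in> {1..<k}"
    "\<And>j. j \<in> {1..<k} \<Longrightarrow> \<bar>s (\<sigma> j) - s0 j\<bar> < \<eta>"
    using ex by metis
  have "\<sigma> j = j"
  proof (rule strict_mono_selfmap_eq[OF \<sigma>(1) _ j])
    fix i j assume ij: "i \<in> {1..<k}" "j \<in> {1..<k}" "i < j"
    have "s0 i + \<delta> \<le> s0 j"
      using knot_gap[OF s0 \<delta> ij(3)] ij by (simp add: knot_def)
    then have "s (\<sigma> i) < s (\<sigma> j)"
      using \<sigma>(2)[OF ij(1)] \<sigma>(2)[OF ij(2)] \<delta> unfolding \<eta>_def by linarith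
    then have "\<not> \<sigma> j \<le> \<sigma> i"
      using knot_mono[OF s \<delta>, of "\<sigma> j" "\<sigma> i"] \<sigma>(1)[OF ij(1)] \<sigma>(1)[OF ij(2)] by (auto simp: knot_def)
    then show "\<sigma> i < \<sigma> j" by simp
  qed
  then show ?thesis using \<sigma>(2)[OF j] by simp
qed

text \<open>A true knot with no knot of \<open>s\<close> within \<open>\<eta>\<close> lies in the
  interior of one segment of \<open>s\<close>, with room \<open>\<eta>\<close> on both sides. There
  the fitted function is constant while \<open>f0\<close> jumps.\<close>

lemma knot_unmatched:
  assumes s: "s \<in> locations \<delta> k" and j: "j \<in> {1..<k}"
    and far: "\<And>i. i \<in> {1..<k} \<Longrightarrow> \<eta> \<le> \<bar>s i - s0 j\<bar>"
  obtains i where "i \<in> {1..k}" "left j \<eta> \<union> right j \<eta> \<subseteq> segment k s i"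
proof -
  have j01: "\<eta> \<le> s0 j" "s0 j + \<eta> \<le> 1"
    using knot_gap[OF s0 \<delta>, of 0 j] knot_gap[OF s0 \<delta>, of j k] j \<eta>_le by (auto simp: knot_def)
  then have "s0 j \<in> {0..<1}" using \<eta>_pos by auto
  then obtain i where i: "i \<in> {1..k}" "s0 j \<in> segment k s i"
    using segment_exists[OF s k] by blast
  have "knot k s (i - 1) \<le> s0 j - \<eta>"
  proof (cases "i = 1")
    case False
    then have "i - 1 \<in> {1..<k}" using i(1) by auto
    with far[OF this] i(2) \<eta>_pos show ?thesis by (auto simp: knot_def split: if_splits)
  qed (use j01 in simp)
  moreover have "s0 j + \<eta> \<le> knot k s i"
  proof (cases "i = k")
    case False
    then have "i \<in> {1..<k}" using i(1) by auto
    with far[OF this] i(2) \<eta>_pos show ?thesis by (auto simp: knot_def split: if_splits)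
  qed (use j01 k in simp)
  ultimately show ?thesis using i by (intro that[of i]) (auto simp: left_def right_def)
qed

text \<open>The levels are tested on the cores of the segments at the scale \<open>sqrt n\<close>, the knots on
  dyadic intervals next to them. The intervals of length below \<open>R / n\<close> are left out because
  the noise alone fails their tests too often.\<close>

definition tests :: "real \<Rightarrow> real \<Rightarrow> nat \<Rightarrow> sample \<Rightarrow> bool" where
  "tests T R n z \<longleftrightarrow>
    (\<forall>j\<in>{1..k}. \<bar>noise_sum n (core j) z\<bar> \<le> T * sqrt (real n)) \<and>
    (\<forall>j\<in>{1..<k}. \<forall>m::nat. R * 2 ^ m \<le> real n * \<eta> \<longrightarrow>
      \<bar>noise_sum n (left j (\<eta> / 2 ^ m)) z\<bar> \<le> \<beta> * real n * (\<eta> / 2 ^ m) \<and>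
      \<bar>noise_sum n (right j (\<eta> / 2 ^ m)) z\<bar> \<le> \<beta> * real n * (\<eta> / 2 ^ m))"

lemma measurable_tests [measurable]: "Measurable.pred (sample_space n) (tests T R n)"
  unfolding tests_def by measurable

section \<open>Power of the tests under a wrong parameter\<close>

definition pass_prob :: "real \<Rightarrow> real \<Rightarrow> nat \<Rightarrow> (nat \<Rightarrow> real) \<Rightarrow> (nat \<Rightarrow> real) \<Rightarrow> real" where
  "pass_prob T R n a s =
    measure (product_law n (step_fun (k, a, s))) {z \<in> space (sample_space n). tests T R n z}"

lemma emeasure_pass:
  "emeasure (product_law n (step_fun (k, a, s))) {z \<in> space (sample_space n). tests T R n z} =
    ennreal (pass_prob T R n a s)"
proof -
  interpret prob_space "product_law n (step_fun (k, a, s))"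
    by (rule prob_space_product_law) measurable
  show ?thesis by (simp only: pass_prob_def emeasure_eq_measure)
qed

lemma pass_prob_le_1: "pass_prob T R n a s \<le> 1"
proof -
  interpret prob_space "product_law n (step_fun (k, a, s))"
    by (rule prob_space_product_law) measurable
  show ?thesis unfolding pass_prob_def by (rule prob_le_1)
qed

text \<open>A single interval with constant discrepancy \<open>\<Delta>\<close> is enough: passing
  caps its noise sum at \<open>b\<close>, too low for the drift that \<open>\<Delta>\<close>
  causes.\<close>

lemma pass_prob_le_exp:
  assumes I[measurable]: "I \<in> sets borel" and sub: "I \<subseteq> {0..<1}"
    and pass: "\<And>z. tests T R n z \<Longrightarrow> \<bar>noise_sum n I z\<bar> \<le> b"
    and \<Delta>: "\<And>x. x \<in> I \<Longrightarrow> step_fun (k, a, s) x = f0 x + \<Delta>" and "\<bar>\<Delta>\<bar> \<le> 2 * K"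
    and b: "b \<le> c1 / 2 * real n * measure lborel I * \<bar>\<Delta>\<bar>"
  shows "pass_prob T R n a s \<le> exp (- (c1 / 2 * real n * measure lborel I * \<Delta>\<^sup>2))"
proof -
  have "ennreal (pass_prob T R n a s) \<le>
      emeasure (product_law n (step_fun (k, a, s))) {z \<in> space (sample_space n). \<bar>noise_sum n I z\<bar> \<le> b}"
    unfolding emeasure_pass[symmetric]
  proof (rule emeasure_mono)
    show "{z \<in> space (sample_space n). tests T R n z} \<subseteq> {z \<in> space (sample_space n). \<bar>noise_sum n I z\<bar> \<le> b}"
      using pass by blast
  qed (unfold sets_product_law, measurable)
  also have "\<dots> \<le> ennreal (exp (- (c1 / 2 * real n * measure lborel I * \<Delta>\<^sup>2)))"
    unfolding c1_def using sub \<Delta> \<open>\<bar>\<Delta>\<bar> \<le> 2 * K\<close> b[unfolded c1_def] by (intro shifted_noise_small) auto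
  finally show ?thesis by simp
qed

lemma level_diff_bound:
  assumes "a \<in> levels K k" "i \<in> {1..k}" "j \<in> {1..k}"
  shows "\<bar>a i - a0 j\<bar> \<le> 2 * K"
  using level_bound[OF assms(1,2)] level_bound[OF a0 assms(3)] by linarith

text \<open>One level \<open>a i\<close> faces both \<open>a0 j\<close> and
  \<open>a0 (Suc j)\<close>. These differ by at least \<open>\<kappa>\<close>, so on one side of the
  knot the discrepancy is at least \<open>\<kappa> / 2\<close>.\<close>

lemma pass_prob_unmatched:
  assumes a: "a \<in> levels K k" and s: "s \<in> locations \<delta> k" and j: "j \<in> {1..<k}"
    and far: "\<And>i. i \<in> {1..<k} \<Longrightarrow> \<eta> \<le> \<bar>s i - s0 j\<bar>" and R: "R \<le> real n * \<eta>"
  shows "pass_prob T R n a s \<le> exp (- (c1 * \<eta> * \<kappa>\<^sup>2 / 8 * real n))"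
proof -
  obtain i where i: "i \<in> {1..k}" and sub: "left j \<eta> \<union> right j \<eta> \<subseteq> segment k s i"
    using knot_unmatched[OF s j far] .
  have val: "step_fun (k, a, s) x = a i" if "x \<in> left j \<eta> \<union> right j \<eta>" for x
    using step_fun_segment[OF s \<delta> i] sub that by auto
  \<comment> \<open>The dyadic test of full length, \<open>m = 0\<close>.\<close>
  have pass: "\<bar>noise_sum n (left j \<eta>) z\<bar> \<le> \<beta> * real n * \<eta>" "\<bar>noise_sum n (right j \<eta>) z\<bar> \<le> \<beta> * real n * \<eta>"
    if "tests T R n z" for z
    using that j R unfolding tests_def by (auto dest!: bspec[of _ _ j] spec[of _ 0])
  have "\<exists>I \<Delta>. I \<in> {left j \<eta>, right j \<eta>} \<and> (\<forall>x\<in>I. step_fun (k, a, s) x = f0 x + \<Delta>) \<and>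
    \<bar>\<Delta>\<bar> \<le> 2 * K \<and> \<kappa> / 2 \<le> \<bar>\<Delta>\<bar>"
  proof (cases "\<kappa> / 2 \<le> \<bar>a i - a0 j\<bar>")
    case True
    then show ?thesis
      using val f0_tests(1)[OF j \<eta>_le] level_diff_bound[OF a i, of j] j
      by (intro exI[of _ "left j \<eta>"] exI[of _ "a i - a0 j"]) auto
  next
    case False
    then have "\<kappa> / 2 \<le> \<bar>a i - a0 (Suc j)\<bar>" using \<kappa>(2)[OF j] by linarith
    then show ?thesis
      using val f0_tests(2)[OF j \<eta>_le] level_diff_bound[OF a i, of "Suc j"] j
      by (intro exI[of _ "right j \<eta>"] exI[of _ "a i - a0 (Suc j)"]) auto
  qed
  then obtain I \<Delta> where I: "I \<in> {left j \<eta>, right j \<eta>}" and \<Delta>: "\<And>x. x \<in> I \<Longrightarrow> step_fun (k, a, s) x = f0 x + \<Delta>"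
    "\<bar>\<Delta>\<bar> \<le> 2 * K" "\<kappa> / 2 \<le> \<bar>\<Delta>\<bar>" by blast
  have mI: "measure lborel I = \<eta>" using I measure_tests(1,2)[of \<eta> j] \<eta>_pos by auto
  have "pass_prob T R n a s \<le> exp (- (c1 / 2 * real n * measure lborel I * \<Delta>\<^sup>2))"
  proof (rule pass_prob_le_exp[OF _ _ _ \<Delta>(1,2)])
    show "I \<in> sets borel" "I \<subseteq> {0..<1}" using I tests_subset(1,2)[OF j \<eta>_le] by auto
    show "\<bar>noise_sum n I z\<bar> \<le> \<beta> * real n * \<eta>" if "tests T R n z" for z using pass[OF that] I by auto
    have "\<beta> * real n * \<eta> = c1 / 2 * real n * \<eta> * (\<kappa> / 2)" by (simp add: \<beta>_def)
    also have "\<dots> \<le> c1 / 2 * real n * measure lborel I * \<bar>\<Delta>\<bar>"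
      unfolding mI using \<Delta>(3) c1_pos \<eta>_pos by (intro mult_left_mono) auto
    finally show "\<beta> * real n * \<eta> \<le> c1 / 2 * real n * measure lborel I * \<bar>\<Delta>\<bar>" .
  qed
  also have "\<dots> \<le> exp (- (c1 * \<eta> * \<kappa>\<^sup>2 / 8 * real n))"
  proof -
    have "(\<kappa> / 2)\<^sup>2 \<le> \<Delta>\<^sup>2" using \<Delta>(3) \<kappa>(1) by (metis abs_ge_zero power2_abs power_mono divide_nonneg_nonneg less_imp_le zero_le_numeral)
    then have "c1 / 2 * real n * \<eta> * (\<kappa> / 2)\<^sup>2 \<le> c1 / 2 * real n * \<eta> * \<Delta>\<^sup>2"
      using c1_pos \<eta>_pos by (intro mult_left_mono) auto
    then show ?thesis unfolding mI by (simp add: power2_eq_square mult_ac)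
  qed
  finally show ?thesis .
qed

context
  fixes a s :: "nat \<Rightarrow> real" and T R :: real and n :: nat
  assumes a: "a \<in> levels K k" and s: "s \<in> locations \<delta> k"
    and near: "\<And>j. j \<in> {1..<k} \<Longrightarrow> \<bar>s j - s0 j\<bar> < \<eta>" and T: "0 \<le> T" and R: "0 \<le> R"
begin

lemma core_value:
  assumes j: "j \<in> {1..k}" and x: "x \<in> core j"
  shows "step_fun (k, a, s) x = a j"
proof (rule step_fun_segment[OF s \<delta> j])
  have d: "\<bar>knot k s i - knot k s0 i\<bar> \<le> \<eta>" if "i \<le> k" for i
    using near[of i] that \<eta>_pos by (auto simp: knot_def)
  have "j \<le> k" "j - 1 \<le> k" using j by auto
  from d[OF this(1)] d[OF this(2)] x show "x \<in> segment k s j"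
    unfolding core_def by (auto simp: abs_le_iff)
qed

text \<open>If the level error is large enough for the threshold \<open>T * sqrt n\<close>, the
  Chernoff bound applies. Otherwise \<open>n * (a j - a0 j)\<^sup>2\<close> is at most
  \<open>(4 * T / (c1 * \<delta>))\<^sup>2\<close>, and the prefactor makes the right-hand side at
  least 1.\<close>

lemma pass_prob_levels:
  assumes j: "j \<in> {1..k}"
  shows "pass_prob T R n a s \<le> exp (4 * T\<^sup>2 / (c1 * \<delta>)) * exp (- (c1 * \<delta> / 4 * (real n * (a j - a0 j)\<^sup>2)))"
proof (cases "T * sqrt (real n) \<le> c1 * \<delta> / 4 * real n * \<bar>a j - a0 j\<bar>")
  case True
  have m: "\<delta> / 2 \<le> measure lborel (core j)" by (rule measure_tests(3)[OF j])
  have "pass_prob T R n a s \<le> exp (- (c1 / 2 * real n * measure lborel (core j) * (a j - a0 j)\<^sup>2))"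
  proof (rule pass_prob_le_exp)
    show "\<bar>noise_sum n (core j) z\<bar> \<le> T * sqrt (real n)" if "tests T R n z" for z
      using that j by (auto simp: tests_def)
    show "step_fun (k, a, s) x = f0 x + (a j - a0 j)" if "x \<in> core j" for x
      using core_value[OF j that] f0_tests(3)[OF j that] by simp
    have "T * sqrt (real n) \<le> c1 / 2 * real n * (\<delta> / 2) * \<bar>a j - a0 j\<bar>"
      using True by (simp add: mult_ac)
    also have "\<dots> \<le> c1 / 2 * real n * measure lborel (core j) * \<bar>a j - a0 j\<bar>"
      using m c1_pos by (intro mult_right_mono mult_left_mono) auto
    finally show "T * sqrt (real n) \<le> c1 / 2 * real n * measure lborel (core j) * \<bar>a j - a0 j\<bar>" .
  qed (use tests_subset(3)[OF j] level_diff_bound[OF a j j] in auto)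
  also have "\<dots> \<le> exp (- (c1 / 2 * real n * (\<delta> / 2) * (a j - a0 j)\<^sup>2))"
    unfolding exp_le_cancel_iff neg_le_iff_le using m c1_pos by (intro mult_right_mono mult_left_mono) auto
  also have "\<dots> = exp (- (c1 * \<delta> / 4 * (real n * (a j - a0 j)\<^sup>2)))"
    by (simp add: mult_ac)
  also have "\<dots> \<le> exp (4 * T\<^sup>2 / (c1 * \<delta>)) * exp (- (c1 * \<delta> / 4 * (real n * (a j - a0 j)\<^sup>2)))"
    using c1_pos \<delta> by simp
  finally show ?thesis .
next
  case False
  define u where "u = sqrt (real n) * \<bar>a j - a0 j\<bar>"
  have pos: "0 < sqrt (real n)" using False by (cases n) auto
  have u2: "u\<^sup>2 = real n * (a j - a0 j)\<^sup>2" by (simp add: u_def power_mult_distrib)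
  have "u * sqrt (real n) = (sqrt (real n) * sqrt (real n)) * \<bar>a j - a0 j\<bar>"
    unfolding u_def by (simp only: mult_ac)
  then have "c1 * \<delta> / 4 * u * sqrt (real n) < T * sqrt (real n)"
    using False by (simp add: mult.assoc)
  then have "c1 * \<delta> / 4 * u \<le> T" using pos by simp
  then have "u \<le> 4 * T / (c1 * \<delta>)" using c1_pos \<delta> by (simp add: field_simps)
  then have "u\<^sup>2 \<le> (4 * T / (c1 * \<delta>))\<^sup>2" by (intro power_mono) (auto simp: u_def)
  then have "c1 * \<delta> / 4 * u\<^sup>2 \<le> c1 * \<delta> / 4 * (4 * T / (c1 * \<delta>))\<^sup>2"
    using c1_pos \<delta> by (intro mult_left_mono) auto
  also have "\<dots> = 4 * T\<^sup>2 / (c1 * \<delta>)"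
    using c1_pos \<delta> by (simp add: power2_eq_square field_simps)
  finally have "1 \<le> exp (4 * T\<^sup>2 / (c1 * \<delta>) + - (c1 * \<delta> / 4 * u\<^sup>2))" by simp
  then show ?thesis
    using pass_prob_le_1[of T R n a s] unfolding exp_add u2 by linarith
qed

text \<open>Displacements below \<open>2 * R / n\<close> are absorbed by the prefactor. A level off
  by \<open>\<kappa> / 2\<close> is already rejected at an exponential rate in \<open>n\<close>, and
  displacements are at most 1; equating these rates gives \<open>c\<close>. Otherwise all levels are
  nearly right, and a displaced knot creates a discrepancy of at least \<open>\<kappa> / 2\<close>
  on a dyadic interval of comparable length.\<close>

lemma pass_prob_knots:
  assumes j: "j \<in> {1..<k}"
  defines "c \<equiv> c1 * \<kappa>\<^sup>2 * \<delta> / 16"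
  shows "pass_prob T R n a s \<le> exp (4 * T\<^sup>2 / (c1 * \<delta>) + 2 * c * R) * exp (- (c * (real n * \<bar>s j - s0 j\<bar>)))"
proof -
  let ?x = "\<bar>s j - s0 j\<bar>"
  have c: "0 < c" using c1_pos \<kappa> \<delta> by (simp add: c_def)
  have e0: "0 \<le> 4 * T\<^sup>2 / (c1 * \<delta>)" "0 \<le> 2 * c * R" using c1_pos \<delta> c R by auto
  have x1: "?x \<le> 1" using near[OF j] \<delta>_le_1 \<eta>_le by linarith
  consider (small) "real n * ?x < 2 * R" | (level) i where "i \<in> {1..k}" "\<kappa> / 2 \<le> \<bar>a i - a0 i\<bar>"
    | (test) "2 * R \<le> real n * ?x" "\<And>i. i \<in> {1..k} \<Longrightarrow> \<bar>a i - a0 i\<bar> < \<kappa> / 2"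
    by force
  then show ?thesis
  proof cases
    case small
    then have "c * (real n * ?x) \<le> c * (2 * R)" using c by (intro mult_left_mono) auto
    then have "0 \<le> 4 * T\<^sup>2 / (c1 * \<delta>) + 2 * c * R - c * (real n * ?x)" using e0 by linarith
    then have "1 \<le> exp (4 * T\<^sup>2 / (c1 * \<delta>) + 2 * c * R + - (c * (real n * ?x)))" by simp
    then show ?thesis using pass_prob_le_1[of T R n a s] unfolding exp_add[of _ "- _"] by linarith
  next
    case level
    have "(\<kappa> / 2)\<^sup>2 \<le> (a i - a0 i)\<^sup>2"
      using level(2) \<kappa>(1) power_mono[of "\<kappa> / 2" "\<bar>a i - a0 i\<bar>" 2] by simp
    then have "c1 * \<delta> / 4 * (real n * (\<kappa> / 2)\<^sup>2) \<le> c1 * \<delta> / 4 * (real n * (a i - a0 i)\<^sup>2)"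
      using c1_pos \<delta> by (intro mult_left_mono) auto
    moreover have "c1 * \<delta> / 4 * (real n * (\<kappa> / 2)\<^sup>2) = c * (real n * 1)"
      by (simp add: c_def power2_eq_square)
    moreover have "c * (real n * ?x) \<le> c * (real n * 1)"
      using x1 c by (intro mult_left_mono) auto
    ultimately have "exp (4 * T\<^sup>2 / (c1 * \<delta>) + - (c1 * \<delta> / 4 * (real n * (a i - a0 i)\<^sup>2))) \<le>
        exp (4 * T\<^sup>2 / (c1 * \<delta>) + 2 * c * R + - (c * (real n * ?x)))"
      unfolding exp_le_cancel_iff using e0 by linarith
    then show ?thesis using pass_prob_levels[OF level(1)] unfolding exp_add[of _ "- _"] by linarith
  next
    case test
    show ?thesis
    proof (cases "?x = 0")
      case True
      have "1 \<le> exp (4 * T\<^sup>2 / (c1 * \<delta>) + 2 * c * R)" using e0 by simp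
      then have "pass_prob T R n a s \<le> exp (4 * T\<^sup>2 / (c1 * \<delta>) + 2 * c * R)"
        using pass_prob_le_1[of T R n a s] by linarith
      then show ?thesis unfolding True by simp
    next
      case False
      then have x0: "0 < ?x" by simp
      have "\<exists>m. \<eta> / 2 ^ m \<le> ?x"
        using real_arch_pow_inv[of "?x / \<eta>" "1 / 2"] x0 \<eta>_pos
        by (auto simp: field_simps power_one_over intro: less_imp_le)
      \<comment> \<open>\<open>r\<close> is the largest dyadic length not exceeding the
        displacement, hence at least half of it. \<open>m\<close> is not 0 because the displacement
        is below \<open>\<eta>\<close>.\<close>
      define m where "m = (LEAST m. \<eta> / 2 ^ m \<le> ?x)"
      define r where "r = \<eta> / 2 ^ m"
      have r1: "r \<le> ?x" unfolding r_def m_def using \<open>\<exists>m. _ m\<close> by (rule LeastI_ex)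
      have "m \<noteq> 0"
      proof
        assume "m = 0"
        then show False using r1 near[OF j] unfolding r_def by simp
      qed
      then obtain m' where m': "m = Suc m'" by (cases m) auto
      have "\<not> \<eta> / 2 ^ m' \<le> ?x"
        using not_less_Least[of m' "\<lambda>m. \<eta> / 2 ^ m \<le> ?x"] m' unfolding m_def by simp
      then have r2: "?x \<le> 2 * r" by (simp add: r_def m')
      have r0: "0 < r" using \<eta>_pos by (simp add: r_def)
      have r\<delta>: "r \<le> \<delta>" using r1 near[OF j] \<eta>_le by linarith
      \<comment> \<open>The 2 in \<open>2 * R\<close> compensates for \<open>r\<close> being
        possibly only half of the displacement, so that the test of length \<open>r\<close> is among
        those imposed.\<close>
      have "2 * R \<le> real n * (2 * r)" using test(1) mult_left_mono[OF r2, of "real n"] by linarith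
      then have Rm: "R * 2 ^ m \<le> real n * \<eta>" by (simp add: r_def field_simps)
      have pass: "\<bar>noise_sum n (left j r) z\<bar> \<le> \<beta> * real n * r" "\<bar>noise_sum n (right j r) z\<bar> \<le> \<beta> * real n * r"
        if "tests T R n z" for z
        using that j Rm unfolding tests_def r_def by blast+
      have d: "knot k s0 i + \<delta> \<le> knot k s0 (Suc i)" if "i < k" for i
        using knot_step[OF s0, of "Suc i"] that by simp
      have near': "\<bar>knot k s i - knot k s0 i\<bar> \<le> \<eta>" if "i \<le> k" for i
        using near[of i] that \<eta>_pos by (auto simp: knot_def)
      have "\<exists>I \<Delta>. I \<in> {left j r, right j r} \<and> (\<forall>x\<in>I. step_fun (k, a, s) x = f0 x + \<Delta>) \<and>
        \<bar>\<Delta>\<bar> \<le> 2 * K \<and> \<kappa> / 2 \<le> \<bar>\<Delta>\<bar>"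
      \<comment> \<open>The interval lies on the side towards which the knot has moved: there
        \<open>(a, s)\<close> still carries the level from the other side of the knot.\<close>
      proof (cases "s0 j < s j")
        case True
        have j': "j - 1 < k" "j - 1 \<le> k" "Suc (j - 1) = j" "knot k s0 j = s0 j" "knot k s j = s j"
          using j by auto
        have "knot k s (j - 1) \<le> s0 j"
          using d[OF j'(1)] near'[OF j'(2)] \<delta> unfolding j'(3,4) \<eta>_def by linarith
        then have "right j r \<subseteq> segment k s j"
          using r1 True j' unfolding right_def by auto
        then have "step_fun (k, a, s) x = a j" if "x \<in> right j r" for x
          using step_fun_segment[OF s \<delta>, of j] that j by auto
        moreover have "\<bar>a j - a0 j\<bar> < \<kappa> / 2" using test(2) j by simp
        then have "\<kappa> / 2 \<le> \<bar>a j - a0 (Suc j)\<bar>" using \<kappa>(2)[OF j] by linarith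
        ultimately show ?thesis
          using f0_tests(2)[OF j r\<delta>] level_diff_bound[OF a, of j "Suc j"] j
          by (intro exI[of _ "right j r"] exI[of _ "a j - a0 (Suc j)"]) auto
      next
        case False
        have j': "j < k" "Suc j \<le> k" "knot k s0 j = s0 j" "knot k s j = s j"
          using j by auto
        have "s0 j \<le> knot k s (Suc j)"
          using d[OF j'(1)] near'[OF j'(2)] \<delta> unfolding j'(3) \<eta>_def by linarith
        then have "left j r \<subseteq> segment k s (Suc j)"
          using r1 False j' unfolding left_def by auto
        then have "step_fun (k, a, s) x = a (Suc j)" if "x \<in> left j r" for x
          using step_fun_segment[OF s \<delta>, of "Suc j"] that j by auto
        moreover have "\<bar>a (Suc j) - a0 (Suc j)\<bar> < \<kappa> / 2" using test(2) j by simp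
        then have "\<kappa> / 2 \<le> \<bar>a (Suc j) - a0 j\<bar>" using \<kappa>(2)[OF j] by linarith
        ultimately show ?thesis
          using f0_tests(1)[OF j r\<delta>] level_diff_bound[OF a, of "Suc j" j] j
          by (intro exI[of _ "left j r"] exI[of _ "a (Suc j) - a0 j"]) auto
      qed
      then obtain I \<Delta> where I: "I \<in> {left j r, right j r}" and \<Delta>: "\<And>x. x \<in> I \<Longrightarrow> step_fun (k, a, s) x = f0 x + \<Delta>"
        "\<bar>\<Delta>\<bar> \<le> 2 * K" "\<kappa> / 2 \<le> \<bar>\<Delta>\<bar>" by blast
      have mI: "measure lborel I = r" using I measure_tests(1,2)[of r j] r0 by auto
      have "pass_prob T R n a s \<le> exp (- (c1 / 2 * real n * measure lborel I * \<Delta>\<^sup>2))"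
      proof (rule pass_prob_le_exp[OF _ _ _ \<Delta>(1,2)])
        show "I \<in> sets borel" "I \<subseteq> {0..<1}" using I tests_subset(1,2)[OF j r\<delta>] by auto
        show "\<bar>noise_sum n I z\<bar> \<le> \<beta> * real n * r" if "tests T R n z" for z using pass[OF that] I by auto
        have "\<beta> * real n * r = c1 / 2 * real n * r * (\<kappa> / 2)" by (simp add: \<beta>_def)
        also have "\<dots> \<le> c1 / 2 * real n * measure lborel I * \<bar>\<Delta>\<bar>"
          unfolding mI using \<Delta>(3) c1_pos r0 by (intro mult_left_mono) auto
        finally show "\<beta> * real n * r \<le> c1 / 2 * real n * measure lborel I * \<bar>\<Delta>\<bar>" .
      qed
      also have "\<dots> \<le> exp (- (c * (real n * ?x)))"
      proof -
        have "c * (real n * ?x) = c1 / 2 * real n * (?x / 2) * (\<kappa> / 2)\<^sup>2 * \<delta>"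
          by (simp add: c_def power2_eq_square)
        also have "\<dots> \<le> c1 / 2 * real n * (?x / 2) * (\<kappa> / 2)\<^sup>2 * 1"
          using \<delta>_le_1 c1_pos by (intro mult_left_mono) auto
        also have "\<dots> \<le> c1 / 2 * real n * r * \<Delta>\<^sup>2"
          unfolding mult_1_right using r2 \<Delta>(3) \<kappa>(1) c1_pos power_mono[of "\<kappa> / 2" "\<bar>\<Delta>\<bar>" 2]
          by (intro mult_mono mult_left_mono) auto
        finally show ?thesis unfolding mI by simp
      qed
      also have "\<dots> \<le> exp (4 * T\<^sup>2 / (c1 * \<delta>) + 2 * c * R) * exp (- (c * (real n * ?x)))"
        using e0 by simp
      finally show ?thesis .
    qed
  qed
qed

end

text \<open>A knot error counts linearly and a level error quadratically, as in the squared L2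
  distance of step functions. Multiplied by \<open>n\<close> it expresses the rates
  \<open>1 / n\<close> and \<open>1 / sqrt n\<close> at once.\<close>

definition sq_dist :: "(nat \<Rightarrow> real) \<Rightarrow> (nat \<Rightarrow> real) \<Rightarrow> real" where
  "sq_dist a s = (\<Sum>j\<in>{1..<k}. \<bar>s j - s0 j\<bar>) + (\<Sum>j\<in>{1..k}. (a j - a0 j)\<^sup>2)"

text \<open>A diameter bound: it converts the rate \<open>exp (- c n)\<close> of the unmatched case
  into one in \<open>n * sq_dist a s\<close>.\<close>

lemma sq_dist_le:
  assumes a: "a \<in> levels K k" and s: "s \<in> locations \<delta> k"
  shows "sq_dist a s \<le> real k * (1 + 4 * K\<^sup>2)"
proof -
  have "(\<Sum>j\<in>{1..<k}. \<bar>s j - s0 j\<bar>) \<le> real (card {1..<k}) * 1"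
  proof (rule sum_bounded_above)
    fix j assume j: "j \<in> {1..<k}"
    then have "0 \<le> s j" "s j \<le> 1" "0 \<le> s0 j" "s0 j \<le> 1"
      using knot_bounds[OF s \<delta> k, of j] knot_bounds[OF s0 \<delta> k, of j] by auto
    then show "\<bar>s j - s0 j\<bar> \<le> 1" by linarith
  qed
  moreover have "(\<Sum>j\<in>{1..k}. (a j - a0 j)\<^sup>2) \<le> real (card {1..k}) * (4 * K\<^sup>2)"
  proof (rule sum_bounded_above)
    fix j assume j: "j \<in> {1..k}"
    show "(a j - a0 j)\<^sup>2 \<le> 4 * K\<^sup>2"
      using power_mono[OF level_diff_bound[OF a j j], of 2] by (simp add: power_mult_distrib)
  qed
  ultimately show ?thesis unfolding sq_dist_def by (simp add: algebra_simps)
qed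

lemma sq_dist_nonneg: "0 \<le> sq_dist a s"
  by (simp add: sq_dist_def sum_nonneg)

text \<open>\<open>c\<close> must not depend on \<open>T\<close> and \<open>R\<close>: the factor \<open>C\<close>, which does, is later beaten by
  \<open>exp (- c M / 2)\<close> for a large localisation radius \<open>M\<close>.\<close>

lemma pass_prob_bound:
  obtains c where "0 < c"
    "\<And>T R. 0 \<le> T \<Longrightarrow> 0 \<le> R \<Longrightarrow> \<exists>C>0. \<forall>n a s. R \<le> real n * \<eta> \<longrightarrow> a \<in> levels K k \<longrightarrow> s \<in> locations \<delta> k \<longrightarrow>
      pass_prob T R n a s \<le> C * exp (- (c * (real n * sq_dist a s)))"
proof -
  define cs where "cs = c1 * \<kappa>\<^sup>2 * \<delta> / 16"
  define ca where "ca = c1 * \<delta> / 4"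
  define D where "D = real k * (1 + 4 * K\<^sup>2)"
  define cf where "cf = c1 * \<eta> * \<kappa>\<^sup>2 / 8 / D"
  \<comment> \<open>The halves come from \<open>X + Y \<le> 2 * max X Y\<close>, applied to the knot
    part and the level part, each of which has only its own bound.\<close>
  define c where "c = min cf (min (cs / real k / 2) (ca / real k / 2))"
  have kk: "0 < D" using k unfolding D_def by (intro mult_pos_pos) (auto intro: add_pos_nonneg)
  have pos: "0 < cs" "0 < ca" "0 < cf" using c1_pos \<delta> \<kappa> \<eta>_pos kk by (auto simp: cs_def ca_def cf_def)
  then have c: "0 < c" using k by (simp add: c_def)
  show ?thesis
  proof (rule that[OF c])
    fix T R :: real assume T: "0 \<le> T" and R: "0 \<le> R"
    define C where "C = exp (4 * T\<^sup>2 / (c1 * \<delta>) + 2 * cs * R)"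
    have e0: "0 \<le> 4 * T\<^sup>2 / (c1 * \<delta>)" "0 \<le> 2 * cs * R" using c1_pos \<delta> pos R by auto
    have C1: "1 \<le> C" using e0 by (simp add: C_def)
    have "pass_prob T R n a s \<le> C * exp (- (c * (real n * sq_dist a s)))"
      if Rn: "R \<le> real n * \<eta>" and a: "a \<in> levels K k" and s: "s \<in> locations \<delta> k" for n a s
    proof (cases "\<forall>j\<in>{1..<k}. \<exists>i\<in>{1..<k}. \<bar>s i - s0 j\<bar> < \<eta>")
      case False
      then obtain j where j: "j \<in> {1..<k}" "\<And>i. i \<in> {1..<k} \<Longrightarrow> \<eta> \<le> \<bar>s i - s0 j\<bar>"
        by (auto simp: not_less)
      have "pass_prob T R n a s \<le> exp (- (c1 * \<eta> * \<kappa>\<^sup>2 / 8 * real n))"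
        by (rule pass_prob_unmatched[OF a s j Rn])
      also have "c1 * \<eta> * \<kappa>\<^sup>2 / 8 * real n = cf * (real n * D)"
        unfolding cf_def using kk by simp
      also have "exp (- \<dots>) \<le> exp (- (c * (real n * sq_dist a s)))"
        unfolding exp_le_cancel_iff neg_le_iff_le
        using sq_dist_le[OF a s, folded D_def] sq_dist_nonneg[of a s] pos c by (intro mult_mono) (auto simp: c_def)
      also have "\<dots> \<le> C * exp (- (c * (real n * sq_dist a s)))" using C1 by simp
      finally show ?thesis .
    next
      case True
      then have near: "\<bar>s j - s0 j\<bar> < \<eta>" if "j \<in> {1..<k}" for j
        using knots_matched[OF s _ that] by blast
      let ?X = "\<Sum>j\<in>{1..<k}. real n * \<bar>s j - s0 j\<bar>" and ?Y = "\<Sum>j\<in>{1..k}. real n * (a j - a0 j)\<^sup>2"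
      have XY: "0 \<le> ?X" "0 \<le> ?Y" by (auto intro: sum_nonneg)
      have X: "pass_prob T R n a s \<le> C * exp (- (cs / real k * ?X))"
        using pass_prob_knots[OF a s near T R] C1 pos k order.trans[OF pass_prob_le_1 C1]
        by (intro exp_bound_sum) (auto simp: cs_def C_def)
      have Y: "pass_prob T R n a s \<le> C * exp (- (ca / real k * ?Y))"
      proof (rule exp_bound_sum)
        fix j assume j: "j \<in> {1..k}"
        show "pass_prob T R n a s \<le> C * exp (- (ca * (real n * (a j - a0 j)\<^sup>2)))"
        proof (rule order.trans)
          show "pass_prob T R n a s \<le> exp (4 * T\<^sup>2 / (c1 * \<delta>)) * exp (- (c1 * \<delta> / 4 * (real n * (a j - a0 j)\<^sup>2)))"
            by (intro pass_prob_levels[OF a s _ T R j] near)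
        qed (unfold C_def ca_def, rule mult_right_mono, use e0 in auto)
      qed (use C1 pos k order.trans[OF pass_prob_le_1 C1] in auto)
      have "real n * sq_dist a s = ?X + ?Y"
        by (simp add: sq_dist_def sum_distrib_left distrib_left)
      moreover have "c * (?X + ?Y) \<le> max (cs / real k * ?X) (ca / real k * ?Y)"
      proof (cases "?X \<le> ?Y")
        case True
        have "c * (?X + ?Y) \<le> c * (2 * ?Y)" using True c by (intro mult_left_mono) auto
        also have "\<dots> \<le> (ca / real k / 2) * (2 * ?Y)" using XY by (intro mult_right_mono) (auto simp: c_def)
        finally show ?thesis by simp
      next
        case False
        have "c * (?X + ?Y) \<le> c * (2 * ?X)" using False c by (intro mult_left_mono) auto
        also have "\<dots> \<le> (cs / real k / 2) * (2 * ?X)" using XY by (intro mult_right_mono) (auto simp: c_def)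
        finally show ?thesis by simp
      qed
      ultimately consider "c * (real n * sq_dist a s) \<le> cs / real k * ?X" | "c * (real n * sq_dist a s) \<le> ca / real k * ?Y"
        by (auto simp: max_def split: if_splits)
      then show ?thesis
      proof cases
        case 1
        then have "C * exp (- (cs / real k * ?X)) \<le> C * exp (- (c * (real n * sq_dist a s)))" using C1 by simp
        with X show ?thesis by linarith
      next
        case 2
        then have "C * exp (- (ca / real k * ?Y)) \<le> C * exp (- (c * (real n * sq_dist a s)))" using C1 by simp
        with Y show ?thesis by linarith
      qed
    qed
    then show "\<exists>C>0. \<forall>n a s. R \<le> real n * \<eta> \<longrightarrow> a \<in> levels K k \<longrightarrow> s \<in> locations \<delta> k \<longrightarrow>
        pass_prob T R n a s \<le> C * exp (- (c * (real n * sq_dist a s)))"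
      using C1 by (intro exI[of _ C]) auto
  qed
qed

end

section \<open>Probability of the good event under the truth\<close>

lemma emeasure_UN_le_sum:
  fixes b :: "'i \<Rightarrow> real"
  assumes "finite J" "\<And>j. j \<in> J \<Longrightarrow> A j \<in> sets M" "\<And>j. j \<in> J \<Longrightarrow> emeasure M (A j) \<le> ennreal (b j)"
    "\<And>j. j \<in> J \<Longrightarrow> 0 \<le> b j"
  shows "emeasure M (\<Union>j\<in>J. A j) \<le> ennreal (\<Sum>j\<in>J. b j)"
proof -
  have "emeasure M (\<Union>j\<in>J. A j) \<le> (\<Sum>j\<in>J. emeasure M (A j))"
    using assms by (intro emeasure_subadditive_finite) auto
  also have "\<dots> \<le> (\<Sum>j\<in>J. ennreal (b j))"
    using assms by (intro sum_mono) auto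
  also have "\<dots> = ennreal (\<Sum>j\<in>J. b j)"
    using assms by (intro sum_ennreal) auto
  finally show ?thesis .
qed

lemma emeasure_Un_le_add:
  fixes b c :: real
  assumes "A \<in> sets M" "B \<in> sets M" "emeasure M A \<le> ennreal b" "emeasure M B \<le> ennreal c" "0 \<le> b" "0 \<le> c"
  shows "emeasure M (A \<union> B) \<le> ennreal (b + c)"
proof -
  have "emeasure M (A \<union> B) \<le> emeasure M A + emeasure M B"
    using assms by (intro emeasure_subadditive) auto
  also have "\<dots> \<le> ennreal b + ennreal c" using assms by (intro add_mono) auto
  finally show ?thesis using assms by (simp add: ennreal_plus)
qed

text \<open>The last term dominates a geometric sum. The \<open>2 ^ m\<close> are the relative
  failure probabilities of the dyadic tests.\<close>

lemma sum_power2_le: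
  fixes x :: real
  assumes "0 \<le> x"
  shows "finite {m::nat. 2 ^ m \<le> x}" "(\<Sum>m\<in>{m::nat. 2 ^ m \<le> x}. 2 ^ m) \<le> 2 * x"
proof -
  have sub: "{m::nat. 2 ^ m \<le> x} \<subseteq> {..nat \<lceil>x\<rceil>}"
  proof
    fix m :: nat assume "m \<in> {m. 2 ^ m \<le> x}"
    then have "2 ^ m \<le> x" by simp
    moreover have "real m < 2 ^ m" by (rule of_nat_less_two_power)
    ultimately have "real m \<le> real (nat \<lceil>x\<rceil>)" using real_nat_ceiling_ge[of x] by linarith
    then show "m \<in> {..nat \<lceil>x\<rceil>}" by simp
  qed
  then show fin: "finite {m::nat. 2 ^ m \<le> x}" using finite_subset by blast
  show "(\<Sum>m\<in>{m::nat. 2 ^ m \<le> x}. 2 ^ m) \<le> 2 * x"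
  proof (cases "{m::nat. 2 ^ m \<le> x} = {}")
    case False
    define N where "N = Max {m::nat. 2 ^ m \<le> x}"
    have N: "2 ^ N \<le> x" using Max_in[OF fin False] by (simp add: N_def)
    have "(\<Sum>m\<in>{m::nat. 2 ^ m \<le> x}. 2 ^ m) \<le> (\<Sum>m\<in>{..<Suc N}. (2::real) ^ m)"
      using Max_ge[OF fin] by (intro sum_mono2) (auto simp: N_def less_Suc_eq_le)
    also have "\<dots> = 2 ^ Suc N - 1" by (subst geometric_sum) auto
    also have "\<dots> \<le> 2 * x" using N by simp
    finally show ?thesis .
  next
    case True
    with assms show ?thesis by (simp only: sum.empty)
  qed
qed

lemma measure_subset_unit_le_1:
  assumes "I \<subseteq> {0..<1::real}" "I \<in> sets borel"
  shows "measure lborel I \<le> 1"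
proof -
  have "measure lborel I \<le> measure lborel {0..<1::real}"
    using assms by (intro measure_mono_fmeasurable) (auto simp: fmeasurable_def)
  then show ?thesis by simp
qed

context separated_change_point
begin

text \<open>The neighbourhood of radius \<open>2 / n\<close> serves the lower bound for the posterior mass, the one
  of radius \<open>M / n\<close> the local approximation. Only the bound \<open>T'\<close> may depend on \<open>M\<close>.\<close>

definition good :: "real \<Rightarrow> real \<Rightarrow> real \<Rightarrow> real \<Rightarrow> nat \<Rightarrow> sample \<Rightarrow> bool" where
  "good T R M T' n z \<longleftrightarrow> in_design n z \<and> tests T R n z \<and>
    (\<forall>j\<in>{1..k}. \<bar>noise_sum n (segment k s0 j) z\<bar> \<le> T * sqrt (real n)) \<and>
    (\<forall>j\<in>{1..k}. \<bar>count n (segment k s0 j) z - real n * seg_length k s0 j\<bar> \<le> T * sqrt (real n)) \<and>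
    abs_noise n (near_knots (2 / real n)) z \<le> T \<and> abs_noise n (near_knots (M / real n)) z \<le> T'"

lemma measurable_in_design [measurable]: "Measurable.pred (sample_space n) (in_design n)"
  unfolding in_design_def by measurable

lemma measurable_good [measurable]: "Measurable.pred (sample_space n) (good T R M T' n)"
  unfolding good_def by measurable

lemma f0_measurable: "f0 \<in> borel_measurable borel"
  by measurable

lemma not_in_design_null:
  "emeasure (product_law n f0) {z \<in> space (sample_space n). \<not> in_design n z} = 0"
proof -
  have "AE z in obs_law f0. fst z \<in> {0..<1}"
    unfolding obs_law_eq_density[OF f0_measurable]
  proof (subst AE_density)
    show "AE z in lborel. 0 < ennreal (obs_density f0 z) \<longrightarrow> fst z \<in> {0..<1}"
      by (rule AE_I2) (auto simp: obs_density_def split_beta indicator_def split: if_splits)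
    show "(\<lambda>z. ennreal (obs_density f0 z)) \<in> borel_measurable lborel"
      using measurable_compose[OF borel_measurable_obs_density[OF f0_measurable] measurable_ennreal] by simp
  qed
  then have "AE z in product_law n f0. \<forall>i\<in>{1..n}. fst (z i) \<in> {0..<1}"
    by (subst AE_finite_all) (auto intro!: AE_PiM_component prob_space_obs_law)
  then have "AE z in product_law n f0. in_design n z" unfolding in_design_def .
  then show ?thesis
    by (subst (asm) AE_iff_measurable[OF _ refl]) (unfold space_product_law sets_product_law, measurable)
qed

lemma prob_not_good:
  assumes n: "1 \<le> n" and T: "0 \<le> T" and R: "0 < R" and M: "0 \<le> M"
  shows "emeasure (product_law n f0) {z \<in> space (sample_space n). \<not> good T R M T' n z}
    \<le> ennreal (6 * real k * exp (1 - T) + exp (8 * real k * exp (3 / 2) - T)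
        + exp (4 * real k * exp (3 / 2) * M - T') + 32 * real k / (\<beta>\<^sup>2 * R))"
proof -
  let ?\<mu> = "emeasure (product_law n f0)"
  let ?c = "\<lambda>P. {z \<in> space (sample_space n). P z}"
  define \<tau> where "\<tau> = T * sqrt (real n)"
  have sq: "0 < sqrt (real n)" "1 \<le> sqrt (real n)" using n by auto
  have s01: "segment k s0 j \<subseteq> {0..<1}" if "j \<in> {1..k}" for j
    by (rule segment_subset[OF s0 \<delta> k that])
  have mI: "measure lborel I \<le> 1" if "I \<in> sets borel" "I \<subseteq> {0..<1}" for I :: "real set"
    using measure_subset_unit_le_1 that by auto
  \<comment> \<open>Tilt \<open>1 / sqrt n\<close>: the quadratic term is at most 1 and the linear
    one is exactly \<open>T\<close>.\<close>
  have root_scale: "2 * exp (real n * measure lborel I * (1 / sqrt (real n))\<^sup>2 - 1 / sqrt (real n) * \<tau>) \<le> 2 * exp (1 - T)"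
    if "I \<in> sets borel" "I \<subseteq> {0..<1}" for I :: "real set"
    using mI[OF that] sq by (simp add: \<tau>_def power_divide)
  have A: "?\<mu> (?c (\<lambda>z. \<tau> \<le> \<bar>noise_sum n I z\<bar>)) \<le> ennreal (2 * exp (1 - T))"
    if I: "I \<in> sets borel" "I \<subseteq> {0..<1}" for I
    using noise_tail[OF f0_measurable I, of "1 / sqrt (real n)" n \<tau>] root_scale[OF I] sq
    by (meson dual_order.trans ennreal_leI divide_nonneg_nonneg less_imp_le zero_le_one divide_le_eq_1_pos)
  have B: "?\<mu> (?c (\<lambda>z. \<tau> \<le> \<bar>count n I z - real n * measure lborel I\<bar>)) \<le> ennreal (2 * exp (1 - T))"
    if I: "I \<in> sets borel" "I \<subseteq> {0..<1}" for I
    using count_tail[OF f0_measurable I, of "1 / sqrt (real n)" n \<tau>] root_scale[OF I] sq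
    by (meson dual_order.trans ennreal_leI divide_nonneg_nonneg less_imp_le zero_le_one divide_le_eq_1_pos)
  have V: "?\<mu> (?c (\<lambda>z. b \<le> abs_noise n (near_knots (r / real n)) z)) \<le> ennreal (exp (4 * real k * exp (3 / 2) * r - b))"
    if r: "0 \<le> r" for r b
  proof -
    have "real n * measure lborel (near_knots (r / real n)) \<le> real n * (2 * (r / real n) * real k)"
      using r by (intro mult_left_mono measure_near_knots_le) auto
    also have "\<dots> = 2 * real k * r" using n by simp
    finally have "real n * measure lborel (near_knots (r / real n)) * (2 * exp (3 / 2)) \<le> 2 * real k * r * (2 * exp (3 / 2))"
      by (intro mult_right_mono) auto
    then show ?thesis
      by (intro order.trans[OF abs_noise_tail[OF f0_measurable sets_near_knots near_knots_subset]] ennreal_leI)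
        (simp add: mult_ac)
  qed
  have \<beta>1: "\<beta> / 2 \<le> 1"
  proof -
    have "c1 \<le> 1" by (simp add: c1_def add_pos_nonneg)
    then have "c1 * \<kappa> \<le> 1 * 1" using \<kappa>_le_1 \<kappa> c1_pos by (intro mult_mono) auto
    then show ?thesis by (simp add: \<beta>_def)
  qed
  \<comment> \<open>Tilt \<open>\<beta> / 2\<close> leaves the exponent \<open>- x\<close>. The
    crude bound \<open>exp (- x) \<le> 1 / x\<close> suffices, since it already makes the sum over
    scales geometric.\<close>
  have D: "?\<mu> (?c (\<lambda>z. \<beta> * real n * r \<le> \<bar>noise_sum n I z\<bar>)) \<le> ennreal (8 / (\<beta>\<^sup>2 * (real n * r)))"
    if I: "I \<in> sets borel" "I \<subseteq> {0..<1}" "measure lborel I = r" and "0 < r" for I r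
  proof -
    define x where "x = \<beta>\<^sup>2 / 4 * (real n * r)"
    have x: "0 < x" using \<beta>_pos n \<open>0 < r\<close> by (simp add: x_def)
    have "?\<mu> (?c (\<lambda>z. \<beta> * real n * r \<le> \<bar>noise_sum n I z\<bar>)) \<le>
        ennreal (2 * exp (real n * measure lborel I * (\<beta> / 2)\<^sup>2 - \<beta> / 2 * (\<beta> * real n * r)))"
      using \<beta>1 \<beta>_pos by (intro noise_tail[OF f0_measurable I(1,2)]) auto
    also have "real n * measure lborel I * (\<beta> / 2)\<^sup>2 - \<beta> / 2 * (\<beta> * real n * r) = - x"
      using I(3) by (simp add: x_def power2_eq_square field_simps)
    also have "2 * exp (- x) \<le> 2 * (1 / x)"
    proof -
      have "x \<le> exp x" using exp_ge_add_one_self[of x] by linarith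
      then show ?thesis using x by (simp add: exp_minus inverse_eq_divide frac_le)
    qed
    then have "ennreal (2 * exp (- x)) \<le> ennreal (8 / (\<beta>\<^sup>2 * (real n * r)))"
      using x by (intro ennreal_leI) (simp add: x_def)
    finally show ?thesis .
  qed
  define J where "J = {m::nat. R * 2 ^ m \<le> real n * \<eta>}"
  have J: "J = {m::nat. 2 ^ m \<le> real n * \<eta> / R}" using R by (auto simp: J_def field_simps)
  have finJ: "finite J" and sumJ: "(\<Sum>m\<in>J. 2 ^ m) \<le> 2 * (real n * \<eta> / R)"
    using sum_power2_le[of "real n * \<eta> / R"] R \<eta>_pos unfolding J by auto
  let ?L = "\<lambda>j m. ?c (\<lambda>z. \<beta> * real n * (\<eta> / 2 ^ m) \<le> \<bar>noise_sum n (left j (\<eta> / 2 ^ m)) z\<bar>)"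
  let ?R = "\<lambda>j m. ?c (\<lambda>z. \<beta> * real n * (\<eta> / 2 ^ m) \<le> \<bar>noise_sum n (right j (\<eta> / 2 ^ m)) z\<bar>)"
  let ?A1 = "\<lambda>j. ?c (\<lambda>z. \<tau> \<le> \<bar>noise_sum n (core j) z\<bar>)"
  let ?A2 = "\<lambda>j. ?c (\<lambda>z. \<tau> \<le> \<bar>noise_sum n (segment k s0 j) z\<bar>)"
  let ?A3 = "\<lambda>j. ?c (\<lambda>z. \<tau> \<le> \<bar>count n (segment k s0 j) z - real n * measure lborel (segment k s0 j)\<bar>)"
  let ?V1 = "?c (\<lambda>z. T \<le> abs_noise n (near_knots (2 / real n)) z)"
  let ?V2 = "?c (\<lambda>z. T' \<le> abs_noise n (near_knots (M / real n)) z)"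
  let ?N = "?c (\<lambda>z. \<not> in_design n z)"
  have bad: "?L j m \<in> sets (product_law n f0)" "?R j m \<in> sets (product_law n f0)"
    "?A1 j \<in> sets (product_law n f0)" "?A2 j \<in> sets (product_law n f0)" "?A3 j \<in> sets (product_law n f0)"
    "?V1 \<in> sets (product_law n f0)" "?V2 \<in> sets (product_law n f0)" "?N \<in> sets (product_law n f0)" for j m
    by (unfold sets_product_law, measurable)
  have LR: "?\<mu> (?L j m \<union> ?R j m) \<le> ennreal (16 / (\<beta>\<^sup>2 * (real n * \<eta>)) * 2 ^ m)"
    if j: "j \<in> {1..<k}" for j m
  proof -
    have r: "\<eta> / 2 ^ m \<le> \<delta>" "0 < \<eta> / 2 ^ m"
    proof -
      have "\<eta> / 2 ^ m \<le> \<eta> / 1" using \<eta>_pos by (intro divide_left_mono) auto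
      then show "\<eta> / 2 ^ m \<le> \<delta>" using \<eta>_le by simp
    qed (use \<eta>_pos in simp)
    have "?\<mu> (?L j m \<union> ?R j m) \<le> ennreal (8 / (\<beta>\<^sup>2 * (real n * (\<eta> / 2 ^ m))) + 8 / (\<beta>\<^sup>2 * (real n * (\<eta> / 2 ^ m))))"
      using r measure_tests(1,2)[of "\<eta> / 2 ^ m" j] tests_subset(1,2)[OF j r(1)] n \<eta>_pos
      by (intro emeasure_Un_le_add D bad sets_tests) auto
    then show ?thesis by (simp add: field_simps)
  qed
  have U: "?\<mu> (\<Union>j\<in>{1..<k}. \<Union>m\<in>J. ?L j m \<union> ?R j m) \<le> ennreal (32 * real k / (\<beta>\<^sup>2 * R))"
  proof -
    have "?\<mu> (\<Union>j\<in>{1..<k}. \<Union>m\<in>J. ?L j m \<union> ?R j m) \<le>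
        ennreal (\<Sum>j\<in>{1..<k}. \<Sum>m\<in>J. 16 / (\<beta>\<^sup>2 * (real n * \<eta>)) * 2 ^ m)"
      using finJ \<eta>_pos LR
      by (intro emeasure_UN_le_sum sets.Un sets.finite_UN bad) (auto intro!: sum_nonneg mult_nonneg_nonneg divide_nonneg_nonneg)
    also have "(\<Sum>j\<in>{1..<k}. \<Sum>m\<in>J. 16 / (\<beta>\<^sup>2 * (real n * \<eta>)) * 2 ^ m) =
        real (k - 1) * (16 / (\<beta>\<^sup>2 * (real n * \<eta>)) * (\<Sum>m\<in>J. 2 ^ m))"
      by (simp add: sum_distrib_left)
    also have "\<dots> \<le> real k * (16 / (\<beta>\<^sup>2 * (real n * \<eta>)) * (2 * (real n * \<eta> / R)))"
      using sumJ \<eta>_pos by (intro mult_mono mult_left_mono) (auto intro!: sum_nonneg divide_nonneg_nonneg mult_nonneg_nonneg)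
    also have "\<dots> = 32 * real k / (\<beta>\<^sup>2 * R)"
      using n \<eta>_pos R \<beta>_pos by (simp add: field_simps)
    finally show ?thesis by (simp add: ennreal_leI order.trans)
  qed
  have l: "measure lborel (segment k s0 j) = seg_length k s0 j" if "j \<in> {1..k}" for j
    using knot_step[OF s0 that] \<delta> by (simp add: seg_length_def)
  let ?W = "?N \<union> ((\<Union>j\<in>{1..k}. ?A1 j) \<union> ((\<Union>j\<in>{1..k}. ?A2 j) \<union> ((\<Union>j\<in>{1..k}. ?A3 j) \<union>
      (?V1 \<union> (?V2 \<union> (\<Union>j\<in>{1..<k}. \<Union>m\<in>J. ?L j m \<union> ?R j m))))))"
  have sub: "?c (\<lambda>z. \<not> good T R M T' n z) \<subseteq> ?W"
  proof (rule subsetI, rule ccontr)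
    fix z assume z: "z \<in> ?c (\<lambda>z. \<not> good T R M T' n z)" and nW: "z \<notin> ?W"
    have "good T R M T' n z"
      unfolding good_def tests_def
    proof (intro conjI ballI allI impI)
      fix j m assume "j \<in> {1..<k}" "R * 2 ^ m \<le> real n * \<eta>"
      then have "j \<in> {1..<k}" "m \<in> J" by (auto simp: J_def)
      then have "z \<notin> ?L j m" "z \<notin> ?R j m" using nW by blast+
      then show "\<bar>noise_sum n (left j (\<eta> / 2 ^ m)) z\<bar> \<le> \<beta> * real n * (\<eta> / 2 ^ m)"
        "\<bar>noise_sum n (right j (\<eta> / 2 ^ m)) z\<bar> \<le> \<beta> * real n * (\<eta> / 2 ^ m)"
        using z by auto
    qed (use nW z l in \<open>auto simp: \<tau>_def not_le intro: less_imp_le\<close>)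
    with z show False by simp
  qed
  have "?\<mu> (?c (\<lambda>z. \<not> good T R M T' n z)) \<le> ?\<mu> ?W"
    using finJ by (intro emeasure_mono sub sets.Un sets.finite_UN bad) auto
  also have "\<dots> \<le> ennreal (0 + ((\<Sum>j\<in>{1..k}. 2 * exp (1 - T)) + ((\<Sum>j\<in>{1..k}. 2 * exp (1 - T)) + ((\<Sum>j\<in>{1..k}. 2 * exp (1 - T)) +
      (exp (4 * real k * exp (3 / 2) * 2 - T) + (exp (4 * real k * exp (3 / 2) * M - T') + 32 * real k / (\<beta>\<^sup>2 * R)))))))"
    using finJ not_in_design_null[of n] s01 R M tests_subset(3)
    by (intro emeasure_Un_le_add emeasure_UN_le_sum[of "{1..k}"] A B V U bad sets.Un sets.finite_UN add_nonneg_nonneg sum_nonneg) auto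
  finally show ?thesis by (simp add: algebra_simps)
qed

end

section \<open>The posterior of the levels\<close>

text \<open>A one-sided bound is enough, because the complement of \<open>E\<close> supplies the
  other side.\<close>

lemma tv_dist_le:
  assumes "prob_space P" "prob_space Q" and sets: "sets P = sets Q"
    and le: "\<And>E. E \<in> sets P \<Longrightarrow> measure P E \<le> measure Q E + c"
  shows "tv_dist P Q \<le> c"
  unfolding tv_dist_def
proof (rule cSUP_least)
  interpret P: prob_space P by fact
  interpret Q: prob_space Q by fact
  have sp: "space P = space Q" using sets by (rule sets_eq_imp_space_eq)
  fix E assume E: "E \<in> sets P"
  have "measure P (space P - E) \<le> measure Q (space P - E) + c"
    using E by (intro le) auto
  then have "measure Q E - measure P E \<le> c"
    using P.prob_compl[OF E] Q.prob_compl[of E] E sets sp by simp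
  with le[OF E] show "\<bar>measure P E - measure Q E\<bar> \<le> c" by linarith
qed auto

text \<open>Stated without probability measures: for degenerate samples the level posterior may have
  total mass 0, and the bad event still needs the trivial bound.\<close>

lemma tv_dist_le_1:
  assumes "\<And>E. E \<in> sets P \<Longrightarrow> measure P E \<le> 1" "\<And>E. E \<in> sets P \<Longrightarrow> measure Q E \<le> 1"
  shows "tv_dist P Q \<le> 1"
  unfolding tv_dist_def
proof (rule cSUP_least)
  fix E assume "E \<in> sets P"
  with assms[of E] show "\<bar>measure P E - measure Q E\<bar> \<le> 1"
    using measure_nonneg[of P E] measure_nonneg[of Q E] by linarith
qed auto

lemma likelihood_nonneg: "0 \<le> likelihood n z \<theta>"
  unfolding likelihood_def obs_density_def by (intro prod_nonneg) (auto split: prod.split)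

lemma likelihood_le_1: "likelihood n z \<theta> \<le> 1"
proof -
  have "1 \<le> sqrt (2 * pi)" using pi_gt3 by simp
  then have "normal_density \<mu> 1 y \<le> 1" for \<mu> y
    unfolding normal_density_def using mult_mono[of "1 / sqrt (2 * pi)" 1 "exp (- (y - \<mu>)\<^sup>2 / 2)" 1] by simp
  then show ?thesis
    unfolding likelihood_def obs_density_def
    by (intro prod_le_1) (auto split: prod.split simp: indicator_def)
qed

text \<open>Unnormalised posterior density of \<open>(a, s)\<close> given \<open>k\<close> segments,
  relative to Lebesgue measure. The mixture weight \<open>p k\<close> and the evidence are left out,
  as they cancel on conditioning.\<close>

definition post_weight ::
  "real \<Rightarrow> real \<Rightarrow> (nat \<Rightarrow> (nat \<Rightarrow> real) \<Rightarrow> (nat \<Rightarrow> real) \<Rightarrow> real) \<Rightarrow>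
    (nat \<Rightarrow> (nat \<Rightarrow> real) \<Rightarrow> real) \<Rightarrow> nat \<Rightarrow> nat \<Rightarrow> sample \<Rightarrow> (nat \<Rightarrow> real) \<times> (nat \<Rightarrow> real) \<Rightarrow> ennreal" where
  "post_weight K \<delta> \<pi>a \<pi>t k n z = (\<lambda>(a, s). ennreal (likelihood n z (k, a, s)) *
     (ennreal (\<pi>a k a s * \<pi>t k s) * indicator (levels K k \<times> locations \<delta> k) (a, s)))"

context
  fixes K \<delta> :: real and kmax k :: nat and p :: "nat \<Rightarrow> real"
    and \<pi>a :: "nat \<Rightarrow> (nat \<Rightarrow> real) \<Rightarrow> (nat \<Rightarrow> real) \<Rightarrow> real" and \<pi>t :: "nat \<Rightarrow> (nat \<Rightarrow> real) \<Rightarrow> real"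
  assumes dens: "prior_densities K \<delta> kmax \<pi>a \<pi>t" and k: "k \<in> {1..kmax}"
    and p: "\<And>k. k \<in> {1..kmax} \<Longrightarrow> 0 < p k" "(\<Sum>k\<in>{1..kmax}. p k) = 1"
begin

private abbreviation "Q \<equiv> prior K \<delta> kmax p \<pi>a \<pi>t"

private abbreviation "AS \<equiv> lebesgue_pow {1..k} \<Otimes>\<^sub>M lebesgue_pow {1..<k}"

private lemma \<pi>_measurable [measurable]:
  "(\<lambda>(a, s). \<pi>a k a s) \<in> borel_measurable AS" "\<pi>t k \<in> borel_measurable (lebesgue_pow {1..<k})"
  using dens k by (auto simp: prior_densities_def)

private lemma density_measurable [measurable]:
  "(\<lambda>(a, s). ennreal (\<pi>a k a s * \<pi>t k s) * indicator (levels K k \<times> locations \<delta> k) (a, s)) \<in> borel_measurable AS"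
  unfolding split_beta by measurable

private lemma fst_set [measurable]: "{\<theta>. fst \<theta> = j} \<in> sets param_space"
proof -
  have "fst -` {j} \<inter> space param_space \<in> sets param_space"
    unfolding param_space_def by (rule measurable_sets[OF measurable_fst]) auto
  then show ?thesis by (simp add: vimage_def)
qed

text \<open>Each component carries its number of segments as a tag, so restricting the mixture to
  the tag \<open>k\<close> leaves \<open>p k\<close> times the component \<open>k\<close>.\<close>

lemma nn_integral_prior_component:
  assumes f[measurable]: "f \<in> borel_measurable param_space"
  shows "(\<integral>\<^sup>+\<theta>. f \<theta> * indicator {\<theta>. fst \<theta> = k} \<theta> \<partial>Q) = ennreal (p k) *
    (\<integral>\<^sup>+w. f (k, w) * (case w of (a, s) \<Rightarrow> ennreal (\<pi>a k a s * \<pi>t k s) * indicator (levels K k \<times> locations \<delta> k) (a, s)) \<partial>AS)"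
proof -
  let ?C = "prior_component K \<delta> \<pi>a \<pi>t"
  have eq: "density Q (indicator {\<theta>. fst \<theta> = k}) = scale_measure (ennreal (p k)) (?C k)"
  proof (rule measure_eqI)
    show "sets (density Q (indicator {\<theta>. fst \<theta> = k})) = sets (scale_measure (ennreal (p k)) (?C k))"
      by (simp add: prior_component_def)
  next
    fix A assume "A \<in> sets (density Q (indicator {\<theta>. fst \<theta> = k}))"
    then have A[measurable]: "A \<in> sets param_space" by simp
    have comp: "emeasure (?C j) (A \<inter> {\<theta>. fst \<theta> = k}) = (if j = k then emeasure (?C k) A else 0)" for j
    proof -
      have "emeasure (?C j) B = emeasure (density (lebesgue_pow {1..j} \<Otimes>\<^sub>M lebesgue_pow {1..<j})
          (\<lambda>(a, s). ennreal (\<pi>a j a s * \<pi>t j s) * indicator (levels K j \<times> locations \<delta> j) (a, s)))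
          ((\<lambda>(a, s). (j, a, s)) -` B \<inter> space (lebesgue_pow {1..j} \<Otimes>\<^sub>M lebesgue_pow {1..<j}))"
        if "B \<in> sets param_space" for B
        unfolding prior_component_def using that measurable_tag_segments[of j]
        by (subst emeasure_distr) auto
      moreover have "(\<lambda>(a, s). (j, a, s)) -` (A \<inter> {\<theta>. fst \<theta> = k}) = (if j = k then (\<lambda>(a, s). (k, a, s)) -` A else {})"
        by auto
      ultimately show ?thesis by auto
    qed
    have "emeasure (density Q (indicator {\<theta>. fst \<theta> = k})) A = emeasure Q (A \<inter> {\<theta>. fst \<theta> = k})"
      by (subst emeasure_density) (auto simp: nn_integral_indicator[symmetric] indicator_inter_arith mult.commute simp del: nn_integral_indicator)
    also have "\<dots> = ennreal (p k) * emeasure (?C k) A"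
      using k by (subst emeasure_prior) (auto simp: comp if_distrib[of "\<lambda>x. _ * x"] sum.delta cong: if_cong)
    finally show "emeasure (density Q (indicator {\<theta>. fst \<theta> = k})) A = emeasure (scale_measure (ennreal (p k)) (?C k)) A"
      by simp
  qed
  have "(\<integral>\<^sup>+\<theta>. f \<theta> * indicator {\<theta>. fst \<theta> = k} \<theta> \<partial>Q) = (\<integral>\<^sup>+\<theta>. f \<theta> \<partial>density Q (indicator {\<theta>. fst \<theta> = k}))"
    by (subst nn_integral_density) (auto simp: mult.commute)
  also have "\<dots> = ennreal (p k) * (\<integral>\<^sup>+\<theta>. f \<theta> \<partial>?C k)"
    unfolding eq by (rule nn_integral_scale_measure) (simp add: prior_component_def)
  also have "(\<integral>\<^sup>+\<theta>. f \<theta> \<partial>?C k) = (\<integral>\<^sup>+w. f (case w of (a, s) \<Rightarrow> (k, a, s)) \<partial>density AS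
      (\<lambda>(a, s). ennreal (\<pi>a k a s * \<pi>t k s) * indicator (levels K k \<times> locations \<delta> k) (a, s)))"
    unfolding prior_component_def using measurable_tag_segments[of k] by (subst nn_integral_distr) auto
  also have "\<dots> = (\<integral>\<^sup>+w. (case w of (a, s) \<Rightarrow> ennreal (\<pi>a k a s * \<pi>t k s) * indicator (levels K k \<times> locations \<delta> k) (a, s)) *
      f (case w of (a, s) \<Rightarrow> (k, a, s)) \<partial>AS)"
    by (rule nn_integral_density[OF density_measurable measurable_compose[OF measurable_tag_segments f]])
  finally show ?thesis by (simp add: split_beta mult.commute)
qed

lemma likelihood_component_measurable: "(\<lambda>w. likelihood n z (k, w)) \<in> borel_measurable AS"
  using measurable_compose[OF measurable_tag_segments[of k] borel_measurable_likelihood[of n z]] by (simp add: split_beta)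

lemma post_weight_measurable [measurable]: "post_weight K \<delta> \<pi>a \<pi>t k n z \<in> borel_measurable AS"
proof -
  have "post_weight K \<delta> \<pi>a \<pi>t k n z = (\<lambda>w. ennreal (likelihood n z (k, w)) *
     (case w of (a, s) \<Rightarrow> (ennreal (\<pi>a k a s * \<pi>t k s) * indicator (levels K k \<times> locations \<delta> k) (a, s))))"
    by (auto simp: post_weight_def)
  then show ?thesis using likelihood_component_measurable density_measurable by simp
qed

lemma level_map_measurable:
  "(\<lambda>(_, a, _). restrict a {1..k}) \<in> param_space \<rightarrow>\<^sub>M (\<Pi>\<^sub>M j\<in>{1..k}. borel)"
  unfolding param_space_def split_beta
proof (rule measurable_PiM_single')
  fix j :: nat
  have "(\<lambda>\<theta>. fst (snd \<theta>) j) \<in> borel_measurable (count_space UNIV \<Otimes>\<^sub>M ((\<Pi>\<^sub>M j\<in>UNIV. borel) \<Otimes>\<^sub>M (\<Pi>\<^sub>M j\<in>UNIV. borel)))"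
    by measurable
  then show "j \<in> {1..k} \<Longrightarrow> (\<lambda>\<theta>. restrict (fst (snd \<theta>)) {1..k} j)
      \<in> borel_measurable (count_space UNIV \<Otimes>\<^sub>M ((\<Pi>\<^sub>M j\<in>UNIV. borel) \<Otimes>\<^sub>M (\<Pi>\<^sub>M j\<in>UNIV. borel)))"
    by simp
qed auto

lemma sets_level_posterior [simp]: "sets (level_posterior Q k n z) = sets (\<Pi>\<^sub>M j\<in>{1..k}. borel)"
  by (simp add: level_posterior_def)

text \<open>The posterior of \<open>B\<close> within the component is \<open>p k / Z\<close> times
  an integral of \<open>post_weight\<close>, and the prefactor cancels in the conditional
  probability. Positive weight mass forces \<open>Z > 0\<close>, which keeps the normalised density
  from collapsing under division by zero.\<close>

lemma emeasure_level_posterior: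
  assumes E: "E \<in> sets (\<Pi>\<^sub>M j\<in>{1..k}. borel)"
    and pos: "(\<integral>\<^sup>+w. post_weight K \<delta> \<pi>a \<pi>t k n z w \<partial>AS) \<noteq> 0"
  shows "emeasure (level_posterior Q k n z) E =
    (\<integral>\<^sup>+w. post_weight K \<delta> \<pi>a \<pi>t k n z w * indicator E (fst w) \<partial>AS) / (\<integral>\<^sup>+w. post_weight K \<delta> \<pi>a \<pi>t k n z w \<partial>AS)"
proof -
  interpret Q: prob_space Q by (rule prob_space_prior[OF dens p])
  let ?S = "{\<theta>. fst \<theta> = k}"
  define Z where "Z = (\<integral>\<theta>. likelihood n z \<theta> \<partial>Q)"
  have int: "integrable Q (likelihood n z)"
    by (rule Q.integrable_const_bound[where B=1]) (auto simp: likelihood_nonneg likelihood_le_1)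
  have Z: "ennreal Z = (\<integral>\<^sup>+\<theta>. ennreal (likelihood n z \<theta>) \<partial>Q)"
    unfolding Z_def by (rule nn_integral_eq_integral[symmetric, OF int]) (auto simp: likelihood_nonneg)
  have comp: "(\<integral>\<^sup>+\<theta>. ennreal (likelihood n z \<theta>) * g \<theta> * indicator ?S \<theta> \<partial>Q) =
      ennreal (p k) * (\<integral>\<^sup>+w. post_weight K \<delta> \<pi>a \<pi>t k n z w * g (k, w) \<partial>AS)"
    if [measurable]: "g \<in> borel_measurable param_space" for g
  proof -
    have "(\<lambda>\<theta>. ennreal (likelihood n z \<theta>) * g \<theta>) \<in> borel_measurable param_space" by measurable
    from nn_integral_prior_component[OF this] show ?thesis
      by (simp add: post_weight_def split_beta mult_ac)
  qed
  have "0 < ennreal (p k) * (\<integral>\<^sup>+w. post_weight K \<delta> \<pi>a \<pi>t k n z w \<partial>AS)"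
    using pos p(1)[OF k] by (simp add: ennreal_zero_less_mult_iff zero_less_iff_neq_zero)
  also have "\<dots> = (\<integral>\<^sup>+\<theta>. ennreal (likelihood n z \<theta>) * indicator ?S \<theta> \<partial>Q)"
    using comp[of "\<lambda>_. 1"] by simp
  also have "\<dots> \<le> ennreal Z"
    unfolding Z by (intro nn_integral_mono) (auto simp: indicator_def)
  finally have Zpos: "0 < Z" by simp
  have post: "emeasure (posterior Q n z) (B \<inter> ?S) =
      ennreal (p k / Z) * (\<integral>\<^sup>+w. post_weight K \<delta> \<pi>a \<pi>t k n z w * indicator B (k, w) \<partial>AS)"
    if [measurable]: "B \<in> sets param_space" for B
  proof -
    have "emeasure (posterior Q n z) (B \<inter> ?S) = (\<integral>\<^sup>+\<theta>. ennreal (likelihood n z \<theta> / Z) * indicator (B \<inter> ?S) \<theta> \<partial>Q)"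
      unfolding Z_def by (rule emeasure_posterior) measurable
    also have "\<dots> = (\<integral>\<^sup>+\<theta>. ennreal (1 / Z) * (ennreal (likelihood n z \<theta>) * indicator B \<theta> * indicator ?S \<theta>) \<partial>Q)"
      using Zpos by (intro nn_integral_cong) (auto simp: indicator_def likelihood_nonneg simp flip: ennreal_mult)
    also have "\<dots> = ennreal (1 / Z) * (\<integral>\<^sup>+\<theta>. ennreal (likelihood n z \<theta>) * indicator B \<theta> * indicator ?S \<theta> \<partial>Q)"
      by (rule nn_integral_cmult) measurable
    also have "\<dots> = ennreal (1 / Z) * (ennreal (p k) * (\<integral>\<^sup>+w. post_weight K \<delta> \<pi>a \<pi>t k n z w * indicator B (k, w) \<partial>AS))"
      by (subst comp) auto
    also have "\<dots> = (ennreal (1 / Z) * ennreal (p k)) * (\<integral>\<^sup>+w. post_weight K \<delta> \<pi>a \<pi>t k n z w * indicator B (k, w) \<partial>AS)"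
      by (simp only: mult.assoc)
    also have "ennreal (1 / Z) * ennreal (p k) = ennreal (p k / Z)"
      using p(1)[OF k] Zpos by (simp flip: ennreal_mult)
    finally show ?thesis .
  qed
  let ?\<phi> = "\<lambda>(_ :: nat, a, _ :: nat \<Rightarrow> real). restrict a {1..k}"
  have pre[measurable]: "?\<phi> -` E \<in> sets param_space"
    using measurable_sets[OF level_map_measurable E] by simp
  have [simp]: "sets (posterior Q n z) = sets param_space" by (simp add: posterior_def)
  have sp: "space (posterior Q n z) = UNIV" using sets_eq_imp_space_eq[of "posterior Q n z" param_space] by simp
  have "emeasure (level_posterior Q k n z) E = emeasure (uniform_measure (posterior Q n z) ?S) (?\<phi> -` E)"
    unfolding level_posterior_def using level_map_measurable E sp
    by (subst emeasure_distr) (auto cong: measurable_cong_sets simp: space_uniform_measure)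
  also have "\<dots> = emeasure (posterior Q n z) (?\<phi> -` E \<inter> ?S) / emeasure (posterior Q n z) (UNIV \<inter> ?S)"
    using fst_set pre by (subst emeasure_uniform_measure) (auto simp: Int_commute)
  also have "\<dots> = (\<integral>\<^sup>+w. post_weight K \<delta> \<pi>a \<pi>t k n z w * indicator (?\<phi> -` E) (k, w) \<partial>AS) /
      (\<integral>\<^sup>+w. post_weight K \<delta> \<pi>a \<pi>t k n z w * indicator UNIV (k, w) \<partial>AS)"
  proof -
    have "UNIV \<in> sets param_space" using sets.top[of param_space] by simp
    then show ?thesis
      unfolding post[OF pre] post[OF \<open>UNIV \<in> sets param_space\<close>] using p(1)[OF k] Zpos
      by (subst (1 2) mult.commute, intro divide_mult_eq) auto
  qed
  also have "(\<integral>\<^sup>+w. post_weight K \<delta> \<pi>a \<pi>t k n z w * indicator (?\<phi> -` E) (k, w) \<partial>AS) =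
      (\<integral>\<^sup>+w. post_weight K \<delta> \<pi>a \<pi>t k n z w * indicator E (fst w) \<partial>AS)"
  proof (rule nn_integral_cong)
    fix w assume "w \<in> space AS"
    then have "restrict (fst w) {1..k} = fst w"
      by (auto simp: space_pair_measure space_PiM PiE_def intro!: extensional_restrict)
    then show "post_weight K \<delta> \<pi>a \<pi>t k n z w * indicator (?\<phi> -` E) (k, w) = post_weight K \<delta> \<pi>a \<pi>t k n z w * indicator E (fst w)"
      by (auto simp: indicator_def split_beta)
  qed
  finally show ?thesis by simp
qed

text \<open>Holds for every sample: the mass of the component divided by itself is 1, or 0 when that
  mass is 0 or infinite.\<close>

lemma measure_level_posterior_le_1: "measure (level_posterior Q k n z) E \<le> 1"
proof (cases "E \<in> sets (\<Pi>\<^sub>M j\<in>{1..k}. borel)")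
  case True
  let ?\<phi> = "\<lambda>(_ :: nat, a, _ :: nat \<Rightarrow> real). restrict a {1..k}" and ?S = "{\<theta> \<in> space param_space. fst \<theta> = k}"
  have pre: "?\<phi> -` E \<in> sets param_space"
    using measurable_sets[OF level_map_measurable True] by simp
  have [simp]: "sets (posterior Q n z) = sets param_space" by (simp add: posterior_def)
  have sp: "space (posterior Q n z) = UNIV" using sets_eq_imp_space_eq[of "posterior Q n z" param_space] by simp
  have "emeasure (level_posterior Q k n z) E = emeasure (uniform_measure (posterior Q n z) ?S) (?\<phi> -` E)"
    unfolding level_posterior_def using level_map_measurable True sp
    by (subst emeasure_distr) (auto cong: measurable_cong_sets simp: space_uniform_measure)
  also have "\<dots> = emeasure (posterior Q n z) (?S \<inter> ?\<phi> -` E) / emeasure (posterior Q n z) ?S"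
    using fst_set pre by (subst emeasure_uniform_measure) auto
  also have "\<dots> \<le> emeasure (posterior Q n z) ?S / emeasure (posterior Q n z) ?S"
    using fst_set by (intro divide_right_mono_ennreal emeasure_mono) auto
  also have "\<dots> \<le> 1"
    by (cases "emeasure (posterior Q n z) ?S = 0 \<or> emeasure (posterior Q n z) ?S = \<top>")
      (auto simp: ennreal_divide_self less_top)
  finally show ?thesis unfolding measure_def by (intro enn2real_leI) auto
qed (simp add: measure_notin_sets)

end

section \<open>The likelihood near the true parameter\<close>

lemma neg_half_le:
  fixes x y c :: real
  shows "x - y \<le> c \<Longrightarrow> - c / 2 + - y / 2 \<le> - x / 2" "y - x \<le> c \<Longrightarrow> - x / 2 \<le> c / 2 + - y / 2"
  by (simp_all add: field_simps)

lemma normal_density_precision: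
  fixes w :: real
  assumes "0 < w"
  shows "normal_density \<mu> (sqrt (1 / w)) x = sqrt (w / (2 * pi)) * exp (- (w * (x - \<mu>)\<^sup>2) / 2)"
proof -
  have 1: "(sqrt (1 / w))\<^sup>2 = 1 / w" using assms by simp
  have "1 / sqrt (2 * pi * (1 / w)) = sqrt (1 / (2 * pi * (1 / w)))" by (simp add: real_sqrt_divide)
  also have "1 / (2 * pi * (1 / w)) = w / (2 * pi)" using assms by simp
  finally have 2: "1 / sqrt (2 * pi * (1 / w)) = sqrt (w / (2 * pi))" .
  show ?thesis
    unfolding normal_density_def 1 2 by (simp add: field_simps)
qed

context separated_change_point
begin

lemma goodD:
  assumes "good T R M T' n z"
  shows "in_design n z" "tests T R n z"
    "\<And>j. j \<in> {1..k} \<Longrightarrow> \<bar>noise_sum n (segment k s0 j) z\<bar> \<le> T * sqrt (real n)"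
    "\<And>j. j \<in> {1..k} \<Longrightarrow> \<bar>count n (segment k s0 j) z - real n * seg_length k s0 j\<bar> \<le> T * sqrt (real n)"
    "abs_noise n (near_knots (2 / real n)) z \<le> T" "abs_noise n (near_knots (M / real n)) z \<le> T'"
  using assms unfolding good_def by blast+

lemma seg_length_bounds:
  assumes "j \<in> {1..k}"
  shows "\<delta> \<le> seg_length k s0 j" "seg_length k s0 j \<le> 1"
proof -
  show "\<delta> \<le> seg_length k s0 j" using knot_step[OF s0 assms] by (simp add: seg_length_def)
  have "0 \<le> knot k s0 (j - 1)" "knot k s0 j \<le> 1"
    by (rule knot_bounds[OF s0 \<delta> k]; use assms in auto)+
  then show "seg_length k s0 j \<le> 1" by (simp add: seg_length_def)
qed

text \<open>Upper bound on the good event for the increase of the loss over the small neighbourhood: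
  interaction, knot shift and level quadratic, in this order. It involves \<open>T\<close> alone, so
  that \<open>M\<close> can later be chosen against it.\<close>

definition loss_budget :: "real \<Rightarrow> real" where
  "loss_budget T = (4 + 8 * K) * T + (4 * K + 4 * K\<^sup>2) * T + real k * (1 + 3 * T)"

text \<open>The step from \<open>(a0, s0)\<close> to \<open>(a, s)\<close> is split into the level
  change at \<open>s0\<close>, the knot change at \<open>a0\<close> and their interaction. For level
  errors up to \<open>1 / sqrt n\<close> each quadratic summand is at most \<open>1 + T\<close>,
  each gradient term at most \<open>2 * T\<close>.\<close>

lemma likelihood_lower_bound:
  assumes good: "good T R M T' n z" and n: "1 \<le> n" and T: "0 \<le> T"
    and a: "a \<in> levels K k" and s: "s \<in> locations \<delta> k"
    and a_near: "\<And>j. j \<in> {1..k} \<Longrightarrow> \<bar>a j - a0 j\<bar> \<le> 1 / sqrt (real n)"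
    and s_near: "\<And>j. j \<in> {1..<k} \<Longrightarrow> \<bar>s j - s0 j\<bar> \<le> 2 / real n"
  shows "exp (- loss_budget T / 2) * likelihood n z (k, a0, s0)
    \<le> likelihood n z (k, a, s)"
proof -
  note g = goodD[OF good]
  have sq: "0 < sqrt (real n)" "1 \<le> sqrt (real n)" using n by auto
  let ?V = "abs_noise n (near_knots (2 / real n)) z"
  have V: "0 \<le> ?V" unfolding segment_stat_def by (intro sum_nonneg) auto
  have "\<bar>(loss n z a s - loss n z a s0) - (loss n z a0 s - loss n z a0 s0)\<bar> \<le> (4 + 8 * K) * (1 / sqrt (real n)) * ?V"
    by (rule loss_shift_difference[OF g(1) s s_near a a_near])
  also have "\<dots> \<le> (4 + 8 * K) * 1 * T"
    using K g(5) V sq by (intro mult_mono) auto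
  finally have 1: "(loss n z a s - loss n z a s0) - (loss n z a0 s - loss n z a0 s0) \<le> (4 + 8 * K) * T" by simp
  have "\<bar>loss n z a0 s - loss n z a0 s0\<bar> \<le> (4 * K + 4 * K\<^sup>2) * ?V"
    by (rule loss_shift[OF g(1) s s_near])
  also have "\<dots> \<le> (4 * K + 4 * K\<^sup>2) * T" using K g(5) by (intro mult_left_mono) auto
  finally have 2: "loss n z a0 s - loss n z a0 s0 \<le> (4 * K + 4 * K\<^sup>2) * T" by simp
  have "loss n z a s0 - loss n z a0 s0 = (\<Sum>j\<in>{1..k}. count n (segment k s0 j) z * (a j - a0 j)\<^sup>2
      - 2 * (a j - a0 j) * noise_sum n (segment k s0 j) z)"
    using loss_quadratic[OF g(1), of a] by simp
  also have "\<dots> \<le> real (card {1..k}) * (1 + 3 * T)"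
  proof (rule sum_bounded_above)
    fix j assume j: "j \<in> {1..k}"
    define N S d where "N = count n (segment k s0 j) z" and "S = noise_sum n (segment k s0 j) z" and "d = a j - a0 j"
    have "0 \<le> N" unfolding N_def segment_stat_def by (intro sum_nonneg) auto
    have "real n * seg_length k s0 j \<le> real n * 1" using seg_length_bounds[OF j] by (intro mult_left_mono) auto
    moreover have "T * sqrt (real n) \<le> T * real n" using T n by (intro mult_left_mono) (auto simp: real_sqrt_le_iff sqrt_le_D real_le_lsqrt power2_eq_square)
    ultimately have N: "N \<le> real n * (1 + T)" using g(4)[OF j] unfolding N_def by (simp add: algebra_simps)
    have d: "\<bar>d\<bar> \<le> 1 / sqrt (real n)" using a_near[OF j] by (simp add: d_def)
    have "d\<^sup>2 \<le> (1 / sqrt (real n))\<^sup>2" using power_mono[OF d, of 2] by simp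
    then have d2: "d\<^sup>2 \<le> 1 / real n" by (simp add: power_divide)
    have "N * d\<^sup>2 \<le> (real n * (1 + T)) * (1 / real n)"
      using N d2 \<open>0 \<le> N\<close> T by (intro mult_mono) auto
    then have "N * d\<^sup>2 \<le> 1 + T" using n by simp
    moreover have "- 2 * d * S \<le> 2 * T"
    proof -
      have "- d * S \<le> \<bar>d\<bar> * \<bar>S\<bar>" using abs_ge_self[of "- d * S"] by (simp add: abs_mult)
      also have "\<dots> \<le> 1 / sqrt (real n) * (T * sqrt (real n))"
        using d g(3)[OF j] by (intro mult_mono) (auto simp: S_def)
      finally show ?thesis using sq by (simp add: mult.commute)
    qed
    ultimately show "N * d\<^sup>2 - 2 * d * S \<le> 1 + 3 * T" by linarith
  qed
  finally have "loss n z a s - loss n z a0 s0 \<le> (4 + 8 * K) * T + (4 * K + 4 * K\<^sup>2) * T + real k * (1 + 3 * T)"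
    using 1 2 by simp
  then have "exp (- ((4 + 8 * K) * T + (4 * K + 4 * K\<^sup>2) * T + real k * (1 + 3 * T)) / 2) * exp (- loss n z a0 s0 / 2)
      \<le> exp (- loss n z a s / 2)"
    unfolding exp_add[symmetric] exp_le_cancel_iff by (rule neg_half_le)
  then have "(1 / sqrt (2 * pi)) ^ n * (exp (- ((4 + 8 * K) * T + (4 * K + 4 * K\<^sup>2) * T + real k * (1 + 3 * T)) / 2) * exp (- loss n z a0 s0 / 2))
      \<le> (1 / sqrt (2 * pi)) ^ n * exp (- loss n z a s / 2)"
    by (intro mult_left_mono) auto
  then show ?thesis unfolding likelihood_eq[OF g(1)] loss_budget_def by (simp only: mult.left_commute)
qed

definition gauss_dens :: "nat \<Rightarrow> (nat \<Rightarrow> real) \<Rightarrow> (nat \<Rightarrow> real) \<Rightarrow> real" where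
  "gauss_dens n b a = (\<Prod>j\<in>{1..k}. normal_density (b j) (sqrt (1 / (seg_length k s0 j * real n))) (a j))"

lemma gauss_dens_eq:
  assumes n: "1 \<le> n"
  shows "gauss_dens n b a = (\<Prod>j\<in>{1..k}. sqrt (seg_length k s0 j * real n / (2 * pi))) *
    exp (- (\<Sum>j\<in>{1..k}. real n * seg_length k s0 j * (a j - b j)\<^sup>2) / 2)"
proof -
  have "gauss_dens n b a = (\<Prod>j\<in>{1..k}. sqrt (seg_length k s0 j * real n / (2 * pi)) *
      exp (- (real n * seg_length k s0 j * (a j - b j)\<^sup>2) / 2))"
    unfolding gauss_dens_def
  proof (rule prod.cong)
    fix j assume "j \<in> {1..k}"
    then have l: "0 < seg_length k s0 j" using seg_length_bounds[of j] \<delta> by linarith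
    then have l': "0 < seg_length k s0 j * real n" using n by simp
    show "normal_density (b j) (sqrt (1 / (seg_length k s0 j * real n))) (a j) =
        sqrt (seg_length k s0 j * real n / (2 * pi)) * exp (- (real n * seg_length k s0 j * (a j - b j)\<^sup>2) / 2)"
      unfolding normal_density_precision[OF l'] by (simp only: mult.commute[of "seg_length k s0 j"])
  qed simp
  also have "\<dots> = (\<Prod>j\<in>{1..k}. sqrt (seg_length k s0 j * real n / (2 * pi))) *
      exp (\<Sum>j\<in>{1..k}. - (real n * seg_length k s0 j * (a j - b j)\<^sup>2) / 2)"
    by (simp add: prod.distrib exp_sum)
  finally show ?thesis by (simp add: sum_negf sum_divide_distrib)
qed

text \<open>What remains of the local likelihood after division by the Gaussian density in
  \<open>a\<close>: a function of \<open>s\<close> containing the loss at the estimator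
  \<open>b\<close> and the inverse Gaussian normalisation. Its size is never estimated.\<close>

definition location_weight :: "nat \<Rightarrow> sample \<Rightarrow> (nat \<Rightarrow> real) \<Rightarrow> (nat \<Rightarrow> real) \<Rightarrow> real" where
  "location_weight n z b s = (1 / sqrt (2 * pi)) ^ n *
    exp (- (loss n z a0 s - loss n z a0 s0 + loss n z b s0) / 2) / (\<Prod>j\<in>{1..k}. sqrt (seg_length k s0 j * real n / (2 * pi)))"

lemma gauss_norm_pos:
  assumes n: "1 \<le> n"
  shows "0 < (\<Prod>j\<in>{1..k}. sqrt (seg_length k s0 j * real n / (2 * pi)))"
proof (rule prod_pos)
  fix j assume "j \<in> {1..k}"
  then show "0 < sqrt (seg_length k s0 j * real n / (2 * pi))" using seg_length_bounds(1)[of j] \<delta> n by simp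
qed

lemma location_weight_nonneg: "0 \<le> location_weight n z b s" if "1 \<le> n"
  unfolding location_weight_def using gauss_norm_pos[OF that] by simp

text \<open>For large \<open>n\<close> the fluctuation \<open>T * sqrt n\<close> of a count is at
  most half of \<open>n * \<delta>\<close>, so every count is at least
  \<open>n * \<delta> / 2\<close>; the estimation error is a noise sum divided by a count.\<close>

lemma mle_near:
  assumes good: "good T R M T' n z" and n: "1 \<le> n" and T: "0 \<le> T" and nT: "2 * T / \<delta> \<le> sqrt (real n)" and T0: "0 < T"
    and mle: "is_level_mle k s0 n z b" and j: "j \<in> {1..k}"
  shows "0 < count n (segment k s0 j) z" "\<bar>b j - a0 j\<bar> \<le> 2 * T / \<delta> / sqrt (real n)"
proof -
  note g = goodD[OF good]
  have sq: "0 < sqrt (real n)" using n by auto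
  have pos: "real n * \<delta> / 2 \<le> count n (segment k s0 i) z" if i: "i \<in> {1..k}" for i
  proof -
    have "T * sqrt (real n) = (2 * T / \<delta>) * (sqrt (real n) * \<delta> / 2)" using \<delta> by simp
    also have "\<dots> \<le> sqrt (real n) * (sqrt (real n) * \<delta> / 2)"
      using nT \<delta> sq by (intro mult_right_mono) auto
    also have "\<dots> = (sqrt (real n) * sqrt (real n)) * \<delta> / 2" by (simp only: mult.assoc times_divide_eq_right)
    also have "\<dots> = real n * \<delta> / 2" by simp
    finally have "T * sqrt (real n) \<le> real n * \<delta> / 2" .
    moreover have "real n * \<delta> \<le> real n * seg_length k s0 i"
      using seg_length_bounds(1)[OF i] by (intro mult_left_mono) auto
    ultimately show ?thesis using g(4)[OF i] by linarith
  qed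
  have npos: "0 < real n * \<delta> / 2" using n \<delta> by simp
  have pos': "0 < count n (segment k s0 i) z" if "i \<in> {1..k}" for i
    using pos[OF that] npos by linarith
  show "0 < count n (segment k s0 j) z" by (rule pos'[OF j])
  have "\<bar>b j - a0 j\<bar> = \<bar>noise_sum n (segment k s0 j) z\<bar> / count n (segment k s0 j) z"
    using level_mle_eq[OF g(1) mle pos' j] pos'[OF j] by simp
  also have "\<dots> \<le> T * sqrt (real n) / (real n * \<delta> / 2)"
    using g(3)[OF j] pos[OF j] npos T by (intro frac_le) auto
  also have "\<dots> = 2 * T / \<delta> * (sqrt (real n) / real n)" by (simp add: mult_ac)
  also have "sqrt (real n) / real n = 1 / sqrt (real n)"
    using sq n by (simp add: field_simps)
  finally show "\<bar>b j - a0 j\<bar> \<le> 2 * T / \<delta> / sqrt (real n)" by simp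
qed

text \<open>\<open>\<zeta>\<close> has two sources: the interaction of levels and knots, and the
  replacement of the counts by their means \<open>n * seg_length\<close>, which gives the Gaussian
  its deterministic covariance. Both are of order \<open>1 / sqrt n\<close> for fixed
  \<open>M\<close>, \<open>T\<close>, \<open>T'\<close>.\<close>

lemma likelihood_local:
  fixes M T T' :: real and n :: nat
  defines "\<zeta> \<equiv> (4 + 8 * K) * (M / sqrt (real n)) * T' + T * sqrt (real n) * (real k * ((M + 2 * T / \<delta>) / sqrt (real n))\<^sup>2)"
  assumes good: "good T R M T' n z" and n: "1 \<le> n" and T: "0 < T" and M: "0 \<le> M" and T': "0 \<le> T'"
    and nT: "2 * T / \<delta> \<le> sqrt (real n)"
    and mle: "is_level_mle k s0 n z b"
    and a: "a \<in> levels K k" and s: "s \<in> locations \<delta> k"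
    and a_near: "\<And>j. j \<in> {1..k} \<Longrightarrow> \<bar>a j - a0 j\<bar> \<le> M / sqrt (real n)"
    and s_near: "\<And>j. j \<in> {1..<k} \<Longrightarrow> \<bar>s j - s0 j\<bar> \<le> M / real n"
  shows "exp (- \<zeta> / 2) * (gauss_dens n b a * location_weight n z b s) \<le> likelihood n z (k, a, s)"
    "likelihood n z (k, a, s) \<le> exp (\<zeta> / 2) * (gauss_dens n b a * location_weight n z b s)"
proof -
  note g = goodD[OF good]
  have sq: "0 < sqrt (real n)" using n by auto
  have T0: "0 \<le> T" using T by simp
  note mn = mle_near[OF good n T0 nT T mle]
  let ?V = "abs_noise n (near_knots (M / real n)) z"
  have V: "0 \<le> ?V" unfolding segment_stat_def by (intro sum_nonneg) auto
  have "\<bar>(loss n z a s - loss n z a s0) - (loss n z a0 s - loss n z a0 s0)\<bar> \<le> (4 + 8 * K) * (M / sqrt (real n)) * ?V"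
    by (rule loss_shift_difference[OF g(1) s s_near a a_near])
  also have "\<dots> \<le> (4 + 8 * K) * (M / sqrt (real n)) * T'"
    using K g(6) M by (intro mult_left_mono) auto
  finally have 1: "\<bar>(loss n z a s - loss n z a s0) - (loss n z a0 s - loss n z a0 s0)\<bar> \<le> (4 + 8 * K) * (M / sqrt (real n)) * T'" .
  let ?Q = "\<Sum>j\<in>{1..k}. real n * seg_length k s0 j * (a j - b j)\<^sup>2"
  have "loss n z a s0 - loss n z b s0 - ?Q =
      (\<Sum>j\<in>{1..k}. (count n (segment k s0 j) z - real n * seg_length k s0 j) * (a j - b j)\<^sup>2)"
    using loss_around_mle[OF g(1) mle mn(1), of a] by (simp add: sum_subtractf left_diff_distrib)
  then have "\<bar>loss n z a s0 - loss n z b s0 - ?Q\<bar> \<le>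
      (\<Sum>j\<in>{1..k}. \<bar>(count n (segment k s0 j) z - real n * seg_length k s0 j) * (a j - b j)\<^sup>2\<bar>)"
    by (simp only: sum_abs)
  also have "\<dots> \<le> real (card {1..k}) * (T * sqrt (real n) * ((M + 2 * T / \<delta>) / sqrt (real n))\<^sup>2)"
  proof (rule sum_bounded_above)
    fix j assume j: "j \<in> {1..k}"
    have "\<bar>a j - b j\<bar> \<le> M / sqrt (real n) + 2 * T / \<delta> / sqrt (real n)"
      using a_near[OF j] mn(2)[OF j] by linarith
    then have "\<bar>a j - b j\<bar> \<le> (M + 2 * T / \<delta>) / sqrt (real n)" by (simp add: add_divide_distrib)
    from power_mono[OF this, of 2] have "(a j - b j)\<^sup>2 \<le> ((M + 2 * T / \<delta>) / sqrt (real n))\<^sup>2" by simp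
    then show "\<bar>(count n (segment k s0 j) z - real n * seg_length k s0 j) * (a j - b j)\<^sup>2\<bar> \<le>
        T * sqrt (real n) * ((M + 2 * T / \<delta>) / sqrt (real n))\<^sup>2"
      unfolding abs_mult using g(4)[OF j] T by (intro mult_mono) auto
  qed
  also have "\<dots> = T * sqrt (real n) * (real k * ((M + 2 * T / \<delta>) / sqrt (real n))\<^sup>2)"
    by simp
  finally have 2: "\<bar>loss n z a s0 - loss n z b s0 - ?Q\<bar> \<le> T * sqrt (real n) * (real k * ((M + 2 * T / \<delta>) / sqrt (real n))\<^sup>2)" .
  let ?L = "loss n z a0 s - loss n z a0 s0 + loss n z b s0 + ?Q"
  have le: "\<bar>loss n z a s - ?L\<bar> \<le> \<zeta>"
    using 1 2 unfolding \<zeta>_def by linarith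
  have eq: "gauss_dens n b a * location_weight n z b s = (1 / sqrt (2 * pi)) ^ n * exp (- ?L / 2)"
  proof -
    define G where "G = (\<Prod>j\<in>{1..k}. sqrt (seg_length k s0 j * real n / (2 * pi)))"
    have "G \<noteq> 0" using gauss_norm_pos[OF n] unfolding G_def by (rule less_imp_neq[symmetric])
    then have "gauss_dens n b a * location_weight n z b s = (1 / sqrt (2 * pi)) ^ n *
       (exp (- ?Q / 2) * exp (- (loss n z a0 s - loss n z a0 s0 + loss n z b s0) / 2))"
      unfolding gauss_dens_eq[OF n] location_weight_def G_def[symmetric] by simp
    also have "exp (- ?Q / 2) * exp (- (loss n z a0 s - loss n z a0 s0 + loss n z b s0) / 2) = exp (- ?L / 2)"
      unfolding exp_add[symmetric] by (simp add: field_simps)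
    finally show ?thesis .
  qed
  have "exp (- \<zeta> / 2) * exp (- ?L / 2) \<le> exp (- loss n z a s / 2)"
    unfolding exp_add[symmetric] exp_le_cancel_iff
    using le by (intro neg_half_le) (simp_all only: abs_le_iff minus_diff_eq)
  then show "exp (- \<zeta> / 2) * (gauss_dens n b a * location_weight n z b s) \<le> likelihood n z (k, a, s)"
    unfolding eq likelihood_eq[OF g(1)] mult.left_commute[of "exp (- \<zeta> / 2)"] by (intro mult_left_mono) auto
  have "exp (- loss n z a s / 2) \<le> exp (\<zeta> / 2) * exp (- ?L / 2)"
    unfolding exp_add[symmetric] exp_le_cancel_iff
    using le by (intro neg_half_le) (simp_all only: abs_le_iff minus_diff_eq)
  then show "likelihood n z (k, a, s) \<le> exp (\<zeta> / 2) * (gauss_dens n b a * location_weight n z b s)"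
    unfolding eq likelihood_eq[OF g(1)] mult.left_commute[of "exp (\<zeta> / 2)"] by (intro mult_left_mono) auto
qed

end

section \<open>Integrals over the parameter space\<close>

lemma nn_integral_gauss_kernel:
  fixes w \<mu> :: real
  assumes "0 < w"
  shows "(\<integral>\<^sup>+x. ennreal (exp (- (w * (x - \<mu>)\<^sup>2))) \<partial>lborel) = ennreal (sqrt (pi / w))"
proof -
  have eq: "exp (- (w * (x - \<mu>)\<^sup>2)) = sqrt (pi / w) * normal_density \<mu> (sqrt (1 / (2 * w))) x" for x
  proof -
    have "sqrt (pi / w) * sqrt (2 * w / (2 * pi)) = 1"
      using assms unfolding real_sqrt_mult[symmetric] by simp
    then show ?thesis
      using assms by (simp add: normal_density_precision mult.assoc[symmetric])
  qed
  have "(\<integral>\<^sup>+x. ennreal (exp (- (w * (x - \<mu>)\<^sup>2))) \<partial>lborel) =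
      ennreal (sqrt (pi / w)) * (\<integral>\<^sup>+x. ennreal (normal_density \<mu> (sqrt (1 / (2 * w))) x) \<partial>lborel)"
    using assms unfolding eq by (subst nn_integral_cmult[symmetric]) (auto simp: ennreal_mult)
  also have "(\<integral>\<^sup>+x. ennreal (normal_density \<mu> (sqrt (1 / (2 * w))) x) \<partial>lborel) = 1"
    using prob_space.emeasure_space_1[OF prob_space_normal_density[of "sqrt (1 / (2 * w))" \<mu>]] assms
    by (simp add: emeasure_density)
  finally show ?thesis by simp
qed

text \<open>The kernel is covered by two exponential densities, one on each side of
  \<open>\<mu>\<close>; they overlap only at \<open>\<mu>\<close> itself.\<close>

lemma nn_integral_laplace_kernel_le:
  fixes w \<mu> :: real
  assumes w: "0 < w"
  shows "(\<integral>\<^sup>+x. ennreal (exp (- (w * \<bar>x - \<mu>\<bar>))) \<partial>lborel) \<le> ennreal (2 / w)"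
proof -
  let ?e = "exponential_density w"
  have one: "(\<integral>\<^sup>+x. ennreal (?e x) \<partial>lborel) = 1"
    using prob_space.emeasure_space_1[OF prob_space_exponential_density[OF w]] by (simp add: emeasure_density)
  have e0: "0 \<le> ?e x" for x using w by (simp add: exponential_density_def)
  have "(\<integral>\<^sup>+x. ennreal (exp (- (w * \<bar>x - \<mu>\<bar>))) \<partial>lborel) \<le>
      (\<integral>\<^sup>+x. ennreal (1 / w) * (ennreal (?e (- \<mu> + 1 * x)) + ennreal (?e (\<mu> + (-1) * x))) \<partial>lborel)"
  proof (rule nn_integral_mono)
    fix x
    have "exp (- (w * \<bar>x - \<mu>\<bar>)) \<le> 1 / w * (?e (- \<mu> + 1 * x) + ?e (\<mu> + (-1) * x))"
      using w by (auto simp: exponential_density_def abs_if algebra_simps)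
    then show "ennreal (exp (- (w * \<bar>x - \<mu>\<bar>))) \<le> ennreal (1 / w) * (ennreal (?e (- \<mu> + 1 * x)) + ennreal (?e (\<mu> + (-1) * x)))"
      using e0 w by (simp add: ennreal_leI flip: ennreal_mult ennreal_plus)
  qed
  also have "\<dots> = ennreal (1 / w) * ((\<integral>\<^sup>+x. ennreal (?e (- \<mu> + 1 * x)) \<partial>lborel) + (\<integral>\<^sup>+x. ennreal (?e (\<mu> + (-1) * x)) \<partial>lborel))"
    by (subst nn_integral_cmult) (auto simp: nn_integral_add)
  also have "(\<integral>\<^sup>+x. ennreal (?e (- \<mu> + 1 * x)) \<partial>lborel) = 1"
    using nn_integral_real_affine[of "\<lambda>x. ennreal (?e x)" 1 "- \<mu>"] one by simp
  also have "(\<integral>\<^sup>+x. ennreal (?e (\<mu> + (-1) * x)) \<partial>lborel) = 1"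
    using nn_integral_real_affine[of "\<lambda>x. ennreal (?e x)" "-1" \<mu>] one by simp
  also have "ennreal (1 / w) * (1 + 1) = ennreal (1 / w) * ennreal 2"
    by simp
  also have "\<dots> = ennreal (1 / w * 2)"
    using w by (subst ennreal_mult) auto
  finally show ?thesis by simp
qed

text \<open>Chebyshev's inequality.\<close>

lemma normal_tail:
  assumes \<sigma>: "0 < \<sigma>" and c: "0 < c"
  shows "emeasure (density lborel (normal_density \<mu> \<sigma>)) {x. c < \<bar>x - \<mu>\<bar>} \<le> ennreal (\<sigma>\<^sup>2 / c\<^sup>2)"
proof -
  have "emeasure (density lborel (normal_density \<mu> \<sigma>)) {x. c < \<bar>x - \<mu>\<bar>} =
      (\<integral>\<^sup>+x. ennreal (normal_density \<mu> \<sigma> x) * indicator {x. c < \<bar>x - \<mu>\<bar>} x \<partial>lborel)"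
    by (rule emeasure_density) auto
  also have "\<dots> \<le> (\<integral>\<^sup>+x. ennreal (1 / c\<^sup>2) * ennreal (normal_density \<mu> \<sigma> x * (x - \<mu>) ^ (2 * 1)) \<partial>lborel)"
  proof (rule nn_integral_mono)
    fix x
    have "normal_density \<mu> \<sigma> x \<le> 1 / c\<^sup>2 * (normal_density \<mu> \<sigma> x * (x - \<mu>)\<^sup>2)" if "c < \<bar>x - \<mu>\<bar>"
    proof -
      have "c\<^sup>2 \<le> (x - \<mu>)\<^sup>2" using that c power_mono[of c "\<bar>x - \<mu>\<bar>" 2] by simp
      then have "1 \<le> (x - \<mu>)\<^sup>2 / c\<^sup>2" using c by simp
      from mult_left_mono[OF this, of "normal_density \<mu> \<sigma> x"] show ?thesis by (simp add: mult_ac)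
    qed
    then show "ennreal (normal_density \<mu> \<sigma> x) * indicator {x. c < \<bar>x - \<mu>\<bar>} x \<le>
        ennreal (1 / c\<^sup>2) * ennreal (normal_density \<mu> \<sigma> x * (x - \<mu>) ^ (2 * 1))"
      by (auto simp: indicator_def ennreal_leI simp flip: ennreal_mult)
  qed
  also have "\<dots> = ennreal (1 / c\<^sup>2) * (\<integral>\<^sup>+x. ennreal (normal_density \<mu> \<sigma> x * (x - \<mu>) ^ (2 * 1)) \<partial>lborel)"
    by (rule nn_integral_cmult) auto
  also have "(\<integral>\<^sup>+x. ennreal (normal_density \<mu> \<sigma> x * (x - \<mu>) ^ (2 * 1)) \<partial>lborel) = ennreal (\<sigma>\<^sup>2)"
    using normal_moment_even[OF \<sigma>, of \<mu> 1] integral_normal_moment_even[OF \<sigma>, of \<mu> 1]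
    by (subst nn_integral_eq_integral) (auto simp: has_bochner_integral_iff)
  finally show ?thesis using c by (simp flip: ennreal_mult)
qed

interpretation lborel_prod: product_sigma_finite "\<lambda>_::nat. lborel :: real measure" ..

lemma emeasure_lebesgue_box:
  assumes "finite J" "0 \<le> r"
  shows "emeasure (lebesgue_pow J) (PiE J (\<lambda>j. {c j - r..c j + r})) = ennreal ((2 * r) ^ card J)"
proof -
  have "emeasure (lebesgue_pow J) (PiE J (\<lambda>j. {c j - r..c j + r})) = (\<Prod>j\<in>J. emeasure lborel {c j - r..c j + r})"
    using assms by (intro lborel_prod.emeasure_PiM) auto
  also have "\<dots> = (\<Prod>j\<in>J. ennreal (2 * r))"
    using assms by (intro prod.cong) auto
  finally show ?thesis using assms by (simp add: ennreal_power)
qed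

lemma pair_sigma_finite_lebesgue_pow:
  "finite I \<Longrightarrow> finite J \<Longrightarrow> pair_sigma_finite (lebesgue_pow I) (lebesgue_pow J)"
  by (intro pair_sigma_finite.intro lborel_prod.sigma_finite)

lemma measurable_coordinate:
  "j \<in> J \<Longrightarrow> (\<lambda>a. a j) \<in> borel_measurable (lebesgue_pow J)"
  using measurable_component_singleton[of j J "\<lambda>_. lborel :: real measure"] by simp

lemma measurable_knot: "j \<le> k \<Longrightarrow> (\<lambda>s. knot k s j) \<in> borel_measurable (lebesgue_pow {1..<k})"
  using measurable_coordinate[of j "{1..<k}"] by (cases "j = 0"; cases "j = k") (auto simp: knot_def[abs_def])

text \<open>Joint measurability in sample and parameter is what Tonelli's theorem requires. The
  indicator of a segment with moving end points is rewritten as a conditional on two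
  inequalities.\<close>

lemma likelihood_jointly_measurable:
  "(\<lambda>(z, w). likelihood n z (k, w)) \<in> borel_measurable
     (sample_space n \<Otimes>\<^sub>M (lebesgue_pow {1..k} \<Otimes>\<^sub>M lebesgue_pow {1..<k}))"
proof -
  let ?M = "sample_space n \<Otimes>\<^sub>M (lebesgue_pow {1..k} \<Otimes>\<^sub>M lebesgue_pow {1..<k})"
  have x[measurable]: "(\<lambda>v. fst (fst v i)) \<in> borel_measurable ?M" "(\<lambda>v. snd (fst v i)) \<in> borel_measurable ?M"
    if "i \<in> {1..n}" for i
    using measurable_compose[OF measurable_fst measurable_sample(1)[OF that]]
      measurable_compose[OF measurable_fst measurable_sample(2)[OF that]] by auto
  have a[measurable]: "(\<lambda>v. fst (snd v) j) \<in> borel_measurable ?M" if "j \<in> {1..k}" for j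
    by (rule measurable_compose[OF measurable_compose[OF measurable_snd measurable_fst] measurable_coordinate[OF that]])
  have t[measurable]: "(\<lambda>v. knot k (snd (snd v)) j) \<in> borel_measurable ?M" if "j \<le> k" for j
    by (rule measurable_compose[OF measurable_compose[OF measurable_snd measurable_snd] measurable_knot[OF that]])
  have s[measurable]: "(\<lambda>v. step_fun (k, snd v) (fst (fst v i))) \<in> borel_measurable ?M" if i: "i \<in> {1..n}" for i
  proof -
    have "(\<lambda>v. \<Sum>j\<in>{1..k}. fst (snd v) j *
        (if knot k (snd (snd v)) (j - 1) \<le> fst (fst v i) \<and> fst (fst v i) < knot k (snd (snd v)) j then 1 else 0)) \<in> borel_measurable ?M"
    proof (intro borel_measurable_sum borel_measurable_times measurable_If measurable_const)
      fix j assume j: "j \<in> {1..k}"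
      have [measurable]: "(\<lambda>v. knot k (snd (snd v)) (j - 1)) \<in> borel_measurable ?M" "(\<lambda>v. knot k (snd (snd v)) j) \<in> borel_measurable ?M"
        "(\<lambda>v. fst (fst v i)) \<in> borel_measurable ?M"
        using t j x[OF i] by auto
      show "(\<lambda>v. fst (snd v) j) \<in> borel_measurable ?M" by (rule a[OF j])
      show "{v \<in> space ?M. knot k (snd (snd v)) (j - 1) \<le> fst (fst v i) \<and> fst (fst v i) < knot k (snd (snd v)) j} \<in> sets ?M"
        by measurable
    qed simp_all
    then show ?thesis by (simp add: step_fun_def indicator_def split_beta of_bool_def)
  qed
  have "(\<lambda>v. \<Prod>i\<in>{1..n}. indicator {0..<1} (fst (fst v i)) *
      normal_density (step_fun (k, snd v) (fst (fst v i))) 1 (snd (fst v i))) \<in> borel_measurable ?M"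
  proof (rule borel_measurable_prod)
    fix i assume i: "i \<in> {1..n}"
    note [measurable] = x[OF i] s[OF i]
    show "(\<lambda>v. indicator {0..<1} (fst (fst v i)) *
      normal_density (step_fun (k, snd v) (fst (fst v i))) 1 (snd (fst v i))) \<in> borel_measurable ?M"
      unfolding normal_density_def by measurable
  qed
  then show ?thesis by (simp add: likelihood_def obs_density_def split_beta)
qed

context separated_change_point
begin

abbreviation "AS \<equiv> lebesgue_pow {1..k} \<Otimes>\<^sub>M lebesgue_pow {1..<k}"

abbreviation "\<Theta> \<equiv> levels K k \<times> locations \<delta> k"

section \<open>Localisation boxes and the expected likelihood mass outside them\<close>

definition level_box :: "nat \<Rightarrow> real \<Rightarrow> (nat \<Rightarrow> real) set" where
  "level_box n M = (\<Pi>\<^sub>E j\<in>{1..k}. {a0 j - M / sqrt (real n)..a0 j + M / sqrt (real n)})"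

definition knot_box :: "nat \<Rightarrow> real \<Rightarrow> (nat \<Rightarrow> real) set" where
  "knot_box n M = (\<Pi>\<^sub>E j\<in>{1..<k}. {s0 j - M / real n..s0 j + M / real n})"

lemma sets_boxes [measurable]:
  "level_box n M \<in> sets (lebesgue_pow {1..k})" "knot_box n M \<in> sets (lebesgue_pow {1..<k})"
  unfolding level_box_def knot_box_def by (auto intro!: sets_PiM_I_finite)

lemma level_boxD: "a \<in> level_box n M \<Longrightarrow> j \<in> {1..k} \<Longrightarrow> \<bar>a j - a0 j\<bar> \<le> M / sqrt (real n)"
  unfolding level_box_def by (drule PiE_mem, assumption) (auto simp: abs_le_iff)

lemma knot_boxD: "s \<in> knot_box n M \<Longrightarrow> j \<in> {1..<k} \<Longrightarrow> \<bar>s j - s0 j\<bar> \<le> M / real n"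
  unfolding knot_box_def by (drule PiE_mem, assumption) (auto simp: abs_le_iff)

text \<open>One coordinate outside its interval suffices: a knot contributes at least
  \<open>M\<close>, a level at least \<open>M\<^sup>2\<close>, to \<open>n * sq_dist\<close>;
  \<open>1 \<le> M\<close> puts both above \<open>M\<close>.\<close>

lemma not_in_boxes:
  assumes w: "w \<in> \<Theta> - level_box n M \<times> knot_box n M" and M: "1 \<le> M" and n: "1 \<le> n"
  shows "M \<le> real n * sq_dist (fst w) (snd w)"
proof -
  obtain a s where [simp]: "w = (a, s)" by (cases w)
  have ext: "a \<in> extensional {1..k}" "s \<in> extensional {1..<k}"
    using w by (auto simp: levels_def locations_def PiE_def)
  have X: "0 \<le> (\<Sum>j\<in>{1..<k}. \<bar>s j - s0 j\<bar>)" "0 \<le> (\<Sum>j\<in>{1..k}. (a j - a0 j)\<^sup>2)"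
    by (auto intro: sum_nonneg)
  have "a \<notin> level_box n M \<or> s \<notin> knot_box n M" using w by auto
  then show ?thesis
  proof
    assume "a \<notin> level_box n M"
    then obtain j where j: "j \<in> {1..k}" "a j \<notin> {a0 j - M / sqrt (real n)..a0 j + M / sqrt (real n)}"
      using ext by (auto simp: level_box_def PiE_iff)
    then have "M / sqrt (real n) \<le> \<bar>a j - a0 j\<bar>" by (auto simp: abs_if)
    then have "(M / sqrt (real n))\<^sup>2 \<le> (a j - a0 j)\<^sup>2"
      using M power_mono[of "M / sqrt (real n)" "\<bar>a j - a0 j\<bar>" 2] by simp
    then have "M\<^sup>2 \<le> real n * (a j - a0 j)\<^sup>2" using n by (simp add: power_divide field_simps)
    also have "\<dots> \<le> real n * (\<Sum>j\<in>{1..k}. (a j - a0 j)\<^sup>2)"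
      using j by (intro mult_left_mono member_le_sum) auto
    also have "\<dots> \<le> real n * sq_dist a s" using X unfolding sq_dist_def by (intro mult_left_mono) auto
    finally have "M\<^sup>2 \<le> real n * sq_dist a s" .
    moreover have "M \<le> M\<^sup>2" using M by (simp add: power2_eq_square)
    ultimately show ?thesis by simp
  next
    assume "s \<notin> knot_box n M"
    then obtain j where j: "j \<in> {1..<k}" "s j \<notin> {s0 j - M / real n..s0 j + M / real n}"
      using ext by (auto simp: knot_box_def PiE_iff)
    then have "M / real n \<le> \<bar>s j - s0 j\<bar>" by (auto simp: abs_if)
    then have "M \<le> real n * \<bar>s j - s0 j\<bar>" using n by (simp add: field_simps)
    also have "\<dots> \<le> real n * (\<Sum>j\<in>{1..<k}. \<bar>s j - s0 j\<bar>)"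
      using j by (intro mult_left_mono member_le_sum) auto
    also have "\<dots> \<le> real n * sq_dist a s" using X unfolding sq_dist_def by (intro mult_left_mono) auto
    finally show ?thesis by simp
  qed
qed

text \<open>The integrand is a product over coordinates, a Gaussian kernel per level and a Laplace
  kernel per knot. This is where the volume order \<open>n\<close> to the power
  \<open>-(k-1)-k/2\<close> arises.\<close>

lemma nn_integral_exp_sq_dist_le:
  assumes w: "0 < w"
  shows "(\<integral>\<^sup>+v. ennreal (exp (- (w * sq_dist (fst v) (snd v)))) \<partial>AS) \<le>
    ennreal ((2 / w) ^ (k - 1) * sqrt (pi / w) ^ k)"
proof -
  interpret pair_sigma_finite "lebesgue_pow {1..k}" "lebesgue_pow {1..<k}"
    by (rule pair_sigma_finite_lebesgue_pow) auto
  let ?f = "\<lambda>a. \<Prod>j\<in>{1..k}. ennreal (exp (- (w * (a j - a0 j)\<^sup>2)))"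
  let ?g = "\<lambda>s. \<Prod>j\<in>{1..<k}. ennreal (exp (- (w * \<bar>s j - s0 j\<bar>)))"
  note [measurable] = measurable_coordinate
  have m: "?f \<in> borel_measurable (lebesgue_pow {1..k})" "?g \<in> borel_measurable (lebesgue_pow {1..<k})"
    by measurable
  have eq: "ennreal (exp (- (w * sq_dist a s))) = ?f a * ?g s" for a s
  proof -
    have "- (w * sq_dist a s) = (\<Sum>j\<in>{1..k}. - (w * (a j - a0 j)\<^sup>2)) + (\<Sum>j\<in>{1..<k}. - (w * \<bar>s j - s0 j\<bar>))"
      unfolding sq_dist_def by (simp add: distrib_left sum_distrib_left sum_negf)
    then show ?thesis by (simp add: exp_add exp_sum prod_ennreal ennreal_mult prod_nonneg)
  qed
  have "(\<integral>\<^sup>+v. ennreal (exp (- (w * sq_dist (fst v) (snd v)))) \<partial>AS) = (\<integral>\<^sup>+v. ?f (fst v) * ?g (snd v) \<partial>AS)"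
    unfolding eq ..
  also have "\<dots> = (\<integral>\<^sup>+a. \<integral>\<^sup>+s. ?f a * ?g s \<partial>lebesgue_pow {1..<k} \<partial>lebesgue_pow {1..k})"
    using m by (subst M2.nn_integral_fst[symmetric]) (auto intro!: borel_measurable_times_ennreal measurable_compose[OF measurable_fst] measurable_compose[OF measurable_snd])
  also have "\<dots> = (\<integral>\<^sup>+a. ?f a \<partial>lebesgue_pow {1..k}) * (\<integral>\<^sup>+s. ?g s \<partial>lebesgue_pow {1..<k})"
    using m by (simp add: nn_integral_cmult nn_integral_multc)
  also have "(\<integral>\<^sup>+a. ?f a \<partial>lebesgue_pow {1..k}) = (\<Prod>j\<in>{1..k}. \<integral>\<^sup>+x. ennreal (exp (- (w * (x - a0 j)\<^sup>2))) \<partial>lborel)"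
    by (rule lborel_prod.product_nn_integral_prod) auto
  also have "\<dots> = ennreal (sqrt (pi / w) ^ k)"
    using w by (simp add: nn_integral_gauss_kernel ennreal_power)
  also have "(\<integral>\<^sup>+s. ?g s \<partial>lebesgue_pow {1..<k}) = (\<Prod>j\<in>{1..<k}. \<integral>\<^sup>+x. ennreal (exp (- (w * \<bar>x - s0 j\<bar>))) \<partial>lborel)"
    by (rule lborel_prod.product_nn_integral_prod) auto
  also have "ennreal (sqrt (pi / w) ^ k) * \<dots> \<le> ennreal (sqrt (pi / w) ^ k) * (\<Prod>j\<in>{1..<k}. ennreal (2 / w))"
    using w by (intro mult_left_mono prod_mono_ennreal nn_integral_laplace_kernel_le) auto
  also have "\<dots> = ennreal ((2 / w) ^ (k - 1) * sqrt (pi / w) ^ k)"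
    using w by (simp add: ennreal_power mult.commute flip: ennreal_mult)
  finally show ?thesis .
qed

text \<open>Half of the exponent is at least \<open>c * M / 2\<close> outside the boxes and gives
  the small factor; the other half, with \<open>w = c * n / 2\<close>, keeps the integral
  finite.\<close>

lemma tail_integral:
  assumes c: "0 < c" and C: "0 < C" and M: "1 \<le> M" and n: "1 \<le> n"
    and pass: "\<And>a s. a \<in> levels K k \<Longrightarrow> s \<in> locations \<delta> k \<Longrightarrow>
      pass_prob T R n a s \<le> C * exp (- (c * (real n * sq_dist a s)))"
  shows "(\<integral>\<^sup>+v. ennreal (pass_prob T R n (fst v) (snd v)) * indicator (\<Theta> - level_box n M \<times> knot_box n M) v \<partial>AS) \<le>
    ennreal (C * exp (- (c * M / 2)) * ((4 / (c * real n)) ^ (k - 1) * sqrt (2 * pi / (c * real n)) ^ k))"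
proof -
  define w where "w = c * real n / 2"
  have w: "0 < w" using c n by (simp add: w_def)
  note [measurable] = measurable_coordinate
  have [measurable]: "(\<lambda>v. sq_dist (fst v) (snd v)) \<in> borel_measurable AS"
    unfolding sq_dist_def
    by (intro borel_measurable_add borel_measurable_sum borel_measurable_abs borel_measurable_diff borel_measurable_power
        measurable_compose[OF measurable_fst measurable_coordinate] measurable_compose[OF measurable_snd measurable_coordinate]) auto
  have "(\<integral>\<^sup>+v. ennreal (pass_prob T R n (fst v) (snd v)) * indicator (\<Theta> - level_box n M \<times> knot_box n M) v \<partial>AS) \<le>
      (\<integral>\<^sup>+v. ennreal (C * exp (- (c * M / 2))) * ennreal (exp (- (w * sq_dist (fst v) (snd v)))) \<partial>AS)"
  proof (rule nn_integral_mono)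
    fix v
    show "ennreal (pass_prob T R n (fst v) (snd v)) * indicator (\<Theta> - level_box n M \<times> knot_box n M) v \<le>
        ennreal (C * exp (- (c * M / 2))) * ennreal (exp (- (w * sq_dist (fst v) (snd v))))"
    proof (cases "v \<in> \<Theta> - level_box n M \<times> knot_box n M")
      case True
      let ?d = "real n * sq_dist (fst v) (snd v)"
      have "pass_prob T R n (fst v) (snd v) \<le> C * exp (- (c * ?d))"
        using True by (intro pass) auto
      also have "\<dots> \<le> C * exp (- (c * M / 2) + - (w * sq_dist (fst v) (snd v)))"
      proof -
        have "c * M \<le> c * ?d" using not_in_boxes[OF True M n] c by (intro mult_left_mono) auto
        moreover have "w * sq_dist (fst v) (snd v) = c * ?d / 2" by (simp add: w_def)
        ultimately have "- (c * ?d) \<le> - (c * M / 2) + - (w * sq_dist (fst v) (snd v))" by linarith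
        then show ?thesis using C by simp
      qed
      also have "\<dots> = (C * exp (- (c * M / 2))) * exp (- (w * sq_dist (fst v) (snd v)))"
        by (simp only: exp_add mult.assoc)
      finally have "ennreal (pass_prob T R n (fst v) (snd v)) \<le>
          ennreal ((C * exp (- (c * M / 2))) * exp (- (w * sq_dist (fst v) (snd v))))"
        by (rule ennreal_leI)
      then show ?thesis
        using True C by (simp add: ennreal_mult del: Diff_iff)
    qed simp
  qed
  also have "\<dots> = ennreal (C * exp (- (c * M / 2))) * (\<integral>\<^sup>+v. ennreal (exp (- (w * sq_dist (fst v) (snd v)))) \<partial>AS)"
    by (rule nn_integral_cmult) measurable
  also have "\<dots> \<le> ennreal (C * exp (- (c * M / 2))) * ennreal ((2 / w) ^ (k - 1) * sqrt (pi / w) ^ k)"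
    by (intro mult_left_mono nn_integral_exp_sq_dist_le[OF w]) auto
  also have "\<dots> = ennreal (C * exp (- (c * M / 2)) * ((4 / (c * real n)) ^ (k - 1) * sqrt (2 * pi / (c * real n)) ^ k))"
  proof -
    have "2 / w = 4 / (c * real n)" "pi / w = 2 * pi / (c * real n)" by (simp_all add: w_def)
    then show ?thesis using C w c by (simp flip: ennreal_mult)
  qed
  finally show ?thesis .
qed

lemma sigma_finite_sample:
  fixes n :: nat
  shows "sigma_finite_measure (\<Pi>\<^sub>M i\<in>{1..n}. (lborel :: (real \<times> real) measure))"
proof -
  interpret L: product_sigma_finite "\<lambda>_::nat. lborel :: (real \<times> real) measure" ..
  show ?thesis by (rule L.sigma_finite) simp
qed

lemma sets_sample_lborel [measurable_cong]:
  fixes n :: nat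
  shows "sets (\<Pi>\<^sub>M i\<in>{1..n}. (lborel :: (real \<times> real) measure)) = sets (sample_space n)"
  by (intro sets_PiM_cong) auto

text \<open>The likelihood is the density of the sample law under \<open>(a, s)\<close>, and the
  good event includes the tests.\<close>

lemma good_likelihood_le_pass_prob:
  "(\<integral>\<^sup>+z. ennreal (likelihood n z (k, a, s)) * indicator {z. good T R M T' n z} z \<partial>(\<Pi>\<^sub>M i\<in>{1..n}. lborel))
    \<le> ennreal (pass_prob T R n a s)"
proof -
  let ?B = "\<Pi>\<^sub>M i\<in>{1..n}. (lborel :: (real \<times> real) measure)"
  have sp: "space ?B = space (sample_space n)" by (rule sets_eq_imp_space_eq[OF sets_sample_lborel])
  have m: "(\<lambda>z. ennreal (likelihood n z (k, a, s))) \<in> borel_measurable ?B"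
    unfolding likelihood_def
    by (intro measurable_compose[OF _ measurable_ennreal] borel_measurable_prod
        measurable_compose[OF measurable_component_singleton]) auto
  have t: "{z \<in> space (sample_space n). tests T R n z} \<in> sets ?B"
    unfolding sets_sample_lborel by measurable
  have "(\<integral>\<^sup>+z. ennreal (likelihood n z (k, a, s)) * indicator {z. good T R M T' n z} z \<partial>?B) \<le>
      (\<integral>\<^sup>+z. ennreal (likelihood n z (k, a, s)) * indicator {z \<in> space (sample_space n). tests T R n z} z \<partial>?B)"
  proof (rule nn_integral_mono)
    fix z assume "z \<in> space ?B"
    then have "z \<in> space (sample_space n)" unfolding sp .
    then show "ennreal (likelihood n z (k, a, s)) * indicator {z. good T R M T' n z} z \<le>
        ennreal (likelihood n z (k, a, s)) * indicator {z \<in> space (sample_space n). tests T R n z} z"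
      by (auto simp: indicator_def good_def)
  qed
  also have "\<dots> = emeasure (density ?B (\<lambda>z. ennreal (likelihood n z (k, a, s)))) {z \<in> space (sample_space n). tests T R n z}"
    using m t by (rule emeasure_density[symmetric])
  also have "density ?B (\<lambda>z. ennreal (likelihood n z (k, a, s))) = product_law n (step_fun (k, a, s))"
    unfolding likelihood_def by (rule product_law_eq_density[symmetric]) measurable
  finally show ?thesis unfolding emeasure_pass .
qed

text \<open>Tonelli's theorem: for each fixed parameter the sample integral is its passing
  probability. The sample is integrated against Lebesgue measure because the density at the truth
  has been cancelled by the lower bound for the total mass.\<close>

lemma expected_tail_mass:
  assumes c: "0 < c" and C: "0 < C" and M: "1 \<le> M" and n: "1 \<le> n"
    and pass: "\<And>a s. a \<in> levels K k \<Longrightarrow> s \<in> locations \<delta> k \<Longrightarrow>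
      pass_prob T R n a s \<le> C * exp (- (c * (real n * sq_dist a s)))"
  shows "(\<integral>\<^sup>+z. (\<integral>\<^sup>+v. ennreal (likelihood n z (k, v)) * indicator (\<Theta> - level_box n M \<times> knot_box n M) v \<partial>AS)
      * indicator {z. good T R M T' n z} z \<partial>(\<Pi>\<^sub>M i\<in>{1..n}. lborel)) \<le>
    ennreal (C * exp (- (c * M / 2)) * ((4 / (c * real n)) ^ (k - 1) * sqrt (2 * pi / (c * real n)) ^ k))"
proof -
  let ?B = "\<Pi>\<^sub>M i\<in>{1..n}. (lborel :: (real \<times> real) measure)"
  let ?T = "\<Theta> - level_box n M \<times> knot_box n M"
  let ?G = "{z. good T R M T' n z}"
  interpret A: pair_sigma_finite "lebesgue_pow {1..k}" "lebesgue_pow {1..<k}"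
    by (rule pair_sigma_finite_lebesgue_pow) auto
  interpret P: pair_sigma_finite ?B AS
    by (intro pair_sigma_finite.intro sigma_finite_sample A.sigma_finite_measure_axioms)
  have L[measurable]: "(\<lambda>(z, w). likelihood n z (k, w)) \<in> borel_measurable (?B \<Otimes>\<^sub>M AS)"
    using likelihood_jointly_measurable[of n k] by (simp cong: measurable_cong_sets sets_pair_measure_cong add: sets_sample_lborel)
  have sT[measurable]: "?T \<in> sets AS" by measurable
  have sp: "space ?B = space (sample_space n)" by (rule sets_eq_imp_space_eq[OF sets_sample_lborel])
  have G: "{z \<in> space ?B. good T R M T' n z} \<in> sets ?B"
    unfolding sp sets_sample_lborel by measurable
  have Gm: "(\<lambda>z. indicator ?G z :: ennreal) \<in> borel_measurable ?B"
  proof -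
    have "(\<lambda>z. indicator {z \<in> space ?B. good T R M T' n z} z :: ennreal) \<in> borel_measurable ?B"
      using G by (rule borel_measurable_indicator)
    then show ?thesis by (rule measurable_cong[THEN iffD1, rotated]) (auto simp: indicator_def)
  qed
  have Lz: "(\<lambda>v. ennreal (likelihood n z (k, v))) \<in> borel_measurable AS" for z
    using measurable_compose[OF measurable_tag_segments borel_measurable_likelihood[of n z], of k] by (simp add: split_beta)
  have joint: "(\<lambda>(z, v). ennreal (likelihood n z (k, v)) * indicator ?T v * indicator ?G z) \<in> borel_measurable (?B \<Otimes>\<^sub>M AS)"
  proof -
    have 1: "(\<lambda>u. ennreal (likelihood n (fst u) (k, snd u))) \<in> borel_measurable (?B \<Otimes>\<^sub>M AS)"
      using measurable_compose[OF L measurable_ennreal] by (simp add: split_beta)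
    have 2: "(\<lambda>u. indicator ?T (snd u) :: ennreal) \<in> borel_measurable (?B \<Otimes>\<^sub>M AS)"
      by (rule measurable_compose[OF measurable_snd borel_measurable_indicator[OF sT]])
    have 3: "(\<lambda>u. indicator ?G (fst u) :: ennreal) \<in> borel_measurable (?B \<Otimes>\<^sub>M AS)"
      by (rule measurable_compose[OF measurable_fst Gm])
    show ?thesis unfolding split_beta by (intro borel_measurable_times_ennreal 1 2 3)
  qed
  have "(\<integral>\<^sup>+z. (\<integral>\<^sup>+v. ennreal (likelihood n z (k, v)) * indicator ?T v \<partial>AS) * indicator ?G z \<partial>?B) =
      (\<integral>\<^sup>+z. (\<integral>\<^sup>+v. ennreal (likelihood n z (k, v)) * indicator ?T v * indicator ?G z \<partial>AS) \<partial>?B)"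
    using Lz by (intro nn_integral_cong nn_integral_multc[symmetric] borel_measurable_times_ennreal borel_measurable_indicator sT)
  also have "\<dots> = (\<integral>\<^sup>+v. (\<integral>\<^sup>+z. ennreal (likelihood n z (k, v)) * indicator ?T v * indicator ?G z \<partial>?B) \<partial>AS)"
    using P.Fubini'[OF joint] by simp
  also have "\<dots> \<le> (\<integral>\<^sup>+v. ennreal (pass_prob T R n (fst v) (snd v)) * indicator ?T v \<partial>AS)"
  proof (rule nn_integral_mono)
    fix v
    have "(\<integral>\<^sup>+z. ennreal (likelihood n z (k, v)) * indicator ?T v * indicator ?G z \<partial>?B) =
       (if v \<in> ?T then (\<integral>\<^sup>+z. ennreal (likelihood n z (k, fst v, snd v)) * indicator ?G z \<partial>?B) else 0)"
      by auto
    also have "\<dots> \<le> ennreal (pass_prob T R n (fst v) (snd v)) * indicator ?T v"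
      using good_likelihood_le_pass_prob by auto
    finally show "(\<integral>\<^sup>+z. ennreal (likelihood n z (k, v)) * indicator ?T v * indicator ?G z \<partial>?B) \<le>
      ennreal (pass_prob T R n (fst v) (snd v)) * indicator ?T v" .
  qed
  also have "\<dots> \<le> ennreal (C * exp (- (c * M / 2)) * ((4 / (c * real n)) ^ (k - 1) * sqrt (2 * pi / (c * real n)) ^ k))"
    by (rule tail_integral[OF c C M n pass])
  finally show ?thesis .
qed

text \<open>\<open>s0\<close> may lie on the boundary of \<open>locations \<delta> k\<close>. By convexity a box of side of order
  \<open>1 / n\<close> still fits inside, after a shift towards the equispaced locations.\<close>

lemma location_box_inside:
  assumes n: "1 \<le> n" and \<xi>: "0 < \<xi>" "\<xi> \<le> 1" "2 \<le> k \<Longrightarrow> 2 * \<xi> \<le> 1 / real k - \<delta>"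
    and s: "s \<in> (\<Pi>\<^sub>E j\<in>{1..<k}. {s0 j + (real j / real k - s0 j) / real n - \<xi> / real n..
      s0 j + (real j / real k - s0 j) / real n + \<xi> / real n})"
  shows "s \<in> locations \<delta> k" "s \<in> knot_box n 2"
proof -
  have ext: "s \<in> extensional {1..<k}" using s by (simp add: PiE_def)
  have d: "\<bar>s j - (s0 j + (real j / real k - s0 j) / real n)\<bar> \<le> \<xi> / real n" if "j \<in> {1..<k}" for j
    using PiE_mem[OF s that] by (auto simp: abs_le_iff)
  \<comment> \<open>Deviation from the convex combination of \<open>s0\<close> and the equispaced
    locations with weight \<open>1 / n\<close> on the latter. Written with \<open>knot\<close>, it
    covers the end points too, where it vanishes.\<close>
  define u where "u j = knot k s j - ((1 - 1 / real n) * knot k s0 j + 1 / real n * (real j / real k))" for j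
  have u: "\<bar>u j\<bar> \<le> \<xi> / real n" if jk: "j \<le> k" for j
  proof -
    consider "j = 0" | "j = k" | "1 \<le> j" "j < k" using jk by linarith
    then show ?thesis
    proof cases
      case 3
      then have j: "j \<in> {1..<k}" by simp
      have "u j = s j - (s0 j + (real j / real k - s0 j) / real n)"
        unfolding u_def knot_inner[OF j] by (simp add: algebra_simps diff_divide_distrib)
      then show ?thesis using d[OF j] by simp
    qed (use k \<xi> n in \<open>auto simp: u_def\<close>)
  qed
  have gap: "\<delta> \<le> knot k s j - knot k s (j - 1)" if j: "j \<in> {1..k}" for j
  proof (cases "k = 1")
    case True
    then show ?thesis using j \<delta>_le_1 by (simp add: knot_def)
  next
    case False
    then have k2: "2 \<le> k" using k by simp
    have jk: "real j / real k - real (j - 1) / real k = 1 / real k"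
      using j by (simp add: diff_divide_distrib[symmetric] of_nat_diff)
    have "knot k s j - knot k s (j - 1) = (1 - 1 / real n) * (knot k s0 j - knot k s0 (j - 1)) +
        1 / real n * (real j / real k - real (j - 1) / real k) + (u j - u (j - 1))"
      unfolding u_def by (simp add: algebra_simps)
    also have "\<dots> \<ge> (1 - 1 / real n) * \<delta> + 1 / real n * (1 / real k) - 2 * (\<xi> / real n)"
    proof -
      have "(1 - 1 / real n) * \<delta> \<le> (1 - 1 / real n) * (knot k s0 j - knot k s0 (j - 1))"
        using knot_step[OF s0 j] n by (intro mult_left_mono) auto
      moreover have "\<bar>u j\<bar> \<le> \<xi> / real n" "\<bar>u (j - 1)\<bar> \<le> \<xi> / real n" using u j by auto
      ultimately show ?thesis unfolding jk by linarith
    qed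
    \<comment> \<open>The shift gains \<open>(1 / k - \<delta>) / n\<close> for each gap, and the
      box costs at most \<open>2 * \<xi> / n\<close>.\<close>
    also have "(1 - 1 / real n) * \<delta> + 1 / real n * (1 / real k) - 2 * (\<xi> / real n) = \<delta> + 1 / real n * (1 / real k - \<delta> - 2 * \<xi>)"
      by (simp add: algebra_simps)
    also have "\<dots> \<ge> \<delta>" using \<xi>(3)[OF k2] by simp
    finally show ?thesis by simp
  qed
  have "knot k s (j - 1) < knot k s j \<and> \<delta> \<le> \<bar>knot k s j - knot k s (j - 1)\<bar>" if "j \<in> {1..k}" for j
    using gap[OF that] \<delta> by auto
  then show "s \<in> locations \<delta> k" using ext by (auto simp: locations_def)
  have "s j \<in> {s0 j - 2 / real n..s0 j + 2 / real n}" if j: "j \<in> {1..<k}" for j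
  proof -
    have "0 \<le> s0 j" "s0 j \<le> 1" using knot_bounds[OF s0 \<delta> k, of j] j by auto
    moreover have "0 \<le> real j / real k" "real j / real k \<le> 1" using j by auto
    ultimately have "\<bar>real j / real k - s0 j\<bar> \<le> 1" by linarith
    then have "\<bar>(real j / real k - s0 j) / real n\<bar> \<le> 1 / real n"
      unfolding abs_divide by (simp add: divide_right_mono)
    moreover have "\<xi> / real n \<le> 1 / real n" using \<xi> by (simp add: divide_right_mono)
    ultimately have "\<bar>s j - s0 j\<bar> \<le> 1 / real n + 1 / real n" using d[OF j] by linarith
    then show ?thesis by (auto simp: abs_le_iff)
  qed
  then show "s \<in> knot_box n 2" using ext by (auto simp: knot_box_def PiE_iff)
qed

end

text \<open>Basic open sets of the product topology have open factors, of which those in the finite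
  \<open>J\<close> admit a common radius; agreement elsewhere places \<open>y\<close> in the
  remaining factors.\<close>

lemma open_fun_contains_box:
  fixes A :: "('i \<Rightarrow> real) set"
  assumes "open A" "x \<in> A" "finite J"
  obtains e where "0 < e" "\<And>y. (\<And>j. j \<in> J \<Longrightarrow> \<bar>y j - x j\<bar> < e) \<Longrightarrow> (\<And>j. j \<notin> J \<Longrightarrow> y j = x j) \<Longrightarrow> y \<in> A"
proof -
  have "openin (product_topology (\<lambda>i. euclidean) UNIV) A" using assms by (simp add: open_fun_def)
  from product_topology_open_contains_basis[OF this \<open>x \<in> A\<close>]
  obtain X where X: "x \<in> (\<Pi>\<^sub>E i\<in>UNIV. X i)" "\<And>i. open (X i)" "(\<Pi>\<^sub>E i\<in>UNIV. X i) \<subseteq> A" by auto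
  have "\<exists>e>0. \<forall>y. \<bar>y - x j\<bar> < e \<longrightarrow> y \<in> X j" for j
    using X(1,2)[unfolded open_dist] by (auto simp: dist_real_def PiE_iff)
  then obtain e where e: "\<And>j. 0 < e j" "\<And>j y. \<bar>y - x j\<bar> < e j \<Longrightarrow> y \<in> X j" by metis
  define e0 where "e0 = Min (insert 1 (e ` J))"
  have e0: "0 < e0" "\<And>j. j \<in> J \<Longrightarrow> e0 \<le> e j"
    using \<open>finite J\<close> e(1) by (auto simp: e0_def)
  show ?thesis
  proof (rule that[OF e0(1)])
    fix y assume y: "\<And>j. j \<in> J \<Longrightarrow> \<bar>y j - x j\<bar> < e0" "\<And>j. j \<notin> J \<Longrightarrow> y j = x j"
    have "y j \<in> X j" for j
    proof (cases "j \<in> J")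
      case True
      then show ?thesis using y(1)[OF True] e0(2)[OF True] e(2)[of "y j" j] by linarith
    next
      case False
      then show ?thesis using y(2)[OF False] X(1) by (auto simp: PiE_iff)
    qed
    then show "y \<in> A" using X(3) by (auto simp: PiE_iff)
  qed
qed

lemma eventually_scaled_small:
  fixes M e :: real
  assumes "0 < e"
  shows "eventually (\<lambda>n. M / sqrt (real n) < e) sequentially" "eventually (\<lambda>n. M / real n < e) sequentially"
proof -
  have "(\<lambda>n. M / sqrt (real n)) \<longlonglongrightarrow> 0"
    by (intro tendsto_divide_0[OF tendsto_const] filterlim_at_top_imp_at_infinity
        filterlim_compose[OF sqrt_at_top filterlim_real_sequentially])
  then show "eventually (\<lambda>n. M / sqrt (real n) < e) sequentially" using assms by (rule order_tendstoD)
  have "(\<lambda>n. M / real n) \<longlonglongrightarrow> 0"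
    by (intro tendsto_divide_0[OF tendsto_const] filterlim_at_top_imp_at_infinity filterlim_real_sequentially)
  then show "eventually (\<lambda>n. M / real n < e) sequentially" using assms by (rule order_tendstoD)
qed

text \<open>For \<open>\<epsilon>\<close> and \<open>g\<close> up to 1/4 the inverse of
  \<open>(1 - \<epsilon>) (1 - g)\<close> is at most \<open>1 + 2 (\<epsilon> + g)\<close>. This
  replaces the unknown factor \<open>w\<close> by the total mass \<open>N\<close>, and
  \<open>x \<le> 1\<close> makes the relative error absolute.\<close>

lemma posterior_ratio_bound:
  fixes x w r N \<epsilon> g :: real
  assumes "0 \<le> x" "x \<le> 1" "0 \<le> \<epsilon>" "\<epsilon> \<le> 1 / 4" "0 \<le> g" "g \<le> 1 / 4" "0 < N" "0 \<le> w"
    and lower: "(1 - \<epsilon>) * (1 - g) * w \<le> N"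
  shows "((1 + \<epsilon>) * x * w + r) / N \<le> x + (4 * \<epsilon> + 2 * g) + r / N"
proof -
  have "1 \<le> (1 - \<epsilon>) * (1 - g) * (1 + 2 * (\<epsilon> + g))"
  proof -
    have "1 - (\<epsilon> + g) \<le> (1 - \<epsilon>) * (1 - g)" using assms by (simp add: algebra_simps)
    then have "(1 - (\<epsilon> + g)) * (1 + 2 * (\<epsilon> + g)) \<le> (1 - \<epsilon>) * (1 - g) * (1 + 2 * (\<epsilon> + g))"
      using assms by (intro mult_right_mono) auto
    moreover have "0 \<le> (\<epsilon> + g) * (1 - 2 * (\<epsilon> + g))" using assms by (intro mult_nonneg_nonneg) auto
    ultimately show ?thesis by (simp add: algebra_simps)
  qed
  then have "1 * w \<le> ((1 - \<epsilon>) * (1 - g) * (1 + 2 * (\<epsilon> + g))) * w"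
    using \<open>0 \<le> w\<close> by (rule mult_right_mono)
  also have "\<dots> = ((1 - \<epsilon>) * (1 - g) * w) * (1 + 2 * (\<epsilon> + g))" by (simp only: mult_ac)
  also have "\<dots> \<le> N * (1 + 2 * (\<epsilon> + g))" using lower assms by (intro mult_right_mono) auto
  finally have w: "w \<le> N * (1 + 2 * (\<epsilon> + g))" by simp
  have "(1 + \<epsilon>) * x * w \<le> (1 + \<epsilon>) * x * (N * (1 + 2 * (\<epsilon> + g)))"
    using w assms by (intro mult_left_mono) auto
  also have "\<dots> = x * N * ((1 + \<epsilon>) * (1 + 2 * (\<epsilon> + g)))" by (simp only: mult_ac)
  also have "\<dots> \<le> x * N * (1 + (4 * \<epsilon> + 2 * g))"
  proof (rule mult_left_mono)
    have "\<epsilon> * (2 * (\<epsilon> + g)) \<le> \<epsilon> * 1" using assms by (intro mult_left_mono) auto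
    then show "(1 + \<epsilon>) * (1 + 2 * (\<epsilon> + g)) \<le> 1 + (4 * \<epsilon> + 2 * g)" by (simp add: algebra_simps)
  qed (use assms in auto)
  also have "\<dots> \<le> N * (x + (4 * \<epsilon> + 2 * g))"
  proof -
    have "x * (4 * \<epsilon> + 2 * g) \<le> 1 * (4 * \<epsilon> + 2 * g)" using assms by (intro mult_right_mono) auto
    then have "x * (1 + (4 * \<epsilon> + 2 * g)) \<le> x + (4 * \<epsilon> + 2 * g)" by (simp add: algebra_simps)
    from mult_left_mono[OF this, of N] show ?thesis using assms by (simp add: mult_ac)
  qed
  finally have "(1 + \<epsilon>) * x * w / N \<le> x + (4 * \<epsilon> + 2 * g)" using \<open>0 < N\<close> by (simp add: divide_le_eq mult.commute)
  then show ?thesis by (simp add: add_divide_distrib)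
qed

context separated_change_point
begin

section \<open>The limiting Gaussian as a density, and its mass in the level box\<close>

lemma diag_gaussian_eq:
  assumes n: "1 \<le> n"
  shows "diag_gaussian k b (\<lambda>j. 1 / (seg_length k s0 j * real n)) =
    density (lebesgue_pow {1..k}) (\<lambda>a. ennreal (gauss_dens n b a))"
    "prob_space (diag_gaussian k b (\<lambda>j. 1 / (seg_length k s0 j * real n)))"
    "sets (diag_gaussian k b (\<lambda>j. 1 / (seg_length k s0 j * real n))) = sets (\<Pi>\<^sub>M j\<in>{1..k}. borel)"
proof -
  \<comment> \<open>The value 1 off the index set is a default: the product locale asks for
    sigma-finite factors at all indices.\<close>
  define \<sigma> where "\<sigma> j = (if j \<in> {1..k} then sqrt (1 / (seg_length k s0 j * real n)) else 1)" for j
  have \<sigma>: "0 < \<sigma> j" for j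
    using seg_length_bounds(1)[of j] \<delta> n by (auto simp: \<sigma>_def)
  have eq: "diag_gaussian k b (\<lambda>j. 1 / (seg_length k s0 j * real n)) =
      (\<Pi>\<^sub>M j\<in>{1..k}. density lborel (\<lambda>x. ennreal (normal_density (b j) (\<sigma> j) x)))"
    unfolding diag_gaussian_def by (intro PiM_cong) (auto simp: \<sigma>_def)
  show "prob_space (diag_gaussian k b (\<lambda>j. 1 / (seg_length k s0 j * real n)))"
    unfolding eq using \<sigma> by (intro prob_space_PiM prob_space_normal_density)
  show "sets (diag_gaussian k b (\<lambda>j. 1 / (seg_length k s0 j * real n))) = sets (\<Pi>\<^sub>M j\<in>{1..k}. borel)"
    unfolding eq by (intro sets_PiM_cong) auto
  have "(\<Pi>\<^sub>M j\<in>{1..k}. density lborel (\<lambda>x. ennreal (normal_density (b j) (\<sigma> j) x))) =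
      density (lebesgue_pow {1..k}) (\<lambda>a. \<Prod>j\<in>{1..k}. ennreal (normal_density (b j) (\<sigma> j) (a j)))"
  proof (rule PiM_density)
    show "product_sigma_finite (\<lambda>j. density lborel (\<lambda>x. ennreal (normal_density (b j) (\<sigma> j) x)))"
      using prob_space_normal_density[OF \<sigma>]
      by (auto simp: product_sigma_finite_def prob_space_def finite_measure_def)
    show "product_sigma_finite (\<lambda>_::nat. lborel :: real measure)" ..
  qed auto
  also have "(\<lambda>a. \<Prod>j\<in>{1..k}. ennreal (normal_density (b j) (\<sigma> j) (a j))) = (\<lambda>a. ennreal (gauss_dens n b a))"
    by (auto simp: gauss_dens_def prod_ennreal \<sigma>_def intro!: ext prod.cong)
  finally show "diag_gaussian k b (\<lambda>j. 1 / (seg_length k s0 j * real n)) =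
    density (lebesgue_pow {1..k}) (\<lambda>a. ennreal (gauss_dens n b a))" unfolding eq .
qed

text \<open>The mean lies within half the box radius of \<open>a0\<close>, so leaving the box moves
  some coordinate away from its mean by the other half; Chebyshev's inequality and a union bound
  finish.\<close>

lemma gauss_level_box:
  assumes n: "1 \<le> n" and M: "0 < M"
    and b: "\<And>j. j \<in> {1..k} \<Longrightarrow> \<bar>b j - a0 j\<bar> \<le> M / 2 / sqrt (real n)"
  shows "1 - 4 * real k / (\<delta> * M\<^sup>2) \<le> measure (diag_gaussian k b (\<lambda>j. 1 / (seg_length k s0 j * real n))) (level_box n M)"
proof -
  let ?\<gamma> = "diag_gaussian k b (\<lambda>j. 1 / (seg_length k s0 j * real n))"
  interpret \<gamma>: prob_space ?\<gamma> by (rule diag_gaussian_eq(2)[OF n])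
  have sets: "sets ?\<gamma> = sets (\<Pi>\<^sub>M j\<in>{1..k}. borel)" by (rule diag_gaussian_eq(3)[OF n])
  have sq: "0 < sqrt (real n)" using n by simp
  have sp: "space ?\<gamma> = space (\<Pi>\<^sub>M j\<in>{1..k}. borel)" by (rule sets_eq_imp_space_eq[OF sets])
  let ?c = "M / 2 / sqrt (real n)"
  let ?B = "\<lambda>j. {a \<in> space ?\<gamma>. a j \<in> {x. ?c < \<bar>x - b j\<bar>}}"
  have c: "0 < ?c" using M sq by simp
  have tail: "measure ?\<gamma> (?B j) \<le> 4 / (\<delta> * M\<^sup>2)" and Bs: "?B j \<in> sets ?\<gamma>" if j: "j \<in> {1..k}" for j
  proof -
    let ?v = "1 / (seg_length k s0 j * real n)"
    let ?N = "density lborel (\<lambda>x. ennreal (normal_density (b j) (sqrt ?v) x))"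
    have l: "0 < seg_length k s0 j" "\<delta> \<le> seg_length k s0 j" using seg_length_bounds(1)[OF j] \<delta> by auto
    then have v: "0 < ?v" using n by simp
    have comp: "(\<lambda>a. a j) \<in> ?\<gamma> \<rightarrow>\<^sub>M ?N"
      unfolding diag_gaussian_def by (rule measurable_component_singleton[OF j])
    have S: "{x. ?c < \<bar>x - b j\<bar>} \<in> sets ?N" by simp
    have eq: "?B j = (\<lambda>a. a j) -` {x. ?c < \<bar>x - b j\<bar>} \<inter> space ?\<gamma>" by auto
    show "?B j \<in> sets ?\<gamma>" unfolding eq by (rule measurable_sets[OF comp S])
    have "distr ?\<gamma> ?N (\<lambda>a. a j) = ?N"
      unfolding diag_gaussian_def
    proof (rule distr_PiM_component[OF _ j])
      fix i assume "i \<in> {1..k}"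
      then show "prob_space (density lborel (\<lambda>x. ennreal (normal_density (b i) (sqrt (1 / (seg_length k s0 i * real n))) x)))"
        using seg_length_bounds(1)[of i] \<delta> n by (intro prob_space_normal_density) auto
    qed
    then have "emeasure ?\<gamma> (?B j) = emeasure ?N {x. ?c < \<bar>x - b j\<bar>}"
      unfolding eq using emeasure_distr[OF comp S] by simp
    also have "\<dots> \<le> ennreal ((sqrt ?v)\<^sup>2 / ?c\<^sup>2)"
      using v c by (intro normal_tail) auto
    also have "(sqrt ?v)\<^sup>2 / ?c\<^sup>2 = 4 / (seg_length k s0 j * M\<^sup>2)"
      using v n l M by (simp add: power_divide field_simps)
    also have "\<dots> \<le> 4 / (\<delta> * M\<^sup>2)"
      using l M \<delta> by (intro divide_left_mono mult_right_mono mult_pos_pos) auto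
    finally show "measure ?\<gamma> (?B j) \<le> 4 / (\<delta> * M\<^sup>2)"
      using \<delta> by (simp add: \<gamma>.emeasure_eq_measure ennreal_leI)
  qed
  have box: "level_box n M \<in> sets ?\<gamma>"
    using sets_boxes(1)[of n M] unfolding sets by (simp cong: sets_PiM_cong)
  have "space ?\<gamma> - level_box n M \<subseteq> (\<Union>j\<in>{1..k}. ?B j)"
  proof
    fix a assume a: "a \<in> space ?\<gamma> - level_box n M"
    then have "a \<in> extensional {1..k}" unfolding sp by (auto simp: space_PiM PiE_def)
    then obtain j where j: "j \<in> {1..k}" "a j \<notin> {a0 j - M / sqrt (real n)..a0 j + M / sqrt (real n)}"
      using a by (auto simp: level_box_def PiE_iff)
    then have "M / sqrt (real n) < \<bar>a j - a0 j\<bar>" by auto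
    moreover have "M / sqrt (real n) = ?c + ?c" by simp
    ultimately have "?c < \<bar>a j - b j\<bar>" using b[OF j(1)] by linarith
    then show "a \<in> (\<Union>j\<in>{1..k}. ?B j)" using a j by auto
  qed
  then have "measure ?\<gamma> (space ?\<gamma> - level_box n M) \<le> measure ?\<gamma> (\<Union>j\<in>{1..k}. ?B j)"
    by (rule \<gamma>.finite_measure_mono) (rule sets.finite_UN[OF finite_atLeastAtMost Bs])
  also have "\<dots> \<le> (\<Sum>j\<in>{1..k}. measure ?\<gamma> (?B j))"
    by (rule \<gamma>.finite_measure_subadditive_finite[OF finite_atLeastAtMost image_subsetI[OF Bs]])
  also have "\<dots> \<le> real (card {1..k}) * (4 / (\<delta> * M\<^sup>2))"
    by (rule sum_bounded_above[OF tail])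
  finally show ?thesis using \<gamma>.prob_compl[OF box] by simp
qed

lemma location_weight_measurable [measurable]:
  "location_weight n z b \<in> borel_measurable (lebesgue_pow {1..<k})"
proof -
  have a0s: "a0 \<in> space (lebesgue_pow {1..k})"
    using a0 by (auto simp: levels_def space_PiM PiE_def)
  have tag: "(\<lambda>s. (k, a0, s)) \<in> lebesgue_pow {1..<k} \<rightarrow>\<^sub>M param_space"
    using measurable_compose[OF measurable_Pair1'[OF a0s] measurable_tag_segments[of k]] by simp
  have [measurable]: "(\<lambda>s. step_fun (k, a0, s) x) \<in> borel_measurable (lebesgue_pow {1..<k})" for x
    by (rule measurable_compose[OF tag borel_measurable_step_fun])
  have [measurable]: "(\<lambda>s. loss n z a0 s) \<in> borel_measurable (lebesgue_pow {1..<k})"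
    unfolding loss_def by measurable
  show ?thesis unfolding location_weight_def[abs_def] by measurable
qed

lemma gauss_dens_measurable [measurable]: "gauss_dens n b \<in> borel_measurable (lebesgue_pow {1..k})"
proof -
  note [measurable] = measurable_coordinate
  show ?thesis unfolding gauss_dens_def[abs_def] by measurable
qed

lemma gauss_dens_nonneg: "0 \<le> gauss_dens n b a"
  unfolding gauss_dens_def by (intro prod_nonneg) auto

lemma nn_integral_product_AS:
  assumes f: "f \<in> borel_measurable (lebesgue_pow {1..k})" and g: "g \<in> borel_measurable (lebesgue_pow {1..<k})"
  shows "(\<integral>\<^sup>+v. f (fst v) * g (snd v) \<partial>AS) = (\<integral>\<^sup>+a. f a \<partial>lebesgue_pow {1..k}) * (\<integral>\<^sup>+s. g s \<partial>lebesgue_pow {1..<k})"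
proof -
  interpret pair_sigma_finite "lebesgue_pow {1..k}" "lebesgue_pow {1..<k}"
    by (rule pair_sigma_finite_lebesgue_pow) auto
  have "(\<lambda>v. f (fst v) * g (snd v)) \<in> borel_measurable AS"
    by (intro borel_measurable_times_ennreal measurable_compose[OF measurable_fst f] measurable_compose[OF measurable_snd g])
  then have "(\<integral>\<^sup>+v. f (fst v) * g (snd v) \<partial>AS) = (\<integral>\<^sup>+a. \<integral>\<^sup>+s. f a * g s \<partial>lebesgue_pow {1..<k} \<partial>lebesgue_pow {1..k})"
    by (subst M2.nn_integral_fst[symmetric]) auto
  also have "\<dots> = (\<integral>\<^sup>+a. f a \<partial>lebesgue_pow {1..k}) * (\<integral>\<^sup>+s. g s \<partial>lebesgue_pow {1..<k})"
    using f g by (simp add: nn_integral_cmult nn_integral_multc)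
  finally show ?thesis .
qed

end

section \<open>Total variation distance to the Gaussian\<close>

text \<open>\<open>interior\<close> places the level boxes inside the support of the prior for large
  \<open>n\<close>, so that the Gaussian is not truncated. \<open>prior_continuous\<close> makes the
  level density nearly constant on the shrinking boxes; the factor \<open>\<pi>t\<close> is
  integrated out with the knots.\<close>

locale change_point_posterior = separated_change_point +
  fixes kmax :: nat and p :: "nat \<Rightarrow> real"
    and \<pi>a :: "nat \<Rightarrow> (nat \<Rightarrow> real) \<Rightarrow> (nat \<Rightarrow> real) \<Rightarrow> real" and \<pi>t :: "nat \<Rightarrow> (nat \<Rightarrow> real) \<Rightarrow> real"
  assumes kmax: "k \<in> {1..kmax}"
    and p: "\<And>k. k \<in> {1..kmax} \<Longrightarrow> 0 < p k" "(\<Sum>k\<in>{1..kmax}. p k) = 1"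
    and dens: "prior_densities K \<delta> kmax \<pi>a \<pi>t" and bounds: "assumption_A K \<delta> kmax \<pi>a \<pi>t"
    and interior: "\<And>j. j \<in> {1..k} \<Longrightarrow> \<bar>a0 j\<bar> < K"
    and prior_continuous: "continuous (at (a0, s0) within levels K k \<times> locations \<delta> k) (\<lambda>(a, s). \<pi>a k a s)"
begin

abbreviation "Q \<equiv> prior K \<delta> kmax p \<pi>a \<pi>t"

abbreviation "weight \<equiv> post_weight K \<delta> \<pi>a \<pi>t k"

section \<open>Total and tail mass of the posterior weight; the lower bound\<close>

definition total_mass :: "nat \<Rightarrow> sample \<Rightarrow> ennreal" where
  "total_mass n z = (\<integral>\<^sup>+v. weight n z v \<partial>AS)"

definition tail_mass :: "nat \<Rightarrow> real \<Rightarrow> sample \<Rightarrow> ennreal" where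
  "tail_mass n M z = (\<integral>\<^sup>+v. weight n z v * indicator (- (level_box n M \<times> knot_box n M)) v \<partial>AS)"

lemma weight_measurable [measurable]: "weight n z \<in> borel_measurable AS"
  by (rule post_weight_measurable[OF dens kmax p])

lemma prior_bounds:
  "\<exists>c C. 0 < c \<and> (\<forall>a\<in>levels K k. \<forall>s\<in>locations \<delta> k. c \<le> \<pi>a k a s \<and> \<pi>a k a s \<le> C)"
  "\<exists>c C. 0 < c \<and> (\<forall>s\<in>locations \<delta> k. c \<le> \<pi>t k s \<and> \<pi>t k s \<le> C)"
  using bounds kmax unfolding assumption_A_def by blast+

lemma prior_pos:
  assumes "a \<in> levels K k" "s \<in> locations \<delta> k"
  shows "0 < \<pi>a k a s" "0 < \<pi>t k s"
  using prior_bounds assms by fastforce+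

lemma prior_product_bounds:
  "\<exists>c C. 0 < c \<and> (\<forall>a\<in>levels K k. \<forall>s\<in>locations \<delta> k. c \<le> \<pi>a k a s * \<pi>t k s \<and> \<pi>a k a s * \<pi>t k s \<le> C)"
proof -
  obtain ca Ca where ca: "0 < ca" "\<forall>a\<in>levels K k. \<forall>s\<in>locations \<delta> k. ca \<le> \<pi>a k a s \<and> \<pi>a k a s \<le> Ca"
    using prior_bounds(1) by blast
  obtain ct Ct where ct: "0 < ct" "\<forall>s\<in>locations \<delta> k. ct \<le> \<pi>t k s \<and> \<pi>t k s \<le> Ct"
    using prior_bounds(2) by blast
  have "ca * ct \<le> \<pi>a k a s * \<pi>t k s \<and> \<pi>a k a s * \<pi>t k s \<le> Ca * Ct"
    if as: "a \<in> levels K k" "s \<in> locations \<delta> k" for a s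
    using prior_pos[OF as] ca ct as by (intro conjI mult_mono) force+
  then show ?thesis using ca(1) ct(1) by (intro exI[of _ "ca * ct"] exI[of _ "Ca * Ct"]) auto
qed

text \<open>The likelihood is at most 1, and the prior component has finite mass because it is part
  of a probability measure with weight \<open>p k > 0\<close>.\<close>

lemma total_mass_finite: "total_mass n z < \<top>"
proof -
  interpret prob_space Q by (rule prob_space_prior[OF dens p])
  let ?d = "\<lambda>(a, s). ennreal (\<pi>a k a s * \<pi>t k s) * indicator \<Theta> (a, s)"
  define X where "X = (\<integral>\<^sup>+v. ?d v \<partial>AS)"
  have "ennreal (p k) * X = (\<integral>\<^sup>+\<theta>. 1 * indicator {\<theta>. fst \<theta> = k} \<theta> \<partial>Q)"
    using nn_integral_prior_component[OF dens kmax p, of "\<lambda>_. 1"] by (simp add: X_def)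
  also have "\<dots> \<le> (\<integral>\<^sup>+\<theta>. 1 \<partial>Q)" by (intro nn_integral_mono) (auto simp: indicator_def)
  also have "\<dots> = 1" using emeasure_space_1 by simp
  finally have "ennreal (p k) * X < \<top>" using ennreal_one_less_top by (rule le_less_trans)
  then have "X < \<top>" using p(1)[OF kmax] by (auto simp: ennreal_mult_less_top)
  moreover have "total_mass n z \<le> X"
    unfolding total_mass_def X_def
  proof (rule nn_integral_mono)
    fix v :: "(nat \<Rightarrow> real) \<times> (nat \<Rightarrow> real)"
    have "ennreal (likelihood n z (k, v)) \<le> 1" using likelihood_le_1[of n z "(k, v)"] by simp
    from mult_right_mono[OF this, of "?d v"] show "weight n z v \<le> ?d v"
      by (simp add: post_weight_def split_beta)
  qed
  ultimately show ?thesis by simp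
qed

text \<open>If \<open>\<delta>\<close> were at least \<open>1 / k\<close>, the gaps to the left and
  right of the first inner knot would pin it to \<open>1 / k\<close>. The locations would then form
  a Lebesgue null set and carry no density of integral 1.\<close>

lemma gap_room:
  assumes "2 \<le> k"
  shows "\<delta> < 1 / real k"
proof (rule ccontr)
  assume "\<not> \<delta> < 1 / real k"
  then have \<delta>k: "1 / real k \<le> \<delta>" by simp
  have "s 1 = 1 / real k" if s: "s \<in> locations \<delta> k" for s
  proof -
    have low: "real j * \<delta> \<le> knot k s j" if "j \<le> k" for j
      using that
    proof (induction j)
      case (Suc j)
      then show ?case using knot_step[OF s, of "Suc j"] by (simp add: algebra_simps)
    qed simp
    have high: "real (k - j) * \<delta> \<le> 1 - knot k s j" if "j \<le> k" for j
      using that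
    proof (induction j rule: inc_induct)
      case base
      then show ?case using k by simp
    next
      case (step j)
      then have "knot k s j + \<delta> \<le> knot k s (Suc j)" using knot_step[OF s, of "Suc j"] by simp
      moreover have "real (k - j) = real (k - Suc j) + 1" using step by auto
      ultimately show ?case using step by (simp add: algebra_simps)
    qed
    have "knot k s 1 = s 1" using assms by (simp add: knot_def)
    then have "\<delta> \<le> s 1" "(real k - 1) * \<delta> \<le> 1 - s 1" using low[of 1] high[of 1] assms by (auto simp: of_nat_diff)
    moreover have "(real k - 1) * (1 / real k) \<le> (real k - 1) * \<delta>" using \<delta>k assms by (intro mult_left_mono) auto
    moreover have "(real k - 1) * (1 / real k) = 1 - 1 / real k" using assms by (simp add: field_simps)
    ultimately show ?thesis using \<delta>k by linarith
  qed
  moreover have "s \<in> extensional {1..<k}" if "s \<in> locations \<delta> k" for s using that by (simp add: locations_def)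
  ultimately have sub: "locations \<delta> k \<subseteq> {s \<in> space (lebesgue_pow {1..<k}). s 1 \<in> {1 / real k}}"
    by (auto simp: space_PiM PiE_def)
  let ?X = "\<Pi>\<^sub>E j\<in>{1..<k}. if j = 1 then {1 / real k} else (UNIV :: real set)"
  have "{s \<in> space (lebesgue_pow {1..<k}). s 1 \<in> {1 / real k}} \<subseteq> ?X"
    by (auto simp: space_PiM PiE_def Pi_iff extensional_def)
  moreover have "emeasure (lebesgue_pow {1..<k}) ?X = (\<Prod>j\<in>{1..<k}. emeasure lborel (if j = 1 then {1 / real k} else (UNIV :: real set)))"
    by (rule lborel_prod.emeasure_PiM) auto
  moreover have "\<dots> = 0"
    using assms by (intro prod_zero bexI[of _ 1]) auto
  ultimately have "?X \<in> null_sets (lebesgue_pow {1..<k})"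
    by (intro null_setsI sets_PiM_I_finite) auto
  then have "locations \<delta> k \<in> null_sets (lebesgue_pow {1..<k})"
    by (rule null_sets_subset[OF _ sets_locations]) (rule order.trans[OF sub \<open>_ \<subseteq> ?X\<close>])
  then have "AE s in lebesgue_pow {1..<k}. s \<notin> locations \<delta> k" by (rule AE_not_in)
  then have "(\<integral>\<^sup>+s\<in>locations \<delta> k. ennreal (\<pi>t k s) \<partial>lebesgue_pow {1..<k}) = (\<integral>\<^sup>+s. 0 \<partial>lebesgue_pow {1..<k})"
    by (intro nn_integral_cong_AE) auto
  then show False using dens kmax unfolding prior_densities_def by force
qed

lemma eventually_level_box_subset:
  "eventually (\<lambda>n. level_box n M \<subseteq> levels K k) sequentially"
proof -
  have "eventually (\<lambda>n. \<forall>j\<in>{1..k}. M / sqrt (real n) < K - \<bar>a0 j\<bar>) sequentially"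
    using interior by (intro eventually_ball_finite ballI eventually_scaled_small(1)) auto
  then show ?thesis
  proof eventually_elim
    case (elim n)
    show ?case
    proof
      fix a assume a: "a \<in> level_box n M"
      then have "a \<in> extensional {1..k}" by (simp add: level_box_def PiE_def)
      moreover have "a j \<in> {-K..K}" if j: "j \<in> {1..k}" for j
      proof -
        have "\<bar>a j\<bar> \<le> K" using level_boxD[OF a j] bspec[OF elim j] by linarith
        then show ?thesis by (auto simp: abs_le_iff)
      qed
      ultimately show "a \<in> levels K k" by (auto simp: levels_def PiE_iff)
    qed
  qed
qed

text \<open>A pointwise lower bound on a box, multiplied by its volume. The bound keeps the
  likelihood at the truth as a factor, and \<open>d\<close> does not depend on \<open>T\<close>,
  \<open>R\<close>, \<open>M\<close>, \<open>T'\<close> or \<open>n\<close>.\<close>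

lemma total_mass_lower_bound:
  obtains d where "0 < d"
    "\<And>T R M T' n z. good T R M T' n z \<Longrightarrow> 1 \<le> n \<Longrightarrow> 0 \<le> T \<Longrightarrow> level_box n 1 \<subseteq> levels K k \<Longrightarrow>
      ennreal (d ^ k * exp (- loss_budget T / 2) *
        (1 / sqrt (real n)) ^ k * (1 / real n) ^ (k - 1) * likelihood n z (k, a0, s0)) \<le> total_mass n z"
proof -
  obtain c where c: "0 < c"
    and cw: "\<And>a s. a \<in> levels K k \<Longrightarrow> s \<in> locations \<delta> k \<Longrightarrow> c \<le> \<pi>a k a s * \<pi>t k s"
    using prior_product_bounds by blast
  \<comment> \<open>Half of the slack in the equispaced gaps. For \<open>k = 1\<close> there are no
    knots, and 1 is a default.\<close>
  obtain \<xi> where \<xi>: "0 < \<xi>" "\<xi> \<le> 1" "2 \<le> k \<Longrightarrow> 2 * \<xi> \<le> 1 / real k - \<delta>"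
  proof (cases "2 \<le> k")
    case True
    then show ?thesis using gap_room \<delta> by (intro that[of "min 1 ((1 / real k - \<delta>) / 2)"]) (auto simp: min_def)
  qed (use that[of 1] in auto)
  \<comment> \<open>Chosen so that the plain power \<open>d ^ k\<close> stays below the product of
    the prior bound and the two volume constants.\<close>
  define d where "d = min 1 c * 2 * \<xi>"
  have d: "0 < d" using c \<xi> by (simp add: d_def)
  have dk: "d ^ k \<le> c * 2 ^ k * (2 * \<xi>) ^ (k - 1)"
  proof -
    have k': "k = Suc (k - 1)" using k by simp
    have "d ^ k = d * d ^ (k - 1)" using k' by (metis power_Suc)
    also have "\<dots> \<le> (c * 2 * 1) * (2 * (2 * \<xi>)) ^ (k - 1)"
      using c \<xi> unfolding d_def by (intro mult_mono power_mono) auto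
    also have "\<dots> = c * (2 * 2 ^ (k - 1)) * (2 * \<xi>) ^ (k - 1)"
      unfolding power_mult_distrib[of 2 "2 * \<xi>"] by (simp only: mult_1_right mult.assoc)
    also have "2 * 2 ^ (k - 1) = (2::real) ^ k" using k' by (metis power_Suc)
    finally show ?thesis .
  qed
  show ?thesis
  proof (rule that[OF d])
    fix T R M T' :: real and n z
    assume good: "good T R M T' n z" and n: "1 \<le> n" and T: "0 \<le> T" and box: "level_box n 1 \<subseteq> levels K k"
    define e where "e = exp (- loss_budget T / 2)"
    let ?L0 = "likelihood n z (k, a0, s0)"
    define U where "U = (\<Pi>\<^sub>E j\<in>{1..<k}. {s0 j + (real j / real k - s0 j) / real n - \<xi> / real n..
      s0 j + (real j / real k - s0 j) / real n + \<xi> / real n})"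
    have Us: "U \<in> sets (lebesgue_pow {1..<k})" unfolding U_def by (intro sets_PiM_I_finite) auto
    interpret pair_sigma_finite "lebesgue_pow {1..k}" "lebesgue_pow {1..<k}"
      by (rule pair_sigma_finite_lebesgue_pow) auto
    have L0: "0 \<le> ?L0" by (rule likelihood_nonneg)
    have "ennreal (d ^ k * e * (1 / sqrt (real n)) ^ k * (1 / real n) ^ (k - 1) * ?L0) \<le>
        ennreal ((c * 2 ^ k * (2 * \<xi>) ^ (k - 1)) * e * (1 / sqrt (real n)) ^ k * (1 / real n) ^ (k - 1) * ?L0)"
      using dk L0 by (intro ennreal_leI mult_right_mono) (auto simp: e_def)
    also have "(c * 2 ^ k * (2 * \<xi>) ^ (k - 1)) * e * (1 / sqrt (real n)) ^ k * (1 / real n) ^ (k - 1) * ?L0 =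
        (e * ?L0 * c) * ((2 * (1 / sqrt (real n))) ^ k * (2 * (\<xi> / real n)) ^ (k - 1))"
      by (simp add: power_mult_distrib power_divide mult_ac)
    also have "ennreal \<dots> = ennreal (e * ?L0 * c) * (ennreal ((2 * (1 / sqrt (real n))) ^ k) * ennreal ((2 * (\<xi> / real n)) ^ (k - 1)))"
      using L0 c \<xi> by (simp add: ennreal_mult e_def)
    also have "ennreal ((2 * (1 / sqrt (real n))) ^ k) = emeasure (lebesgue_pow {1..k}) (level_box n 1)"
      unfolding level_box_def by (subst emeasure_lebesgue_box) auto
    also have "ennreal ((2 * (\<xi> / real n)) ^ (k - 1)) = emeasure (lebesgue_pow {1..<k}) U"
      unfolding U_def using \<xi> by (subst emeasure_lebesgue_box) auto
    also have "emeasure (lebesgue_pow {1..k}) (level_box n 1) * emeasure (lebesgue_pow {1..<k}) U = emeasure AS (level_box n 1 \<times> U)"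
      by (rule M2.emeasure_pair_measure_Times[OF sets_boxes(1) Us, symmetric])
    also have "ennreal (e * ?L0 * c) * emeasure AS (level_box n 1 \<times> U) =
        (\<integral>\<^sup>+v. ennreal (e * ?L0 * c) * indicator (level_box n 1 \<times> U) v \<partial>AS)"
      by (rule nn_integral_cmult_indicator[OF pair_measureI[OF sets_boxes(1) Us], symmetric])
    also have "\<dots> \<le> total_mass n z"
      unfolding total_mass_def
    proof (rule nn_integral_mono)
      fix v :: "(nat \<Rightarrow> real) \<times> (nat \<Rightarrow> real)"
      show "ennreal (e * ?L0 * c) * indicator (level_box n 1 \<times> U) v \<le> weight n z v"
      proof (cases "v \<in> level_box n 1 \<times> U")
        case True
        obtain a s where v: "v = (a, s)" by (cases v)
        have a: "a \<in> level_box n 1" "a \<in> levels K k" and sU: "s \<in> U" using True box v by auto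
        have s: "s \<in> locations \<delta> k" "s \<in> knot_box n 2"
          using location_box_inside[OF n \<xi> sU[unfolded U_def]] by auto
        have "e * ?L0 \<le> likelihood n z (k, a, s)"
          unfolding e_def using level_boxD[OF a(1)] knot_boxD[OF s(2)]
          by (intro likelihood_lower_bound[OF good n T a(2) s(1)]) auto
        then have "e * ?L0 * c \<le> likelihood n z (k, a, s) * (\<pi>a k a s * \<pi>t k s)"
          using cw[OF a(2) s(1)] c L0 likelihood_nonneg by (intro mult_mono) auto
        then show ?thesis
          using True a s v likelihood_nonneg[of n z "(k, a, s)"]
          by (simp add: post_weight_def ennreal_leI flip: ennreal_mult')
      qed simp
    qed
    finally show "ennreal (d ^ k * exp (- loss_budget T / 2) *
        (1 / sqrt (real n)) ^ k * (1 / real n) ^ (k - 1) * ?L0) \<le> total_mass n z"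
      unfolding e_def .
  qed
qed

text \<open>Translates continuity in the function topology into uniform closeness on shrinking
  boxes; off the index sets the functions agree by extensionality.\<close>

lemma eventually_prior_close:
  assumes \<epsilon>: "0 < \<epsilon>"
  shows "eventually (\<lambda>n. \<forall>a\<in>levels K k \<inter> level_box n M. \<forall>s\<in>locations \<delta> k \<inter> knot_box n M.
    \<bar>\<pi>a k a s - \<pi>a k a0 s0\<bar> < \<epsilon>) sequentially"
proof -
  let ?f = "\<lambda>(a, s). \<pi>a k a s"
  have "open {\<pi>a k a0 s0 - \<epsilon><..<\<pi>a k a0 s0 + \<epsilon>}" "?f (a0, s0) \<in> {\<pi>a k a0 s0 - \<epsilon><..<\<pi>a k a0 s0 + \<epsilon>}"
    using \<epsilon> by auto
  then obtain A where A: "open A" "(a0, s0) \<in> A"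
    "\<forall>y\<in>\<Theta>. y \<in> A \<longrightarrow> ?f y \<in> {\<pi>a k a0 s0 - \<epsilon><..<\<pi>a k a0 s0 + \<epsilon>}"
    using prior_continuous unfolding continuous_within_topological by metis
  from open_prod_elim[OF A(1,2)] obtain A1 A2 where A12: "open A1" "open A2" "(a0, s0) \<in> A1 \<times> A2" "A1 \<times> A2 \<subseteq> A" .
  obtain e1 where e1: "0 < e1" "\<And>y. (\<And>j. j \<in> {1..k} \<Longrightarrow> \<bar>y j - a0 j\<bar> < e1) \<Longrightarrow> (\<And>j. j \<notin> {1..k} \<Longrightarrow> y j = a0 j) \<Longrightarrow> y \<in> A1"
    using open_fun_contains_box[OF A12(1), of a0 "{1..k}"] A12(3) by auto
  obtain e2 where e2: "0 < e2" "\<And>y. (\<And>j. j \<in> {1..<k} \<Longrightarrow> \<bar>y j - s0 j\<bar> < e2) \<Longrightarrow> (\<And>j. j \<notin> {1..<k} \<Longrightarrow> y j = s0 j) \<Longrightarrow> y \<in> A2"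
    using open_fun_contains_box[OF A12(2), of s0 "{1..<k}"] A12(3) by auto
  show ?thesis
    using eventually_scaled_small(1)[OF e1(1), of M] eventually_scaled_small(2)[OF e2(1), of M]
  proof eventually_elim
    case (elim n)
    show ?case
    proof (intro ballI)
      fix a s assume a: "a \<in> levels K k \<inter> level_box n M" and s: "s \<in> locations \<delta> k \<inter> knot_box n M"
      have "a \<in> A1"
      proof (rule e1(2))
        fix j assume "j \<in> {1..k}"
        then show "\<bar>a j - a0 j\<bar> < e1" using level_boxD[of a n M j] a elim(1) by auto
      next
        fix j assume "j \<notin> {1..k}"
        then show "a j = a0 j" using a a0 unfolding levels_def Int_iff by (metis PiE_arb)
      qed
      moreover have "s \<in> A2"
      proof (rule e2(2))
        fix j assume "j \<in> {1..<k}"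
        then show "\<bar>s j - s0 j\<bar> < e2" using knot_boxD[of s n M j] s elim(2) by auto
      next
        fix j assume j: "j \<notin> {1..<k}"
        have "s \<in> extensional {1..<k}" "s0 \<in> extensional {1..<k}" using s s0 by (auto simp: locations_def)
        then show "s j = s0 j" using j by (metis extensional_arb)
      qed
      ultimately have "(a, s) \<in> A" using A12(4) by auto
      then have "\<pi>a k a s \<in> {\<pi>a k a0 s0 - \<epsilon><..<\<pi>a k a0 s0 + \<epsilon>}" using A(3) a s by auto
      then show "\<bar>\<pi>a k a s - \<pi>a k a0 s0\<bar> < \<epsilon>" by (auto simp: abs_less_iff)
    qed
  qed
qed

end

lemma ennreal_tendsto_0I:
  fixes f :: "'i \<Rightarrow> ennreal"
  assumes "\<And>e::real. 0 < e \<Longrightarrow> eventually (\<lambda>n. f n \<le> ennreal e) F"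
  shows "(f \<longlongrightarrow> 0) F"
proof (rule order_tendstoI)
  fix a :: ennreal assume "0 < a"
  then obtain b where b: "0 < b" "b < a" using dense by blast
  then have "b < \<top>" using less_top order.strict_trans by (metis top.not_eq_extremum)
  then obtain r where r: "b = ennreal r" "0 \<le> r" by (cases b) auto
  then have "0 < r" using b by (simp add: ennreal_less_zero_iff)
  from assms[OF this] show "eventually (\<lambda>n. f n < a) F"
    by eventually_elim (use b r in \<open>auto intro: le_less_trans\<close>)
qed simp

text \<open>Merges the likelihood error \<open>exp (\<zeta> / 2)\<close> and the relative error
  \<open>\<epsilon> / 4\<close> of the prior into one factor \<open>1 + \<epsilon>\<close> or
  \<open>1 - \<epsilon>\<close>.\<close>

lemma exp_quarter_bounds:
  fixes \<epsilon> \<zeta> x y :: real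
  assumes "0 < \<epsilon>" "\<epsilon> \<le> 1 / 4" "\<zeta> \<le> \<epsilon> / 2" "0 < y" "\<bar>x - y\<bar> \<le> \<epsilon> / 4 * y"
  shows "exp (\<zeta> / 2) * x \<le> (1 + \<epsilon>) * y" "(1 - \<epsilon>) * y \<le> exp (- \<zeta> / 2) * x"
proof -
  have x: "x \<le> (1 + \<epsilon> / 4) * y" "(1 - \<epsilon> / 4) * y \<le> x" using assms(5) unfolding left_diff_distrib distrib_right by linarith+
  moreover have "0 \<le> (1 - \<epsilon> / 4) * y" using assms by (intro mult_nonneg_nonneg) auto
  ultimately have x0: "0 \<le> x" by linarith
  have "exp (\<epsilon> / 4) \<le> 1 + \<epsilon> / 4 + (\<epsilon> / 4)\<^sup>2" using assms by (intro exp_bound) auto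
  also have "(\<epsilon> / 4)\<^sup>2 \<le> \<epsilon> / 4" using assms by (simp add: power2_eq_square)
  finally have "exp (\<epsilon> / 4) \<le> 1 + \<epsilon> / 2" by simp
  moreover have "exp (\<zeta> / 2) \<le> exp (\<epsilon> / 4)" using assms by simp
  ultimately have "exp (\<zeta> / 2) \<le> 1 + \<epsilon> / 2" by linarith
  then have "exp (\<zeta> / 2) * x \<le> (1 + \<epsilon> / 2) * ((1 + \<epsilon> / 4) * y)"
    using x x0 assms by (intro mult_mono) auto
  also have "\<dots> = ((1 + \<epsilon> / 2) * (1 + \<epsilon> / 4)) * y" by simp
  also have "\<dots> \<le> (1 + \<epsilon>) * y"
  proof (rule mult_right_mono)
    have "\<epsilon> * \<epsilon> \<le> \<epsilon> * 1" using assms by (intro mult_left_mono) auto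
    moreover have "(1 + \<epsilon> / 2) * (1 + \<epsilon> / 4) = 1 + 3 / 4 * \<epsilon> + \<epsilon> * \<epsilon> / 8" by (simp add: algebra_simps)
    ultimately show "(1 + \<epsilon> / 2) * (1 + \<epsilon> / 4) \<le> 1 + \<epsilon>" using assms by linarith
  qed (use assms in simp)
  finally show "exp (\<zeta> / 2) * x \<le> (1 + \<epsilon>) * y" .
  have "1 - \<epsilon> / 4 \<le> exp (- \<zeta> / 2)" using exp_ge_add_one_self[of "- \<zeta> / 2"] assms by simp
  then have "(1 - \<epsilon> / 4) * ((1 - \<epsilon> / 4) * y) \<le> exp (- \<zeta> / 2) * x"
    using x assms by (intro mult_mono) auto
  moreover have "(1 - \<epsilon>) * y \<le> (1 - \<epsilon> / 4) * ((1 - \<epsilon> / 4) * y)"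
  proof -
    have "1 - \<epsilon> \<le> (1 - \<epsilon> / 4) * (1 - \<epsilon> / 4)" using assms by (simp add: algebra_simps)
    from mult_right_mono[OF this, of y] show ?thesis using assms by (simp add: mult.assoc)
  qed
  ultimately show "(1 - \<epsilon>) * y \<le> exp (- \<zeta> / 2) * x" by linarith
qed

context change_point_posterior
begin

lemma tail_mass_le_total_mass: "tail_mass n M z \<le> total_mass n z"
  unfolding tail_mass_def total_mass_def by (intro nn_integral_mono) (auto simp: indicator_def)

lemma weight_eq:
  assumes "a \<in> levels K k" "s \<in> locations \<delta> k"
  shows "weight n z (a, s) = ennreal (likelihood n z (k, a, s) * (\<pi>a k a s * \<pi>t k s))"
  using assms likelihood_nonneg[of n z "(k, a, s)"] by (simp add: post_weight_def ennreal_mult')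

text \<open>The mass of \<open>E\<close> is at most
  \<open>(1 + \<epsilon>) * \<gamma>(E) * w\<close> plus the tail, and the total mass is at least
  \<open>(1 - \<epsilon>) * \<gamma>(box) * w\<close>. The integral \<open>w\<close> over the knots
  is the same in both and cancels, whatever its size. The Gaussian mass of the box is at least
  \<open>1 - \<epsilon>\<close>, hence \<open>4 * \<epsilon> + 2 * \<epsilon>\<close>.\<close>

lemma tv_dist_bound:
  fixes \<epsilon> M T R T' :: real and n :: nat
  defines "\<zeta> \<equiv> (4 + 8 * K) * (M / sqrt (real n)) * T' + T * sqrt (real n) * (real k * ((M + 2 * T / \<delta>) / sqrt (real n))\<^sup>2)"
  defines "\<gamma> b \<equiv> diag_gaussian k b (\<lambda>j. 1 / (seg_length k s0 j * real n))"
  assumes good: "good T R M T' n z" and n: "1 \<le> n" and T: "0 < T" and T': "0 \<le> T'"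
    and M: "0 < M" "4 * T / \<delta> \<le> M" "4 * real k / (\<delta> * M\<^sup>2) \<le> \<epsilon>"
    and nT: "2 * T / \<delta> \<le> sqrt (real n)"
    and mle: "is_level_mle k s0 n z b"
    and box: "level_box n M \<subseteq> levels K k"
    and close: "\<And>a s. a \<in> levels K k \<inter> level_box n M \<Longrightarrow> s \<in> locations \<delta> k \<inter> knot_box n M \<Longrightarrow>
      \<bar>\<pi>a k a s - \<pi>a k a0 s0\<bar> \<le> \<epsilon> / 4 * \<pi>a k a0 s0"
    and \<zeta>: "\<zeta> \<le> \<epsilon> / 2" and \<epsilon>: "0 < \<epsilon>" "\<epsilon> \<le> 1 / 4"
    and pos: "0 < total_mass n z"
  shows "ennreal (tv_dist (level_posterior Q k n z) (\<gamma> b)) \<le> ennreal (6 * \<epsilon>) + tail_mass n M z / total_mass n z"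
proof -
  note gauss = diag_gaussian_eq[OF n, of b, folded \<gamma>_def]
  interpret \<gamma>: prob_space "\<gamma> b" by (rule gauss(2))
  let ?P = "level_posterior Q k n z"
  let ?f = "\<pi>a k a0 s0"
  have f: "0 < ?f" by (rule prior_pos[OF a0 s0])
  have setsP: "sets ?P = sets (\<Pi>\<^sub>M j\<in>{1..k}. borel)" by (rule sets_level_posterior[OF dens kmax p])
  have lebs: "sets (lebesgue_pow {1..k}) = sets (\<Pi>\<^sub>M j\<in>{1..k}. borel)" by (intro sets_PiM_cong) auto
  have spAS: "fst v \<in> space (\<Pi>\<^sub>M j\<in>{1..k}. borel)" if "v \<in> space AS" for v
    using that by (auto simp: space_pair_measure space_PiM)
  let ?D = "locations \<delta> k \<inter> knot_box n M"
  \<comment> \<open>Everything in the local weight that depends on \<open>s\<close>, with the level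
    prior frozen at the truth.\<close>
  define W where "W s = ennreal (location_weight n z b s * (\<pi>t k s * ?f)) * indicator ?D s" for s
  have \<pi>t[measurable]: "\<pi>t k \<in> borel_measurable (lebesgue_pow {1..<k})"
    using dens kmax unfolding prior_densities_def by blast
  have W[measurable]: "W \<in> borel_measurable (lebesgue_pow {1..<k})"
    unfolding W_def[abs_def] by measurable
  define w where "w = (\<integral>\<^sup>+s. W s \<partial>lebesgue_pow {1..<k})"
  define N where "N E = (\<integral>\<^sup>+v. weight n z v * indicator E (fst v) \<partial>AS)" for E
  have gE: "emeasure (\<gamma> b) E = (\<integral>\<^sup>+a. ennreal (gauss_dens n b a) * indicator E a \<partial>lebesgue_pow {1..k})"
    if "E \<in> sets (\<Pi>\<^sub>M j\<in>{1..k}. borel)" for E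
    unfolding gauss(1)
  proof (rule emeasure_density)
    show "E \<in> sets (lebesgue_pow {1..k})" using that unfolding lebs .
  qed measurable
  have gm: "(\<lambda>a. ennreal (gauss_dens n b a) * indicator E a) \<in> borel_measurable (lebesgue_pow {1..k})"
    if "E \<in> sets (\<Pi>\<^sub>M j\<in>{1..k}. borel)" for E
    using that unfolding lebs[symmetric] by measurable
  have local: "ennreal ((1 - \<epsilon>) * (gauss_dens n b a * (location_weight n z b s * (\<pi>t k s * ?f)))) \<le> weight n z (a, s)"
    "weight n z (a, s) \<le> ennreal ((1 + \<epsilon>) * (gauss_dens n b a * (location_weight n z b s * (\<pi>t k s * ?f))))"
    if a: "a \<in> level_box n M" and s: "s \<in> ?D" for a s
  proof -
    have a': "a \<in> levels K k" and s': "s \<in> locations \<delta> k" "s \<in> knot_box n M" using a s box by auto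
    let ?g = "gauss_dens n b a * location_weight n z b s"
    let ?L = "likelihood n z (k, a, s)"
    have g0: "0 \<le> ?g" using gauss_dens_nonneg location_weight_nonneg[OF n] by simp
    have L: "exp (- \<zeta> / 2) * ?g \<le> ?L" "?L \<le> exp (\<zeta> / 2) * ?g"
      unfolding \<zeta>_def using level_boxD[OF a] knot_boxD[OF s'(2)] M(1)
      by (intro likelihood_local[OF good n T _ T' nT mle a' s'(1)]; simp)+
    have p0: "0 < \<pi>a k a s" "0 < \<pi>t k s" using prior_pos[OF a' s'(1)] by auto
    note q = exp_quarter_bounds[OF \<epsilon> \<zeta> f close[of a s]]
    have q1: "exp (\<zeta> / 2) * \<pi>a k a s \<le> (1 + \<epsilon>) * ?f" and q2: "(1 - \<epsilon>) * ?f \<le> exp (- \<zeta> / 2) * \<pi>a k a s"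
      using q a a' s by auto
    have "(1 - \<epsilon>) * (gauss_dens n b a * (location_weight n z b s * (\<pi>t k s * ?f))) = ?g * \<pi>t k s * ((1 - \<epsilon>) * ?f)"
      by (simp only: mult_ac)
    also have "\<dots> \<le> ?g * \<pi>t k s * (exp (- \<zeta> / 2) * \<pi>a k a s)"
      using g0 p0 by (intro mult_left_mono q2) auto
    also have "\<dots> = (exp (- \<zeta> / 2) * ?g) * (\<pi>a k a s * \<pi>t k s)" by (simp only: mult_ac)
    also have "\<dots> \<le> ?L * (\<pi>a k a s * \<pi>t k s)" using p0 by (intro mult_right_mono L) auto
    finally show "ennreal ((1 - \<epsilon>) * (gauss_dens n b a * (location_weight n z b s * (\<pi>t k s * ?f)))) \<le> weight n z (a, s)"
      unfolding weight_eq[OF a' s'(1)] by (rule ennreal_leI)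
    have "?L * (\<pi>a k a s * \<pi>t k s) \<le> (exp (\<zeta> / 2) * ?g) * (\<pi>a k a s * \<pi>t k s)"
      using p0 by (intro mult_right_mono L) auto
    also have "\<dots> = ?g * \<pi>t k s * (exp (\<zeta> / 2) * \<pi>a k a s)" by (simp only: mult_ac)
    also have "\<dots> \<le> ?g * \<pi>t k s * ((1 + \<epsilon>) * ?f)"
      using g0 p0 by (intro mult_left_mono q1) auto
    also have "\<dots> = (1 + \<epsilon>) * (gauss_dens n b a * (location_weight n z b s * (\<pi>t k s * ?f)))" by (simp only: mult_ac)
    finally show "weight n z (a, s) \<le> ennreal ((1 + \<epsilon>) * (gauss_dens n b a * (location_weight n z b s * (\<pi>t k s * ?f))))"
      unfolding weight_eq[OF a' s'(1)] by (rule ennreal_leI)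
  qed
  have nonneg: "0 \<le> location_weight n z b s * (\<pi>t k s * ?f)" if "s \<in> ?D" for s
    using that prior_pos[OF a0, of s] f location_weight_nonneg[OF n] by auto
  have upper: "N E \<le> ennreal (1 + \<epsilon>) * emeasure (\<gamma> b) E * w + tail_mass n M z"
    if E: "E \<in> sets (\<Pi>\<^sub>M j\<in>{1..k}. borel)" for E
  proof -
    let ?G = "\<lambda>a. ennreal (gauss_dens n b a) * indicator E a"
    let ?A = "level_box n M \<times> knot_box n M"
    have A: "- ?A \<inter> space AS \<in> sets AS"
    proof -
      have "space AS - ?A \<in> sets AS" by measurable
      then show ?thesis by (simp add: Diff_eq Int_commute)
    qed
    have m1: "(\<lambda>v. ennreal (1 + \<epsilon>) * ?G (fst v) * W (snd v)) \<in> borel_measurable AS"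
      by (intro borel_measurable_times_ennreal borel_measurable_const
          measurable_compose[OF measurable_fst gm[OF E]] measurable_compose[OF measurable_snd W])
    have m2: "(\<lambda>v. weight n z v * indicator (- ?A) v) \<in> borel_measurable AS"
    proof (rule measurable_cong[THEN iffD1])
      show "(\<lambda>v. weight n z v * indicator (- ?A \<inter> space AS) v) \<in> borel_measurable AS"
        by (intro borel_measurable_times_ennreal borel_measurable_indicator weight_measurable A)
    qed (auto simp: indicator_def)
    have "N E \<le> (\<integral>\<^sup>+v. ennreal (1 + \<epsilon>) * ?G (fst v) * W (snd v) + weight n z v * indicator (- ?A) v \<partial>AS)"
      unfolding N_def
    proof (rule nn_integral_mono)
      fix v :: "(nat \<Rightarrow> real) \<times> (nat \<Rightarrow> real)"
      obtain a s where v: "v = (a, s)" by (cases v)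
      show "weight n z v * indicator E (fst v) \<le>
          ennreal (1 + \<epsilon>) * ?G (fst v) * W (snd v) + weight n z v * indicator (- ?A) v"
      proof (cases "v \<in> ?A")
        case True
        show ?thesis
        proof (cases "v \<in> \<Theta>")
          case in\<Theta>: True
          have as: "a \<in> level_box n M" "s \<in> ?D" using True in\<Theta> v by auto
          have "ennreal ((1 + \<epsilon>) * (gauss_dens n b a * (location_weight n z b s * (\<pi>t k s * ?f)))) =
              ennreal (1 + \<epsilon>) * ennreal (gauss_dens n b a) * W s"
            using as \<epsilon> nonneg[OF as(2)] gauss_dens_nonneg[of n b a]
            by (simp add: W_def ennreal_mult mult.assoc)
          then have "weight n z (a, s) \<le> ennreal (1 + \<epsilon>) * ennreal (gauss_dens n b a) * W s"
            using local(2)[OF as] by simp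
          then show ?thesis using True v by (auto simp: indicator_def)
        qed (auto simp: post_weight_def v)
      qed (auto simp: indicator_def)
    qed
    also have "\<dots> = (\<integral>\<^sup>+v. ennreal (1 + \<epsilon>) * ?G (fst v) * W (snd v) \<partial>AS) + tail_mass n M z"
      unfolding tail_mass_def by (rule nn_integral_add[OF m1 m2])
    also have "(\<integral>\<^sup>+v. ennreal (1 + \<epsilon>) * ?G (fst v) * W (snd v) \<partial>AS) = (\<integral>\<^sup>+a. ennreal (1 + \<epsilon>) * ?G a \<partial>lebesgue_pow {1..k}) * w"
      unfolding w_def by (rule nn_integral_product_AS[OF borel_measurable_times_ennreal[OF borel_measurable_const gm[OF E]] W])
    also have "(\<integral>\<^sup>+a. ennreal (1 + \<epsilon>) * ?G a \<partial>lebesgue_pow {1..k}) = ennreal (1 + \<epsilon>) * emeasure (\<gamma> b) E"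
      unfolding gE[OF E] by (rule nn_integral_cmult[OF gm[OF E]])
    finally show ?thesis .
  qed
  have boxE: "level_box n M \<in> sets (\<Pi>\<^sub>M j\<in>{1..k}. borel)"
    using sets_boxes(1)[of n M] unfolding lebs .
  have lower: "ennreal (1 - \<epsilon>) * emeasure (\<gamma> b) (level_box n M) * w \<le> total_mass n z"
  proof -
    let ?G = "\<lambda>a. ennreal (gauss_dens n b a) * indicator (level_box n M) a"
    have "ennreal (1 - \<epsilon>) * emeasure (\<gamma> b) (level_box n M) = (\<integral>\<^sup>+a. ennreal (1 - \<epsilon>) * ?G a \<partial>lebesgue_pow {1..k})"
      unfolding gE[OF boxE] by (rule nn_integral_cmult[OF gm[OF boxE], symmetric])
    also have "\<dots> * w = (\<integral>\<^sup>+v. ennreal (1 - \<epsilon>) * ?G (fst v) * W (snd v) \<partial>AS)"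
      unfolding w_def by (rule nn_integral_product_AS[OF borel_measurable_times_ennreal[OF borel_measurable_const gm[OF boxE]] W, symmetric])
    also have "\<dots> \<le> total_mass n z"
      unfolding total_mass_def
    proof (rule nn_integral_mono)
      fix v :: "(nat \<Rightarrow> real) \<times> (nat \<Rightarrow> real)"
      obtain a s where v: "v = (a, s)" by (cases v)
      show "ennreal (1 - \<epsilon>) * ?G (fst v) * W (snd v) \<le> weight n z v"
      proof (cases "a \<in> level_box n M \<and> s \<in> ?D")
        case True
        then have as: "a \<in> level_box n M" "s \<in> ?D" by auto
        have "ennreal ((1 - \<epsilon>) * (gauss_dens n b a * (location_weight n z b s * (\<pi>t k s * ?f)))) =
            ennreal (1 - \<epsilon>) * ennreal (gauss_dens n b a) * W s"
          using as \<epsilon> nonneg[OF as(2)] gauss_dens_nonneg[of n b a]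
          by (simp add: W_def ennreal_mult mult.assoc)
        then show ?thesis using local(1)[OF as] as by (simp add: v)
      next
        case False
        then have "?G a = 0 \<or> W s = 0" by (auto simp: W_def)
        then have "ennreal (1 - \<epsilon>) * ?G a * W s = 0" by (elim disjE) (simp_all only: mult_zero_left mult_zero_right)
        then show ?thesis unfolding v fst_conv snd_conv by (simp only: zero_le)
      qed
    qed
    finally show ?thesis .
  qed
  have gbox: "1 - \<epsilon> \<le> measure (\<gamma> b) (level_box n M)"
  proof -
    have "\<bar>b j - a0 j\<bar> \<le> M / 2 / sqrt (real n)" if "j \<in> {1..k}" for j
    proof -
      have "\<bar>b j - a0 j\<bar> \<le> 2 * T / \<delta> / sqrt (real n)"
        using mle_near(2)[OF good n _ nT T mle that] T by simp
      also have "\<dots> \<le> M / 2 / sqrt (real n)" using M(2) by (intro divide_right_mono) auto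
      finally show ?thesis .
    qed
    from gauss_level_box[OF n M(1) this] show ?thesis using M(3) unfolding \<gamma>_def by linarith
  qed
  \<comment> \<open>Finiteness of \<open>w\<close> is read off the lower bound: a positive multiple
    of it is below the finite total mass.\<close>
  have "ennreal (1 - \<epsilon>) * emeasure (\<gamma> b) (level_box n M) * w < \<top>"
    using lower total_mass_finite by (rule le_less_trans)
  moreover have "0 < ennreal (1 - \<epsilon>) * emeasure (\<gamma> b) (level_box n M)"
    using gbox \<epsilon> by (auto simp: \<gamma>.emeasure_eq_measure ennreal_zero_less_mult_iff)
  ultimately have "w < \<top>" by (auto simp: ennreal_mult_less_top)
  then obtain wr where wr: "w = ennreal wr" "0 \<le> wr" by (cases w) auto
  obtain Nr where Nr: "total_mass n z = ennreal Nr" "0 < Nr"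
    using total_mass_finite[of n z] pos by (cases "total_mass n z") (auto simp: ennreal_less_zero_iff)
  have "tail_mass n M z < \<top>" using tail_mass_le_total_mass total_mass_finite by (rule le_less_trans)
  then obtain r where r: "tail_mass n M z = ennreal r" "0 \<le> r" by (cases "tail_mass n M z") auto
  have lower': "(1 - \<epsilon>) * (1 - \<epsilon>) * wr \<le> Nr"
  proof -
    have "ennreal ((1 - \<epsilon>) * measure (\<gamma> b) (level_box n M) * wr) \<le> ennreal Nr"
      using lower \<epsilon> wr unfolding Nr(1) wr(1) \<gamma>.emeasure_eq_measure by (simp add: ennreal_mult)
    then have "(1 - \<epsilon>) * measure (\<gamma> b) (level_box n M) * wr \<le> Nr" using Nr by simp
    moreover have "(1 - \<epsilon>) * (1 - \<epsilon>) * wr \<le> (1 - \<epsilon>) * measure (\<gamma> b) (level_box n M) * wr"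
      using gbox \<epsilon> wr by (intro mult_right_mono mult_left_mono) auto
    ultimately show ?thesis by linarith
  qed
  have post: "emeasure ?P E = N E / total_mass n z" if "E \<in> sets (\<Pi>\<^sub>M j\<in>{1..k}. borel)" for E
    using emeasure_level_posterior[OF dens kmax p that, of n z] pos unfolding N_def total_mass_def by simp
  have probP: "prob_space ?P"
  proof (rule prob_spaceI)
    have sp: "space ?P = space (\<Pi>\<^sub>M j\<in>{1..k}. borel)" by (rule sets_eq_imp_space_eq[OF setsP])
    have "N (space ?P) = total_mass n z"
      unfolding N_def total_mass_def sp using spAS by (intro nn_integral_cong) auto
    then show "emeasure ?P (space ?P) = 1"
      using post[of "space ?P"] pos total_mass_finite[of n z] unfolding sp by auto
  qed
  interpret P: prob_space ?P by (rule probP)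
  have "tv_dist ?P (\<gamma> b) \<le> 6 * \<epsilon> + r / Nr"
  proof (rule tv_dist_le[OF probP gauss(2)])
    show "sets ?P = sets (\<gamma> b)" using setsP gauss(3) by simp
    fix E assume "E \<in> sets ?P"
    then have E: "E \<in> sets (\<Pi>\<^sub>M j\<in>{1..k}. borel)" using setsP by simp
    let ?x = "measure (\<gamma> b) E"
    have "ennreal (measure ?P E) = N E / ennreal Nr"
      using post[OF E] unfolding P.emeasure_eq_measure Nr(1) .
    also have "\<dots> \<le> (ennreal (1 + \<epsilon>) * emeasure (\<gamma> b) E * w + tail_mass n M z) / ennreal Nr"
      by (rule divide_right_mono_ennreal[OF upper[OF E]])
    also have "\<dots> = ennreal (((1 + \<epsilon>) * ?x * wr + r) / Nr)"
      unfolding \<gamma>.emeasure_eq_measure wr(1) r(1) using \<epsilon> wr r Nr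
      by (simp add: divide_ennreal ennreal_plus ennreal_mult flip: ennreal_plus ennreal_mult)
    finally have "measure ?P E \<le> ((1 + \<epsilon>) * ?x * wr + r) / Nr"
      using \<epsilon> wr r Nr by (subst (asm) ennreal_le_iff) auto
    also have "\<dots> \<le> ?x + (4 * \<epsilon> + 2 * \<epsilon>) + r / Nr"
      using \<epsilon> wr Nr lower' by (intro posterior_ratio_bound) auto
    finally show "measure ?P E \<le> ?x + (6 * \<epsilon> + r / Nr)" by simp
  qed
  then have "ennreal (tv_dist ?P (\<gamma> b)) \<le> ennreal (6 * \<epsilon> + r / Nr)" by (rule ennreal_leI)
  also have "\<dots> = ennreal (6 * \<epsilon>) + tail_mass n M z / total_mass n z"
    using \<epsilon> r Nr by (simp add: divide_ennreal)
  finally show ?thesis .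
qed

end

section \<open>Expected posterior mass outside the boxes, and the limit\<close>

lemma exp_minus_le:
  fixes A \<epsilon> T :: real
  assumes "0 < \<epsilon>" "A - ln \<epsilon> \<le> T"
  shows "exp (A - T) \<le> \<epsilon>"
proof -
  have "exp (A - T) \<le> exp (ln \<epsilon>)" using assms(2) by simp
  then show ?thesis using assms(1) by simp
qed

lemma ennreal_inverse_antimono:
  fixes a b :: ennreal
  assumes "a \<le> b"
  shows "inverse b \<le> inverse a"
proof (cases "a = 0 \<or> b = \<top>")
  case False
  with assms obtain x y where "a = ennreal x" "b = ennreal y" "0 < x" "x \<le> y"
    by (cases a; cases b) (auto simp: top_unique)
  then show ?thesis by (simp add: inverse_ennreal le_imp_inverse_le)
qed auto

context change_point_posterior
begin

text \<open>\<open>h\<close> divides the likelihood mass outside the boxes by the lower bound for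
  the total mass. Integrated against the density \<open>L0\<close> of the true law,
  \<open>L0\<close> cancels. The powers of \<open>n\<close> in the lower bound and in the expected
  tail mass are equal, so the resulting bound is free of \<open>n\<close>.\<close>

lemma expected_tail_ratio:
  assumes c: "0 < c" and C: "0 < C" and d: "0 < d" and Cu: "0 < Cu" and M: "1 \<le> M" and n: "1 \<le> n"
    and pass: "\<And>a s. a \<in> levels K k \<Longrightarrow> s \<in> locations \<delta> k \<Longrightarrow>
      pass_prob T R n a s \<le> C * exp (- (c * (real n * sq_dist a s)))"
    and upper: "\<And>a s. a \<in> levels K k \<Longrightarrow> s \<in> locations \<delta> k \<Longrightarrow> \<pi>a k a s * \<pi>t k s \<le> Cu"
    and lower: "\<And>z. good T R M T' n z \<Longrightarrow>
      ennreal (d * (1 / sqrt (real n)) ^ k * (1 / real n) ^ (k - 1) * likelihood n z (k, a0, s0)) \<le> total_mass n z"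
  obtains h where "h \<in> borel_measurable (sample_space n)"
    "\<And>z. good T R M T' n z \<Longrightarrow> tail_mass n M z / total_mass n z \<le> h z"
    "(\<integral>\<^sup>+z. h z \<partial>product_law n f0) \<le> ennreal (Cu * C / d * (4 / c) ^ (k - 1) * sqrt (2 * pi / c) ^ k * exp (- (c * M / 2)))"
proof -
  let ?T = "\<Theta> - level_box n M \<times> knot_box n M"
  let ?B = "\<Pi>\<^sub>M i\<in>{1..n}. (lborel :: (real \<times> real) measure)"
  define \<kappa>n where "\<kappa>n = d * (1 / sqrt (real n)) ^ k * (1 / real n) ^ (k - 1)"
  have \<kappa>n: "0 < \<kappa>n" using d n by (simp add: \<kappa>n_def)
  define L0 where "L0 z = likelihood n z (k, a0, s0)" for z
  define R' where "R' z = (\<integral>\<^sup>+v. ennreal (likelihood n z (k, v)) * indicator ?T v \<partial>AS)" for z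
  define I where "I z = (indicator {z. good T R M T' n z} z :: ennreal)" for z
  define h where "h z = ennreal Cu * (R' z * I z) / ennreal (\<kappa>n * L0 z)" for z
  interpret A: pair_sigma_finite "lebesgue_pow {1..k}" "lebesgue_pow {1..<k}"
    by (rule pair_sigma_finite_lebesgue_pow) auto
  have sT: "?T \<in> sets AS" by measurable
  have Lj: "(\<lambda>u. likelihood n (fst u) (k, snd u)) \<in> borel_measurable (sample_space n \<Otimes>\<^sub>M AS)"
    using likelihood_jointly_measurable[of n k] by (simp add: split_beta)
  have "(\<lambda>u. ennreal (likelihood n (fst u) (k, snd u)) * indicator ?T (snd u)) \<in> borel_measurable (sample_space n \<Otimes>\<^sub>M AS)"
    by (intro borel_measurable_times_ennreal measurable_compose[OF Lj measurable_ennreal]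
        measurable_compose[OF measurable_snd borel_measurable_indicator[OF sT]])
  from A.borel_measurable_nn_integral_fst[OF this] have R'm[measurable]: "R' \<in> borel_measurable (sample_space n)"
    unfolding R'_def[abs_def] by simp
  have Im[measurable]: "I \<in> borel_measurable (sample_space n)"
  proof -
    have "(\<lambda>z. indicator {z \<in> space (sample_space n). good T R M T' n z} z :: ennreal) \<in> borel_measurable (sample_space n)"
      by measurable
    then show ?thesis by (rule measurable_cong[THEN iffD1, rotated]) (auto simp: indicator_def I_def)
  qed
  have L0m[measurable]: "L0 \<in> borel_measurable (sample_space n)"
  proof -
    have "(a0, s0) \<in> space AS"
      using a0 s0 by (auto simp: space_pair_measure space_PiM levels_def locations_def PiE_def)
    from measurable_compose[OF measurable_Pair2'[OF this] Lj] show ?thesis by (simp add: L0_def[abs_def])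
  qed
  have hm: "h \<in> borel_measurable (sample_space n)"
    unfolding h_def[abs_def] by measurable
  have L0pos: "0 < L0 z" if "good T R M T' n z" for z
    unfolding L0_def likelihood_eq[OF goodD(1)[OF that]] by simp
  have ratio: "tail_mass n M z / total_mass n z \<le> h z" if g: "good T R M T' n z" for z
  proof -
    have "tail_mass n M z \<le> (\<integral>\<^sup>+v. ennreal Cu * (ennreal (likelihood n z (k, v)) * indicator ?T v) \<partial>AS)"
      unfolding tail_mass_def
    proof (rule nn_integral_mono)
      fix v :: "(nat \<Rightarrow> real) \<times> (nat \<Rightarrow> real)"
      obtain a s where v: "v = (a, s)" by (cases v)
      show "weight n z v * indicator (- (level_box n M \<times> knot_box n M)) v \<le> ennreal Cu * (ennreal (likelihood n z (k, v)) * indicator ?T v)"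
      proof (cases "v \<in> ?T")
        case True
        then have as: "a \<in> levels K k" "s \<in> locations \<delta> k" by (auto simp: v)
        have "likelihood n z (k, a, s) * (\<pi>a k a s * \<pi>t k s) \<le> Cu * likelihood n z (k, a, s)"
          using mult_left_mono[OF upper[OF as] likelihood_nonneg] by (simp add: mult.commute)
        then have "weight n z v \<le> ennreal Cu * ennreal (likelihood n z (k, v))"
          unfolding v weight_eq[OF as] using Cu by (simp add: ennreal_leI flip: ennreal_mult')
        then show ?thesis using True by (simp add: indicator_def)
      next
        case False
        then have "weight n z v * indicator (- (level_box n M \<times> knot_box n M)) v = 0"
          by (auto simp: post_weight_def v indicator_def)
        then show ?thesis by (simp only: zero_le)
      qed
    qed
    also have "\<dots> = ennreal Cu * R' z"
      unfolding R'_def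
    proof (rule nn_integral_cmult)
      have "(\<lambda>v. ennreal (likelihood n z (k, v))) \<in> borel_measurable AS"
        using measurable_compose[OF measurable_tag_segments[of k] borel_measurable_likelihood[of n z]] by (simp add: split_beta)
      then show "(\<lambda>v. ennreal (likelihood n z (k, v)) * indicator ?T v) \<in> borel_measurable AS"
        by (intro borel_measurable_times_ennreal borel_measurable_indicator sT)
    qed
    finally have t: "tail_mass n M z \<le> ennreal Cu * (R' z * I z)" using g by (simp add: I_def)
    have l: "ennreal (\<kappa>n * L0 z) \<le> total_mass n z" using lower[OF g] by (simp add: \<kappa>n_def L0_def)
    have "0 < ennreal (\<kappa>n * L0 z)" using \<kappa>n L0pos[OF g] by simp
    have "tail_mass n M z / total_mass n z \<le> tail_mass n M z / ennreal (\<kappa>n * L0 z)"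
      unfolding divide_ennreal_def using l by (intro mult_left_mono) (simp_all add: ennreal_inverse_antimono)
    also have "\<dots> \<le> h z" unfolding h_def by (rule divide_right_mono_ennreal[OF t])
    finally show ?thesis .
  qed
  have setsB: "sets ?B = sets (sample_space n)" by (rule sets_sample_lborel)
  have mB: "f \<in> borel_measurable (sample_space n) \<Longrightarrow> f \<in> borel_measurable ?B" for f :: "sample \<Rightarrow> ennreal"
    using measurable_cong_sets[OF setsB refl] by auto
  have "(\<integral>\<^sup>+z. h z \<partial>product_law n f0) = (\<integral>\<^sup>+z. ennreal (L0 z) * h z \<partial>?B)"
  proof -
    have "product_law n f0 = density ?B (\<lambda>z. ennreal (L0 z))"
      unfolding L0_def likelihood_def by (rule product_law_eq_density) measurable
    then show ?thesis
      by (simp only:) (rule nn_integral_density[OF mB mB[OF hm]], measurable)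
  qed
  also have "\<dots> \<le> (\<integral>\<^sup>+z. ennreal (Cu / \<kappa>n) * (R' z * I z) \<partial>?B)"
  proof (rule nn_integral_mono)
    fix z
    show "ennreal (L0 z) * h z \<le> ennreal (Cu / \<kappa>n) * (R' z * I z)"
    proof (cases "good T R M T' n z")
      case True
      note L = L0pos[OF True]
      have "ennreal (L0 z) * h z = (ennreal (L0 z) / ennreal (\<kappa>n * L0 z)) * (ennreal Cu * (R' z * I z))"
        unfolding h_def divide_ennreal_def by (simp only: mult_ac)
      also have "\<dots> = (ennreal (1 / \<kappa>n) * ennreal Cu) * (R' z * I z)"
        using L \<kappa>n by (simp add: divide_ennreal mult.assoc)
      also have "ennreal (1 / \<kappa>n) * ennreal Cu = ennreal (Cu / \<kappa>n)"
        using \<kappa>n Cu by (simp flip: ennreal_mult)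
      finally show ?thesis by simp
    next
      case False
      then have "I z = 0" by (simp add: I_def)
      then show ?thesis by (simp add: h_def)
    qed
  qed
  also have "\<dots> = ennreal (Cu / \<kappa>n) * (\<integral>\<^sup>+z. R' z * I z \<partial>?B)"
    by (rule nn_integral_cmult[OF mB]) measurable
  also have "\<dots> \<le> ennreal (Cu / \<kappa>n) * ennreal (C * exp (- (c * M / 2)) * ((4 / (c * real n)) ^ (k - 1) * sqrt (2 * pi / (c * real n)) ^ k))"
    unfolding R'_def I_def by (intro mult_left_mono expected_tail_mass[OF c C M n pass]) auto
  also have "\<dots> = ennreal (Cu / \<kappa>n * (C * exp (- (c * M / 2)) * ((4 / (c * real n)) ^ (k - 1) * sqrt (2 * pi / (c * real n)) ^ k)))"
    using Cu \<kappa>n C c by (intro ennreal_mult[symmetric]) auto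
  also have "Cu / \<kappa>n * (C * exp (- (c * M / 2)) * ((4 / (c * real n)) ^ (k - 1) * sqrt (2 * pi / (c * real n)) ^ k)) =
      Cu * C / d * (4 / c) ^ (k - 1) * sqrt (2 * pi / c) ^ k * exp (- (c * M / 2))"
  proof -
    have 1: "(4 / (c * real n)) ^ (k - 1) = (4 / c) ^ (k - 1) * (1 / real n) ^ (k - 1)"
      by (simp add: power_mult_distrib[symmetric])
    have 2: "sqrt (2 * pi / (c * real n)) ^ k = sqrt (2 * pi / c) ^ k * (1 / sqrt (real n)) ^ k"
      unfolding power_mult_distrib[symmetric] by (simp add: real_sqrt_divide real_sqrt_mult)
    have "(1 / real n) ^ (k - 1) \<noteq> 0" "(1 / sqrt (real n)) ^ k \<noteq> 0" using n by auto
    then show ?thesis unfolding 1 2 \<kappa>n_def using d n by (simp add: field_simps)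
  qed
  finally have "(\<integral>\<^sup>+z. h z \<partial>product_law n f0) \<le>
      ennreal (Cu * C / d * (4 / c) ^ (k - 1) * sqrt (2 * pi / c) ^ k * exp (- (c * M / 2)))" .
  with hm ratio show ?thesis by (rule that)
qed

text \<open>The budget of \<open>11 * \<epsilon>\<close> consists of 4 for the bad event, 6 for the
  comparison on the good event and 1 for the expected tail ratio.\<close>

theorem level_posterior_tendsto_gaussian:
  assumes mle: "\<And>n z. z \<in> space (sample_space n) \<Longrightarrow> is_level_mle k s0 n z (ahat n z)"
  shows "(\<lambda>n. \<integral>\<^sup>+z. ennreal (tv_dist (level_posterior Q k n z)
    (diag_gaussian k (ahat n z) (\<lambda>j. 1 / (seg_length k s0 j * real n)))) \<partial>product_law n f0) \<longlonglongrightarrow> 0"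
proof (rule ennreal_tendsto_0I)
  fix e :: real assume e: "0 < e"
  define \<epsilon> where "\<epsilon> = min (1 / 4) (e / 11)"
  have \<epsilon>: "0 < \<epsilon>" "\<epsilon> \<le> 1 / 4" "11 * \<epsilon> \<le> e" using e by (auto simp: \<epsilon>_def)
  have kpos: "0 < real k" using k by simp
  \<comment> \<open>Solves for the two terms of \<open>prob_not_good\<close> that depend on
    \<open>T\<close> alone; the minimum 1 secures positivity.\<close>
  define T where "T = max 1 (max (1 - ln (\<epsilon> / (6 * real k))) (8 * real k * exp (3 / 2) - ln \<epsilon>))"
  have T: "1 \<le> T" by (simp add: T_def)
  have T1: "6 * real k * exp (1 - T) \<le> \<epsilon>"
  proof -
    have "exp (1 - T) \<le> \<epsilon> / (6 * real k)" using \<epsilon> kpos by (intro exp_minus_le) (auto simp: T_def)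
    then show ?thesis using kpos by (simp add: field_simps)
  qed
  have T2: "exp (8 * real k * exp (3 / 2) - T) \<le> \<epsilon>" using \<epsilon> by (intro exp_minus_le) (auto simp: T_def)
  define R where "R = 32 * real k / (\<beta>\<^sup>2 * \<epsilon>)"
  have R: "0 < R" using kpos \<beta>_pos \<epsilon> by (simp add: R_def)
  have R1: "32 * real k / (\<beta>\<^sup>2 * R) = \<epsilon>" using kpos \<beta>_pos \<epsilon> by (simp add: R_def)
  obtain c where c: "0 < c" and cC: "\<And>T R. 0 \<le> T \<Longrightarrow> 0 \<le> R \<Longrightarrow> \<exists>C>0. \<forall>n a s. R \<le> real n * \<eta> \<longrightarrow> a \<in> levels K k \<longrightarrow> s \<in> locations \<delta> k \<longrightarrow>
      pass_prob T R n a s \<le> C * exp (- (c * (real n * sq_dist a s)))"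
    using pass_prob_bound by blast
  obtain C where C: "0 < C" and pass: "\<And>n a s. R \<le> real n * \<eta> \<Longrightarrow> a \<in> levels K k \<Longrightarrow> s \<in> locations \<delta> k \<Longrightarrow>
      pass_prob T R n a s \<le> C * exp (- (c * (real n * sq_dist a s)))"
    using cC[of T R] T R by force
  obtain Cl Cu where Cl: "0 < Cl" and Cu: "\<And>a s. a \<in> levels K k \<Longrightarrow> s \<in> locations \<delta> k \<Longrightarrow> Cl \<le> \<pi>a k a s * \<pi>t k s \<and> \<pi>a k a s * \<pi>t k s \<le> Cu"
    using prior_product_bounds by blast
  have Cu0: "0 < Cu" using Cl Cu[OF a0 s0] by linarith
  obtain d0 where d0: "0 < d0" and lower: "\<And>T R M T' n z. good T R M T' n z \<Longrightarrow> 1 \<le> n \<Longrightarrow> 0 \<le> T \<Longrightarrow> level_box n 1 \<subseteq> levels K k \<Longrightarrow>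
      ennreal (d0 ^ k * exp (- loss_budget T / 2) *
        (1 / sqrt (real n)) ^ k * (1 / real n) ^ (k - 1) * likelihood n z (k, a0, s0)) \<le> total_mass n z"
    using total_mass_lower_bound by blast
  define d where "d = d0 ^ k * exp (- loss_budget T / 2)"
  have d: "0 < d" using d0 by (simp add: d_def)
  define D where "D = Cu * C / d * (4 / c) ^ (k - 1) * sqrt (2 * pi / c) ^ k"
  have D: "0 < D" using Cu0 C d c by (simp add: D_def)
  \<comment> \<open>In order: the range of \<open>not_in_boxes\<close>, the estimator within half
    the box, Gaussian mass at most \<open>\<epsilon>\<close> outside (through
    \<open>M \<le> M\<^sup>2\<close>), and expected tail ratio at most
    \<open>\<epsilon>\<close>.\<close>
  define M where "M = max (max 1 (4 * T / \<delta>)) (max (4 * real k / (\<delta> * \<epsilon>)) (2 / c * (0 - ln (\<epsilon> / D))))"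
  have M: "1 \<le> M" "4 * T / \<delta> \<le> M" "4 * real k / (\<delta> * \<epsilon>) \<le> M" "2 / c * (0 - ln (\<epsilon> / D)) \<le> M"
    unfolding M_def by auto
  have M1: "D * exp (- (c * M / 2)) \<le> \<epsilon>"
  proof -
    have "0 - ln (\<epsilon> / D) \<le> c * M / 2" using M(4) c by (simp add: field_simps)
    then have "exp (0 - c * M / 2) \<le> \<epsilon> / D" using \<epsilon> D by (intro exp_minus_le) auto
    then show ?thesis using D by (simp add: field_simps)
  qed
  have M2: "4 * real k / (\<delta> * M\<^sup>2) \<le> \<epsilon>"
  proof -
    have "4 * real k \<le> M * (\<delta> * \<epsilon>)" using M(3) \<delta> \<epsilon> by (simp add: pos_divide_le_eq)
    also have "\<dots> \<le> M\<^sup>2 * (\<delta> * \<epsilon>)"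
      using M(1) \<delta> \<epsilon> by (intro mult_right_mono) (auto simp: power2_eq_square)
    finally show ?thesis using M(1) \<delta> by (subst pos_divide_le_eq) (auto simp: mult_ac)
  qed
  \<comment> \<open>Chosen after \<open>M\<close>, since the noise near the knots grows with the
    radius; it affects only terms that vanish with \<open>n\<close>.\<close>
  define T' where "T' = max 0 (4 * real k * exp (3 / 2) * M - ln \<epsilon>)"
  have T': "0 \<le> T'" "exp (4 * real k * exp (3 / 2) * M - T') \<le> \<epsilon>"
    using \<epsilon> by (auto simp: T'_def intro!: exp_minus_le)
  \<comment> \<open>\<open>\<zeta>\<close> equals \<open>B / sqrt n\<close>.\<close>
  define B where "B = (4 + 8 * K) * M * T' + T * (real k * (M + 2 * T / \<delta>)\<^sup>2)"
  have f: "0 < \<pi>a k a0 s0" by (rule prior_pos[OF a0 s0])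
  have close: "eventually (\<lambda>n. \<forall>a\<in>levels K k \<inter> level_box n M. \<forall>s\<in>locations \<delta> k \<inter> knot_box n M.
      \<bar>\<pi>a k a s - \<pi>a k a0 s0\<bar> < \<epsilon> / 4 * \<pi>a k a0 s0) sequentially"
    using \<epsilon> f by (intro eventually_prior_close) auto
  have sq: "eventually (\<lambda>n. 2 * T / \<delta> / sqrt (real n) < 1) sequentially"
    by (rule eventually_scaled_small(1)) simp
  have lin: "eventually (\<lambda>n. R / \<eta> / real n < 1) sequentially"
    by (rule eventually_scaled_small(2)) simp
  have small: "eventually (\<lambda>n. B / sqrt (real n) < \<epsilon> / 2) sequentially"
    using \<epsilon> by (intro eventually_scaled_small(1)) simp
  show "eventually (\<lambda>n. (\<integral>\<^sup>+z. ennreal (tv_dist (level_posterior Q k n z)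
    (diag_gaussian k (ahat n z) (\<lambda>j. 1 / (seg_length k s0 j * real n)))) \<partial>product_law n f0) \<le> ennreal e) sequentially"
    using eventually_ge_at_top[of 1] sq lin small close eventually_level_box_subset[of 1] eventually_level_box_subset[of M]
  proof eventually_elim
    case (elim n)
    note n = elim(1)
    have n0: "0 < real n" "0 < sqrt (real n)" using n by auto
    have nT: "2 * T / \<delta> \<le> sqrt (real n)" using elim(2) unfolding pos_divide_less_eq[OF n0(2)] by simp
    have Rn: "R \<le> real n * \<eta>" using elim(3) unfolding pos_divide_less_eq[OF n0(1)] pos_divide_less_eq[OF \<eta>_pos] by simp
    have \<zeta>: "(4 + 8 * K) * (M / sqrt (real n)) * T' + T * sqrt (real n) * (real k * ((M + 2 * T / \<delta>) / sqrt (real n))\<^sup>2) \<le> \<epsilon> / 2"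
    proof -
      have "sqrt (real n) * ((M + 2 * T / \<delta>) / sqrt (real n))\<^sup>2 = (M + 2 * T / \<delta>)\<^sup>2 / sqrt (real n)"
      proof -
        have "r * (x / r)\<^sup>2 = x\<^sup>2 / r" if "0 < r" for r x :: real
          using that by (simp add: power2_eq_square)
        from this[OF n0(2)] show ?thesis .
      qed
      then have "T * sqrt (real n) * (real k * ((M + 2 * T / \<delta>) / sqrt (real n))\<^sup>2) = T * (real k * (M + 2 * T / \<delta>)\<^sup>2) / sqrt (real n)"
        by (simp add: mult.assoc mult.left_commute[of "sqrt (real n)"])
      then have "(4 + 8 * K) * (M / sqrt (real n)) * T' + T * sqrt (real n) * (real k * ((M + 2 * T / \<delta>) / sqrt (real n))\<^sup>2) = B / sqrt (real n)"
        by (simp add: B_def add_divide_distrib)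
      then show ?thesis using elim(4) by simp
    qed
    have lower': "ennreal (d * (1 / sqrt (real n)) ^ k * (1 / real n) ^ (k - 1) * likelihood n z (k, a0, s0)) \<le> total_mass n z"
      if "good T R M T' n z" for z
      unfolding d_def using lower[OF that n _ elim(6)] T by simp
    obtain h where h[measurable]: "h \<in> borel_measurable (sample_space n)"
      and h1: "\<And>z. good T R M T' n z \<Longrightarrow> tail_mass n M z / total_mass n z \<le> h z"
      and h2: "(\<integral>\<^sup>+z. h z \<partial>product_law n f0) \<le> ennreal (Cu * C / d * (4 / c) ^ (k - 1) * sqrt (2 * pi / c) ^ k * exp (- (c * M / 2)))"
      using expected_tail_ratio[OF c C d Cu0 M(1) n pass[OF Rn] _ lower'] Cu by blast
    let ?bad = "{z \<in> space (sample_space n). \<not> good T R M T' n z}"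
    let ?tv = "\<lambda>z. tv_dist (level_posterior Q k n z) (diag_gaussian k (ahat n z) (\<lambda>j. 1 / (seg_length k s0 j * real n)))"
    interpret P: prob_space "product_law n f0" by (rule prob_space_product_law) measurable
    have bad: "?bad \<in> sets (sample_space n)" by measurable
    \<comment> \<open>A measurable majorant for every sample: monotonicity of the integral then
      applies without measurability of the distance itself. On the bad event the indicator covers
      the trivial bound 1.\<close>
    have le: "ennreal (?tv z) \<le> indicator ?bad z + (ennreal (6 * \<epsilon>) + h z)" if z: "z \<in> space (sample_space n)" for z
    proof (cases "good T R M T' n z")
      case True
      have "0 < likelihood n z (k, a0, s0)" unfolding likelihood_eq[OF goodD(1)[OF True]] by simp
      then have "0 < ennreal (d * (1 / sqrt (real n)) ^ k * (1 / real n) ^ (k - 1) * likelihood n z (k, a0, s0))"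
        using d n0 by simp
      then have pos: "0 < total_mass n z" using lower'[OF True] by (rule less_le_trans)
      have "ennreal (?tv z) \<le> ennreal (6 * \<epsilon>) + tail_mass n M z / total_mass n z"
        using T T' M M2 nT mle[OF z] elim(5,7) \<zeta> \<epsilon> pos
        by (intro tv_dist_bound[OF True n]) (auto intro: less_imp_le)
      also have "\<dots> \<le> ennreal (6 * \<epsilon>) + h z" by (intro add_left_mono h1 True)
      also have "\<dots> \<le> indicator ?bad z + (ennreal (6 * \<epsilon>) + h z)" by simp
      finally show ?thesis .
    next
      case False
      interpret G: prob_space "diag_gaussian k (ahat n z) (\<lambda>j. 1 / (seg_length k s0 j * real n))"
        by (rule diag_gaussian_eq(2)[OF n])
      have "?tv z \<le> 1"
        by (intro tv_dist_le_1 measure_level_posterior_le_1[OF dens kmax p] G.prob_le_1)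
      then have "ennreal (?tv z) \<le> indicator ?bad z" using False z by simp
      also have "\<dots> \<le> indicator ?bad z + (ennreal (6 * \<epsilon>) + h z)" by simp
      finally show ?thesis .
    qed
    have mP: "f \<in> borel_measurable (sample_space n) \<Longrightarrow> f \<in> borel_measurable (product_law n f0)" for f :: "sample \<Rightarrow> ennreal"
      using measurable_cong_sets[OF sets_product_law refl] by auto
    have "(\<integral>\<^sup>+z. ennreal (?tv z) \<partial>product_law n f0) \<le> (\<integral>\<^sup>+z. indicator ?bad z + (ennreal (6 * \<epsilon>) + h z) \<partial>product_law n f0)"
      by (rule nn_integral_mono) (rule le, simp only: space_product_law)
    also have "\<dots> = (\<integral>\<^sup>+z. indicator ?bad z \<partial>product_law n f0) + ((\<integral>\<^sup>+z. ennreal (6 * \<epsilon>) \<partial>product_law n f0) + (\<integral>\<^sup>+z. h z \<partial>product_law n f0))"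
      using bad by (subst nn_integral_add nn_integral_add[OF _ mP[OF h]], (intro mP borel_measurable_indicator; measurable)+)+ simp
    also have "(\<integral>\<^sup>+z. indicator ?bad z \<partial>product_law n f0) = emeasure (product_law n f0) ?bad"
      using bad by (intro nn_integral_indicator) (simp only: sets_product_law)
    also have "(\<integral>\<^sup>+z. ennreal (6 * \<epsilon>) \<partial>product_law n f0) = ennreal (6 * \<epsilon>)"
      using P.emeasure_space_1 by (simp only: nn_integral_const mult_1_right)
    also have "emeasure (product_law n f0) ?bad + (ennreal (6 * \<epsilon>) + (\<integral>\<^sup>+z. h z \<partial>product_law n f0)) \<le>
        ennreal (4 * \<epsilon>) + (ennreal (6 * \<epsilon>) + ennreal \<epsilon>)"
    proof (intro add_mono order.refl)
      have "emeasure (product_law n f0) ?bad \<le> ennreal (6 * real k * exp (1 - T) + exp (8 * real k * exp (3 / 2) - T)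
        + exp (4 * real k * exp (3 / 2) * M - T') + 32 * real k / (\<beta>\<^sup>2 * R))"
        using T R M by (intro prob_not_good[OF n]) auto
      also have "\<dots> \<le> ennreal (\<epsilon> + \<epsilon> + \<epsilon> + \<epsilon>)"
        by (intro ennreal_leI add_mono T1 T2 T'(2) eq_refl[OF R1])
      also have "\<epsilon> + \<epsilon> + \<epsilon> + \<epsilon> = 4 * \<epsilon>" by simp
      finally show "emeasure (product_law n f0) ?bad \<le> ennreal (4 * \<epsilon>)" .
      show "(\<integral>\<^sup>+z. h z \<partial>product_law n f0) \<le> ennreal \<epsilon>"
        using h2 M1 unfolding D_def[symmetric] by (meson ennreal_leI order.trans)
    qed
    also have "\<dots> = ennreal (11 * \<epsilon>)" using \<epsilon> by (simp flip: ennreal_plus)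
    also have "\<dots> \<le> ennreal e" using \<epsilon>(3) by (rule ennreal_leI)
    finally show ?case .
  qed
qed

end

theorem theorem4:
  fixes kmax k0 :: nat and K \<delta> :: real
    and a0 s0 p :: "nat \<Rightarrow> real"
    and \<pi>a :: "nat \<Rightarrow> (nat \<Rightarrow> real) \<Rightarrow> (nat \<Rightarrow> real) \<Rightarrow> real"
    and \<pi>t :: "nat \<Rightarrow> (nat \<Rightarrow> real) \<Rightarrow> real"
    and ahat :: "nat \<Rightarrow> sample \<Rightarrow> nat \<Rightarrow> real"
  assumes "kmax \<ge> 1" and "K > 0" and "\<delta> > 0"
    and "k0 \<in> {1..kmax}" and "a0 \<in> levels K k0" and "s0 \<in> locations \<delta> k0"
    and "\<And>j. j \<in> {2..k0} \<Longrightarrow> a0 j \<noteq> a0 (j - 1)"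
    and "\<And>k. k \<in> {1..kmax} \<Longrightarrow> p k > 0" and "(\<Sum>k\<in>{1..kmax}. p k) = 1"
    and "prior_densities K \<delta> kmax \<pi>a \<pi>t"
    and "assumption_A K \<delta> kmax \<pi>a \<pi>t"
    and interior: "\<And>j. j \<in> {1..k0} \<Longrightarrow> \<bar>a0 j\<bar> < K"
    and prior_continuous:
      "continuous (at (a0, s0) within levels K k0 \<times> locations \<delta> k0) (\<lambda>(a, s). \<pi>a k0 a s)"
    and "\<And>n. ahat n \<in> (\<Pi>\<^sub>M i\<in>{1..n}. borel) \<rightarrow>\<^sub>M (\<Pi>\<^sub>M j\<in>{1..k0}. borel)"
    and "\<And>n z. z \<in> space (\<Pi>\<^sub>M i\<in>{1..n}. borel) \<Longrightarrow> is_level_mle k0 s0 n z (ahat n z)"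
  shows "(\<lambda>n. \<integral>\<^sup>+z. ennreal (tv_dist
             (level_posterior (prior K \<delta> kmax p \<pi>a \<pi>t) k0 n z)
             (diag_gaussian k0 (ahat n z) (\<lambda>j. 1 / (seg_length k0 s0 j * real n))))
           \<partial>sample_law n (k0, a0, s0)) \<longlonglongrightarrow> 0"
proof -
  \<comment> \<open>The smallest jump; inserting 1 keeps the minimum defined when there is a single
    segment and provides the cap.\<close>
  define \<kappa> where "\<kappa> = Min (insert 1 ((\<lambda>j. \<bar>a0 (Suc j) - a0 j\<bar>) ` {1..<k0}))"
  have jump: "0 < \<bar>a0 (Suc j) - a0 j\<bar>" if "j \<in> {1..<k0}" for j
    using assms(7)[of "Suc j"] that by auto
  have "\<kappa> \<in> insert 1 ((\<lambda>j. \<bar>a0 (Suc j) - a0 j\<bar>) ` {1..<k0})"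
    unfolding \<kappa>_def by (rule Min_in) auto
  then have \<kappa>_pos: "0 < \<kappa>" using jump by auto
  have \<kappa>_le: "\<kappa> \<le> 1" unfolding \<kappa>_def by (rule Min_le) auto
  have \<kappa>: "\<kappa> \<le> \<bar>a0 (Suc j) - a0 j\<bar>" if "j \<in> {1..<k0}" for j
    unfolding \<kappa>_def by (rule Min_le) (use that in auto)
  interpret change_point_posterior k0 K \<delta> a0 s0 \<kappa> kmax p \<pi>a \<pi>t
    by unfold_locales (use assms \<kappa> \<kappa>_pos \<kappa>_le in auto)
  show ?thesis
    unfolding sample_law_def using assms(15) by (rule level_posterior_tendsto_gaussian)
qed

end
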